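(* The functor $G:\mathbf{LNFrm}\to \mathbf{Sh}(\mathsf{Sp}_f)^{\mathrm{op}}$ is left adjoint to the functor $H:\mathbf{Sh}(\mathsf{Sp}_f)^{\mathrm{op}}\to\mathbf{LNFrm}$. That is, for left-handed noncommutative frames $A$ and objects $(Y,\mathcal{E})$ of $\mathbf{Sh}(\mathsf{Sp}_f)$ there is a bijection, natural in $A$ and $(Y,\mathcal{E})$, between morphisms of noncommutative frames $A\to H(Y,\mathcal{E})$ and morphisms $(Y,\mathcal{E})\to G(A)$ in $\mathbf{Sh}(\mathsf{Sp}_f)$.
   Context: **Skew lattices.** A skew lattice is a set $A$ with idempotent associative operations $\wedge,\vee$ satisfying $x\wedge(x\vee y)=x=x\vee(x\wedge y)$ and $(x\wedge y)\vee y=y=(x\vee y)\wedge y$. Natural partial order: $a\le b$ iff $a\wedge b=b\wedge a=a$. Green's relation: $a\,\mathcal{D}\,b$ iff $a\wedge b\wedge a=a$ and $b\wedge a\wedge b=b$; it is a congruence, $A/\mathcal{D}$ is a lattice (the commutative shadow of $A$), and $[a]$ denotes the class of $a$. $A$ is left-handed if $x\wedge y\wedge x=x\wedge y$ holds identically; strongly distributive if $(x\vee y)\wedge z=(x\wedge z)\vee(y\wedge z)$ and $x\wedge(y\vee z)=(x\wedge y)\vee(x\wedge z)$ hold identically. A skew lattice with $0$ has a distinguished element $0$ with $x\vee 0=x=0\vee x$ for all $x$. A commuting subset is a nonempty subset $\{x_i\}_{i\in I}$ with $x_i\wedge x_j=x_j\wedge x_i$ and $x_i\vee x_j=x_j\vee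 x_i$ for all $i,j$. $A$ is join complete if all commuting subsets have suprema for the natural partial order. **Noncommutative frames.** A noncommutative frame is a strongly distributive, join complete skew lattice $A$ with $0$ such that $(\bigvee_i x_i)\wedge y=\bigvee_i(x_i\wedge y)$ and $x\wedge(\bigvee_i y_i)=\bigvee_i(x\wedge y_i)$ for all $x,y\in A$ and all commuting subsets $\{x_i\},\{y_i\}$. It has a maximal $\mathcal{D}$-class, and $A/\mathcal{D}$ is a frame. A morphism of noncommutative frames is a map preserving $\wedge$, $\vee$, $0$, and suprema of commuting subsets, and sending elements of the maximal $\mathcal{D}$-class to elements of the maximal $\mathcal{D}$-class. $\mathbf{LNFrm}$ is the category of left-handed noncommutative frames. **The category $\mathbf{Sh}(\mathsf{Sp}_f)$.** For a topological space $Y$, $Y_f$ is the set $Y$ with the front topology, which has as basis the locally closed subsets (intersections of an open and a closed subset) of $Y$. Objects of $\mathbf{Sh}(\mathsf{Sp}_f)$ are pairs $(Y,\mathcal{E})$ with $Y$ a topological space and $\mathcal{E}$ a sheaf of sets on $Y_f$ with $\mathcal{E}(Y_f)\ne\varnothing$. Morphisms $(Y,\mathcal{E})\to(Y',\mathcal{E}')$ are pairs $(f,\lambda)$ with $f:Y\to Y'$ continuous (hence also continuous as a map $Y_f\to Y'_f$) and $\lambda:\mathcal{E}'\to f_*\mathcal{E}$ a morphism of sheaves on $Y'_f$. **The functor $H$.** $H(Y,\mathcal{E})$ is the set of pairs $(U,s)$ with $U\subseteq Y$ open in the original topology of $Y$ and $s\in\mathcal{E}(U)$, with $(U,s)\wedge(V,t)=(U\cap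 V,s|_{U\cap V})$ and $(U,s)\vee(V,t)=(U\cup V,\,s|_{U-V}\cup t)$, where $s|_{U-V}\cup t$ is the unique section over $U\cup V$ restricting to $s|_{U-V}$ on $U-V$ and to $t$ on $V$. It is a left-handed noncommutative frame. For $(f,\lambda):(Y,\mathcal{E})\to(Y',\mathcal{E}')$, $H(f,\lambda):H(Y',\mathcal{E}')\to H(Y,\mathcal{E})$ sends $(U,s)$ to $(f^{-1}(U),\lambda(s))$. **The functor $G$.** For $A$ in $\mathbf{LNFrm}$, $G(A)=(Y_A,\mathcal{E}_A)$. Here $Y_A=\mathrm{pt}(A/\mathcal{D})$ is the set of frame homomorphisms $p:A/\mathcal{D}\to\mathbf{2}=\{0,1\}$, with open sets $U_a=\{p: p(a)=1\}$, $a\in A$ (where $p(a):=p([a])$). For $p\in Y_A$ and $a,b\in A$ with $p(a)=p(b)=1$, put $a\sim_p b$ iff there are $c,d\in A$ with $p(c)=0$, $p(d)=1$ and $(a\wedge d)\vee c=(b\wedge d)\vee c$; this is an equivalence relation. Let $E_A=\{(p,[a]_{\sim_p}): p\in Y_A, a\in A, p(a)=1\}$, $\pi_A(p,[a]_{\sim_p})=p$, and $s_a:U_a\to E_A$, $s_a(p)=(p,[a]_{\sim_p})$. Give $E_A$ the topology generated by the sets $s_a(Z)$ with $a\in A$ and $Z\subseteq U_a$ locally closed in $Y_A$. Then $\mathcal{E}_A$ is the sheaf on $(Y_A)_f$ of continuous sections of $\pi_A:E_A\to (Y_A)_f$. For $\varphi:A\to A'$ in $\mathbf{LNFrm}$,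 $G(\varphi):G(A')\to G(A)$ is $(f,\lambda)$ with $f(p)=p\circ\varphi$ and $\lambda:\mathcal{E}_A\to f_*\mathcal{E}_{A'}$ the sheaf morphism determined by $\lambda(s_a)=s_{\varphi(a)}$ for all $a\in A$ (every section of $\mathcal{E}_A$ is locally of the form $s_a$). *)

theory Defs
  imports "HOL-Algebra.Order" "HOL-Analysis.Abstract_Topology"
begin

section \<open>Skew lattices and noncommutative frames\<close>

record 'a skew = "'a partial_object" +
  smeet :: "'a \<Rightarrow> 'a \<Rightarrow> 'a" (infixl \<open>\<curlywedge>\<index>\<close> 70)
  sjoin :: "'a \<Rightarrow> 'a \<Rightarrow> 'a" (infixl \<open>\<curlyvee>\<index>\<close> 65)
  szero :: "'a" (\<open>\<zero>\<index>\<close>)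

locale skew_lattice =
  fixes A :: "'a skew" (structure)
  assumes meet_closed: "\<lbrakk>x \<in> carrier A; y \<in> carrier A\<rbrakk> \<Longrightarrow> x \<curlywedge> y \<in> carrier A"
    and join_closed: "\<lbrakk>x \<in> carrier A; y \<in> carrier A\<rbrakk> \<Longrightarrow> x \<curlyvee> y \<in> carrier A"
    and meet_idem: "x \<in> carrier A \<Longrightarrow> x \<curlywedge> x = x"
    and join_idem: "x \<in> carrier A \<Longrightarrow> x \<curlyvee> x = x"
    and meet_assoc: "\<lbrakk>x \<in> carrier A; y \<in> carrier A; z \<in> carrier A\<rbrakk> \<Longrightarrow> (x \<curlywedge> y) \<curlywedge> z = x \<curlywedge> (y \<curlywedge> z)"
    and join_assoc: "\<lbrakk>x \<in> carrier A; y \<in> carrier A; z \<in> carrier A\<rbrakk> \<Longrightarrow> (x \<curlyvee> y) \<curlyvee> z = x \<curlyvee> (y \<curlyvee> z)"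
    and absorb1: "\<lbrakk>x \<in> carrier A; y \<in> carrier A\<rbrakk> \<Longrightarrow> x \<curlywedge> (x \<curlyvee> y) = x"
    and absorb2: "\<lbrakk>x \<in> carrier A; y \<in> carrier A\<rbrakk> \<Longrightarrow> x \<curlyvee> (x \<curlywedge> y) = x"
    and absorb3: "\<lbrakk>x \<in> carrier A; y \<in> carrier A\<rbrakk> \<Longrightarrow> (x \<curlywedge> y) \<curlyvee> y = y"
    and absorb4: "\<lbrakk>x \<in> carrier A; y \<in> carrier A\<rbrakk> \<Longrightarrow> (x \<curlyvee> y) \<curlywedge> y = y"

locale skew_lattice_zero = skew_lattice +
  assumes zero_closed: "\<zero> \<in> carrier A"
    and zero_right: "x \<in> carrier A \<Longrightarrow> x \<curlyvee> \<zero> = x"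
    and zero_left: "x \<in> carrier A \<Longrightarrow> \<zero> \<curlyvee> x = x"

locale strongly_distributive_skew_lattice = skew_lattice +
  assumes join_meet_distrib:
      "\<lbrakk>x \<in> carrier A; y \<in> carrier A; z \<in> carrier A\<rbrakk> \<Longrightarrow> (x \<curlyvee> y) \<curlywedge> z = (x \<curlywedge> z) \<curlyvee> (y \<curlywedge> z)"
    and meet_join_distrib:
      "\<lbrakk>x \<in> carrier A; y \<in> carrier A; z \<in> carrier A\<rbrakk> \<Longrightarrow> x \<curlywedge> (y \<curlyvee> z) = (x \<curlywedge> y) \<curlyvee> (x \<curlywedge> z)"

definition nat_order :: "'a skew \<Rightarrow> 'a gorder" where
  "nat_order A = \<lparr>carrier = carrier A, eq = (=),
     le = (\<lambda>a b. a \<curlywedge>\<^bsub>A\<^esub> b = a \<and> b \<curlywedge>\<^bsub>A\<^esub> a = a)\<rparr>"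

definition is_supremum :: "'a skew \<Rightarrow> 'a \<Rightarrow> 'a set \<Rightarrow> bool" where
  "is_supremum A s S \<longleftrightarrow> least (nat_order A) s (Upper (nat_order A) S)"

definition commuting_subset :: "'a skew \<Rightarrow> 'a set \<Rightarrow> bool" where
  "commuting_subset A S \<longleftrightarrow> S \<subseteq> carrier A \<and> S \<noteq> {} \<and>
     (\<forall>x\<in>S. \<forall>y\<in>S. x \<curlywedge>\<^bsub>A\<^esub> y = y \<curlywedge>\<^bsub>A\<^esub> x \<and> x \<curlyvee>\<^bsub>A\<^esub> y = y \<curlyvee>\<^bsub>A\<^esub> x)"

locale noncommutative_frame = skew_lattice_zero + strongly_distributive_skew_lattice +
  assumes join_complete: "commuting_subset A S \<Longrightarrow> \<exists>s. is_supremum A s S"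
    and sup_meet_distrib: "\<lbrakk>commuting_subset A S; is_supremum A s S; y \<in> carrier A\<rbrakk>
          \<Longrightarrow> is_supremum A (s \<curlywedge> y) ((\<lambda>x. x \<curlywedge> y) ` S)"
    and meet_sup_distrib: "\<lbrakk>commuting_subset A S; is_supremum A s S; x \<in> carrier A\<rbrakk>
          \<Longrightarrow> is_supremum A (x \<curlywedge> s) ((\<lambda>y. x \<curlywedge> y) ` S)"

locale left_handed_noncommutative_frame = noncommutative_frame +
  assumes left_handed: "\<lbrakk>x \<in> carrier A; y \<in> carrier A\<rbrakk> \<Longrightarrow> x \<curlywedge> y \<curlywedge> x = x \<curlywedge> y"

definition green_D :: "'a skew \<Rightarrow> ('a \<times> 'a) set" where
  "green_D A = {(a, b). a \<in> carrier A \<and> b \<in> carrier A \<and>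
     a \<curlywedge>\<^bsub>A\<^esub> b \<curlywedge>\<^bsub>A\<^esub> a = a \<and> b \<curlywedge>\<^bsub>A\<^esub> a \<curlywedge>\<^bsub>A\<^esub> b = b}"

definition D_class :: "'a skew \<Rightarrow> 'a \<Rightarrow> 'a set" where
  "D_class A a = green_D A `` {a}"

text \<open>The quotient by Green's relation as a partially ordered set: \<open>[a] \<le> [b]\<close> iff \<open>[a \<and> b] = [a]\<close>.\<close>

definition shadow :: "'a skew \<Rightarrow> 'a set gorder" where
  "shadow A = \<lparr>carrier = carrier A // green_D A, eq = (=),
     le = (\<lambda>P Q. \<exists>a\<in>P. \<exists>b\<in>Q. a \<curlywedge>\<^bsub>A\<^esub> b \<in> P)\<rparr>"

definition max_D_class :: "'a skew \<Rightarrow> 'a set" where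
  "max_D_class A =
     {m \<in> carrier A. greatest (shadow A) (D_class A m) (carrier (shadow A))}"

text \<open>
  A morphism is a function on the carrier, represented by an extensional function (constantly
  \<open>undefined\<close> off the carrier), so that equality in HOL is equality of morphisms. The same
  convention is used for all functions, points, sections and sheaf morphisms below.
\<close>

definition lnf_hom :: "'a skew \<Rightarrow> 'b skew \<Rightarrow> ('a \<Rightarrow> 'b) set" where
  "lnf_hom A B = {\<phi> \<in> carrier A \<rightarrow>\<^sub>E carrier B.
     (\<forall>x\<in>carrier A. \<forall>y\<in>carrier A. \<phi> (x \<curlywedge>\<^bsub>A\<^esub> y) = \<phi> x \<curlywedge>\<^bsub>B\<^esub> \<phi> y) \<and>
     (\<forall>x\<in>carrier A. \<forall>y\<in>carrier A. \<phi> (x \<curlyvee>\<^bsub>A\<^esub> y) = \<phi> x \<curlyvee>\<^bsub>B\<^esub> \<phi> y) \<and>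
     \<phi> \<zero>\<^bsub>A\<^esub> = \<zero>\<^bsub>B\<^esub> \<and>
     (\<forall>S s. commuting_subset A S \<and> is_supremum A s S \<longrightarrow> is_supremum B (\<phi> s) (\<phi> ` S)) \<and>
     \<phi> ` max_D_class A \<subseteq> max_D_class B}"

definition lnf_id :: "'a skew \<Rightarrow> 'a \<Rightarrow> 'a" where
  "lnf_id A = (\<lambda>a\<in>carrier A. a)"

text \<open>Composition of \<^const>\<open>lnf_hom\<close> morphisms out of \<open>A\<close> is \<^term>\<open>compose (carrier A)\<close>.\<close>


section \<open>Sheaves for the front topology\<close>

definition locally_closedin :: "'y topology \<Rightarrow> 'y set \<Rightarrow> bool" where
  "locally_closedin Y Z \<longleftrightarrow> (\<exists>U C. openin Y U \<and> closedin Y C \<and> Z = U \<inter> C)"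

definition front :: "'y topology \<Rightarrow> 'y topology" where
  "front Y = topology (arbitrary union_of (locally_closedin Y))"

text \<open>
  A space with a presheaf of sets on its front topology; \<open>restr X U V s\<close> is the restriction
  to \<open>V\<close> of the section \<open>s\<close> over \<open>U\<close>. Only the values on front-open sets \<open>V \<subseteq> U\<close> matter.
\<close>

record ('y, 's) fspace =
  space :: "'y topology"
  sections :: "'y set \<Rightarrow> 's set"
  restr :: "'y set \<Rightarrow> 'y set \<Rightarrow> 's \<Rightarrow> 's"

abbreviation fopen :: "('y, 's) fspace \<Rightarrow> 'y set \<Rightarrow> bool" where
  "fopen X \<equiv> openin (front (space X))"

text \<open>Gluing over the empty family makes \<open>sections X {}\<close> a singleton.\<close>

locale sheaf_on_front =
  fixes X :: "('y, 's) fspace"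
  assumes restr_closed: "\<lbrakk>fopen X U; fopen X V; V \<subseteq> U; s \<in> sections X U\<rbrakk>
        \<Longrightarrow> restr X U V s \<in> sections X V"
    and restr_id: "\<lbrakk>fopen X U; s \<in> sections X U\<rbrakk> \<Longrightarrow> restr X U U s = s"
    and restr_comp: "\<lbrakk>fopen X U; fopen X V; fopen X W; W \<subseteq> V; V \<subseteq> U; s \<in> sections X U\<rbrakk>
        \<Longrightarrow> restr X V W (restr X U V s) = restr X U W s"
    and gluing: "\<lbrakk>\<And>U. U \<in> \<U> \<Longrightarrow> fopen X U; \<And>U. U \<in> \<U> \<Longrightarrow> \<sigma> U \<in> sections X U;
          \<And>U V. \<lbrakk>U \<in> \<U>; V \<in> \<U>\<rbrakk> \<Longrightarrow> restr X U (U \<inter> V) (\<sigma> U) = restr X V (U \<inter> V) (\<sigma> V)\<rbrakk>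
        \<Longrightarrow> \<exists>!t. t \<in> sections X (\<Union>\<U>) \<and> (\<forall>U\<in>\<U>. restr X (\<Union>\<U>) U t = \<sigma> U)"

locale sh_object = sheaf_on_front +
  assumes global_section: "sections X (topspace (space X)) \<noteq> {}"

definition preim :: "('y, 's) fspace \<Rightarrow> ('y \<Rightarrow> 'z) \<Rightarrow> 'z set \<Rightarrow> 'y set" where
  "preim X f V = {y \<in> topspace (space X). f y \<in> V}"

text \<open>The component \<open>l V\<close> of a morphism \<open>(f, l)\<close> maps sections over \<open>V\<close> to sections over the
  preimage of \<open>V\<close>, for every front-open \<open>V\<close>.\<close>

definition sh_hom ::
  "('y, 's) fspace \<Rightarrow> ('z, 't) fspace \<Rightarrow> (('y \<Rightarrow> 'z) \<times> ('z set \<Rightarrow> 't \<Rightarrow> 's)) set" where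
  "sh_hom X Y = {(f, l).
     continuous_map (space X) (space Y) f \<and> f \<in> extensional (topspace (space X)) \<and>
     l \<in> (\<Pi>\<^sub>E V\<in>{V. fopen Y V}. sections Y V \<rightarrow>\<^sub>E sections X (preim X f V)) \<and>
     (\<forall>U V s. fopen Y U \<and> fopen Y V \<and> V \<subseteq> U \<and> s \<in> sections Y U \<longrightarrow>
        l V (restr Y U V s) = restr X (preim X f U) (preim X f V) (l U s))}"

definition sh_id :: "('y, 's) fspace \<Rightarrow> ('y \<Rightarrow> 'y) \<times> ('y set \<Rightarrow> 's \<Rightarrow> 's)" where
  "sh_id X = (\<lambda>y\<in>topspace (space X). y, \<lambda>V\<in>{V. fopen X V}. \<lambda>s\<in>sections X V. s)"

text \<open>\<open>sh_comp X Y Z h k\<close> is the composite of \<open>k : X \<rightarrow> Y\<close> and \<open>h : Y \<rightarrow> Z\<close>.\<close>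

definition sh_comp ::
  "('x, 'r) fspace \<Rightarrow> ('y, 's) fspace \<Rightarrow> ('z, 't) fspace \<Rightarrow>
   ('y \<Rightarrow> 'z) \<times> ('z set \<Rightarrow> 't \<Rightarrow> 's) \<Rightarrow> ('x \<Rightarrow> 'y) \<times> ('y set \<Rightarrow> 's \<Rightarrow> 'r) \<Rightarrow>
   ('x \<Rightarrow> 'z) \<times> ('z set \<Rightarrow> 't \<Rightarrow> 'r)" where
  "sh_comp X Y Z = (\<lambda>(g, m) (f, l).
     (compose (topspace (space X)) g f,
      \<lambda>V\<in>{V. fopen Z V}. compose (sections Z V) (l (preim Y g V)) (m V)))"


section \<open>The functor H\<close>

definition H_obj :: "('y, 's) fspace \<Rightarrow> ('y set \<times> 's) skew" where
  "H_obj X = \<lparr>carrier = {(U, s). openin (space X) U \<and> s \<in> sections X U},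
     smeet = (\<lambda>(U, s) (V, t). (U \<inter> V, restr X U (U \<inter> V) s)),
     sjoin = (\<lambda>(U, s) (V, t). (U \<union> V, THE r. r \<in> sections X (U \<union> V) \<and>
        restr X (U \<union> V) (U - V) r = restr X U (U - V) s \<and> restr X (U \<union> V) V r = t)),
     szero = ({}, THE s. s \<in> sections X {})\<rparr>"

definition H_map ::
  "('y, 's) fspace \<Rightarrow> ('z, 't) fspace \<Rightarrow> ('y \<Rightarrow> 'z) \<times> ('z set \<Rightarrow> 't \<Rightarrow> 's) \<Rightarrow>
   'z set \<times> 't \<Rightarrow> 'y set \<times> 's" where
  "H_map X Y = (\<lambda>(f, l). \<lambda>(U, s)\<in>carrier (H_obj Y). (preim X f U, l U s))"


section \<open>The functor G\<close>

text \<open>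
  Frame homomorphisms from the commutative shadow to \<^typ>\<open>bool\<close>, the two-element frame:
  they preserve finite meets (the empty one included) and arbitrary joins.
\<close>

definition points :: "'a skew \<Rightarrow> ('a set \<Rightarrow> bool) set" where
  "points A = {p \<in> extensional (carrier (shadow A)).
     (\<forall>S m. S \<subseteq> carrier (shadow A) \<and> finite S \<and> greatest (shadow A) m (Lower (shadow A) S)
        \<longrightarrow> (p m \<longleftrightarrow> (\<forall>x\<in>S. p x))) \<and>
     (\<forall>S s. S \<subseteq> carrier (shadow A) \<and> least (shadow A) s (Upper (shadow A) S)
        \<longrightarrow> (p s \<longleftrightarrow> (\<exists>x\<in>S. p x)))}"

definition basic_open :: "'a skew \<Rightarrow> 'a \<Rightarrow> ('a set \<Rightarrow> bool) set" where
  "basic_open A a = {p \<in> points A. p (D_class A a)}"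

definition pt_space :: "'a skew \<Rightarrow> ('a set \<Rightarrow> bool) topology" where
  "pt_space A = topology (\<lambda>U. \<exists>a\<in>carrier A. U = basic_open A a)"

definition germ_rel :: "'a skew \<Rightarrow> ('a set \<Rightarrow> bool) \<Rightarrow> ('a \<times> 'a) set" where
  "germ_rel A p = {(a, b). a \<in> carrier A \<and> b \<in> carrier A \<and> p (D_class A a) \<and> p (D_class A b) \<and>
     (\<exists>c\<in>carrier A. \<exists>d\<in>carrier A. \<not> p (D_class A c) \<and> p (D_class A d) \<and>
        (a \<curlywedge>\<^bsub>A\<^esub> d) \<curlyvee>\<^bsub>A\<^esub> c = (b \<curlywedge>\<^bsub>A\<^esub> d) \<curlyvee>\<^bsub>A\<^esub> c)}"

definition basic_section ::
  "'a skew \<Rightarrow> 'a \<Rightarrow> ('a set \<Rightarrow> bool) \<Rightarrow> ('a set \<Rightarrow> bool) \<times> 'a set" where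
  "basic_section A a = (\<lambda>p\<in>basic_open A a. (p, germ_rel A p `` {a}))"

text \<open>The underlying set of this topology is the set of all germs.\<close>

definition etale_space :: "'a skew \<Rightarrow> (('a set \<Rightarrow> bool) \<times> 'a set) topology" where
  "etale_space A = topology_generated_by
     {basic_section A a ` Z | a Z.
        a \<in> carrier A \<and> Z \<subseteq> basic_open A a \<and> locally_closedin (pt_space A) Z}"

definition G_obj :: "'a skew \<Rightarrow> ('a set \<Rightarrow> bool, ('a set \<Rightarrow> bool) \<Rightarrow> ('a set \<Rightarrow> bool) \<times> 'a set) fspace" where
  "G_obj A = \<lparr>space = pt_space A,
     sections = (\<lambda>W. {\<sigma> \<in> extensional W.
        continuous_map (subtopology (front (pt_space A)) W) (etale_space A) \<sigma> \<and>
        (\<forall>p\<in>W. fst (\<sigma> p) = p)}),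
     restr = (\<lambda>U V \<sigma>. restrict \<sigma> V)\<rparr>"

text \<open>\<open>p \<mapsto> p \<circ> \<phi>\<close>, where \<open>\<phi>\<close> acts on a \<open>\<D>\<close>-class \<open>P\<close> by \<open>[a] \<mapsto> [\<phi> a]\<close>.\<close>

definition pt_map ::
  "'a skew \<Rightarrow> 'b skew \<Rightarrow> ('a \<Rightarrow> 'b) \<Rightarrow> ('b set \<Rightarrow> bool) \<Rightarrow> 'a set \<Rightarrow> bool" where
  "pt_map A B \<phi> = (\<lambda>p\<in>points B. \<lambda>P\<in>carrier (shadow A). p (\<Union>a\<in>P. D_class B (\<phi> a)))"

definition G_map where
  "G_map A B \<phi> = (pt_map A B \<phi>,
     THE l. (pt_map A B \<phi>, l) \<in> sh_hom (G_obj B) (G_obj A) \<and>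
       (\<forall>a\<in>carrier A. l (basic_open A a) (basic_section A a) = basic_section B (\<phi> a)))"


section \<open>The adjunction\<close>

definition adj_unit where
  "adj_unit A = (\<lambda>a\<in>carrier A. (basic_open A a, basic_section A a))"

text \<open>
  The transposition sending \<open>h : X \<rightarrow> G A\<close> to \<open>H h \<circ> adj_unit A : A \<rightarrow> H X\<close>. It has to be a
  constant rather than an existentially quantified family, because naturality relates its
  instances at different types.
\<close>

definition adj_transpose where
  "adj_transpose A X h = compose (carrier A) (H_map X (G_obj A) h) (adj_unit A)"

end

theory Submission
  imports Defs
begin

text \<open>
  Both functors become transparent once everything is read off from germs.

  A section of a sheaf is determined by its germs, so an element \<open>(U, s)\<close> of \<open>H X\<close> is the same
  thing as the partial function that is defined on \<open>U\<close> and sends \<open>y\<close> to the germ of \<open>s\<close> at \<open>y\<close>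
  (\<open>germ_map_inj\<close>). Under this identification the meet restricts the left operand to the domain of
  the right one and the join overrides the left operand by the right one, so the axioms of a
  left-handed noncommutative frame hold pointwise. Conversely a function that is
  locally given by germs of sections is given by the germs of exactly one section
  (\<open>glue_germs\<close>); this yields the joins and the suprema of \<open>H X\<close>.

  In a left-handed noncommutative frame \<open>A\<close> the relation \<open>a \<curlywedge> b = a\<close> is a preorder whose induced
  equivalence is Green's relation. The commutative shadow is therefore the quotient poset of this
  preorder, and its points are the completely prime filters of \<open>A\<close>. The shadow is complete because
  it has a copy inside \<open>A\<close>: the elements below a fixed element of the maximal class in the natural
  partial order commute and represent each class exactly once. The relation that defines the germs of \<open>G A\<close> is
  made so that \<open>s\<^bsub>a \<and> b\<^esub>\<close> is a restriction of \<open>s\<^sub>a\<close> and \<open>s\<^bsub>a \<or> b\<^esub>\<close> is \<open>s\<^sub>a\<close> overridden by \<open>s\<^sub>b\<close>.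
  Hence \<open>a \<mapsto> (U\<^sub>a, s\<^sub>a)\<close> is a morphism \<open>A \<rightarrow> H (G A)\<close>, the unit (\<open>adj_unit_hom\<close>).

  The transpose of \<open>h = (f, l) : X \<rightarrow> G A\<close> records the preimages \<open>f\<^sup>-\<^sup>1(U\<^sub>a)\<close> and the sections \<open>l(s\<^sub>a)\<close>.
  The preimages determine \<open>f\<close>, and since every section of \<open>G A\<close> is locally some \<open>s\<^sub>a\<close>
  (\<open>section_G_iff\<close>), the sections \<open>l(s\<^sub>a)\<close> determine \<open>l\<close>; so transposition is injective. Given a morphism
  \<open>\<phi> : A \<rightarrow> H X\<close>, let \<open>f y\<close> be the point that corresponds to the filter of all \<open>a\<close> such that \<open>\<phi> a\<close>
  is defined at \<open>y\<close>. If \<open>s\<^sub>a\<close> and \<open>s\<^sub>b\<close> agree at \<open>f y\<close>, then \<open>(a \<curlywedge> d) \<curlyvee> c = (b \<curlywedge> d) \<curlyvee> c\<close> where \<open>\<phi> d\<close>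
  is defined at \<open>y\<close> and \<open>\<phi> c\<close> is not, and applying \<open>\<phi>\<close> shows that \<open>\<phi> a\<close> and \<open>\<phi> b\<close> have the same
  germ at \<open>y\<close>. So a section \<open>\<sigma>\<close> of \<open>G A\<close> can be sent to the section of \<open>X\<close> whose germ at \<open>y\<close> is that
  of \<open>\<phi> a\<close> for any \<open>a\<close> with \<open>\<sigma> (f y) = s\<^sub>a (f y)\<close>; this proves surjectivity (\<open>adj_transpose_surj\<close>).

  The bijection also constructs \<open>G\<close> on morphisms: \<open>G \<phi>\<close> is the morphism whose transpose is the unit of
  the target composed with \<open>\<phi>\<close> (\<open>G_map_spec\<close>). Functoriality of \<open>G\<close> and both naturality statements
  then follow from functoriality of \<open>H\<close> and the uniqueness of transposes.
\<close>

section \<open>Left-handed noncommutative frames\<close>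

definition natural_le :: "'a skew \<Rightarrow> 'a \<Rightarrow> 'a \<Rightarrow> bool" where
  "natural_le A a b \<longleftrightarrow> a \<curlywedge>\<^bsub>A\<^esub> b = a \<and> b \<curlywedge>\<^bsub>A\<^esub> a = a"

lemma is_supremum_iff:
  assumes "S \<subseteq> carrier A"
  shows "is_supremum A s S \<longleftrightarrow> s \<in> carrier A \<and> (\<forall>x\<in>S. natural_le A x s) \<and>
           (\<forall>u\<in>carrier A. (\<forall>x\<in>S. natural_le A x u) \<longrightarrow> natural_le A s u)"
  using assms unfolding is_supremum_def least_def Upper_def nat_order_def natural_le_def
  by (auto simp: subset_iff)

lemma is_supremum_unique:
  assumes "S \<subseteq> carrier A" "is_supremum A s S" "is_supremum A t S"
  shows "s = t"
  using assms by (metis is_supremum_iff natural_le_def)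

context left_handed_noncommutative_frame
begin

text \<open>
  In the left-handed case \<open>a \<curlywedge> b \<curlywedge> a = a\<close> simplifies to \<open>a \<curlywedge> b = a\<close>, so the order of the
  commutative shadow can be computed with representatives. It is only a preorder: two elements
  are below each other exactly if they are related by Green's relation.
\<close>
abbreviation below :: "'a \<Rightarrow> 'a \<Rightarrow> bool" (infix \<open>\<preceq>\<close> 50) where
  "a \<preceq> b \<equiv> a \<curlywedge> b = a"

lemmas closed [simp] = meet_closed join_closed zero_closed
lemmas idem [simp] = meet_idem join_idem

lemma meet_join_absorb:
  "\<lbrakk>x \<in> carrier A; y \<in> carrier A\<rbrakk> \<Longrightarrow> (x \<curlywedge> y) \<curlyvee> x = x"
  by (metis absorb3 left_handed meet_closed)

lemma below_trans:
  "\<lbrakk>a \<in> carrier A; b \<in> carrier A; c \<in> carrier A; a \<preceq> b; b \<preceq> c\<rbrakk> \<Longrightarrow> a \<preceq> c"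
  by (metis meet_assoc)

lemma meet_below1: "\<lbrakk>a \<in> carrier A; b \<in> carrier A\<rbrakk> \<Longrightarrow> a \<curlywedge> b \<preceq> a"
  by (rule left_handed)

lemma meet_below2: "\<lbrakk>a \<in> carrier A; b \<in> carrier A\<rbrakk> \<Longrightarrow> a \<curlywedge> b \<preceq> b"
  by (metis meet_assoc meet_idem)

lemma below_meet_iff:
  assumes "a \<in> carrier A" "b \<in> carrier A" "c \<in> carrier A"
  shows "c \<preceq> a \<curlywedge> b \<longleftrightarrow> c \<preceq> a \<and> c \<preceq> b"
  using assms by (metis below_trans meet_assoc meet_below1 meet_below2 meet_closed)

lemma join_above1: "\<lbrakk>a \<in> carrier A; b \<in> carrier A\<rbrakk> \<Longrightarrow> a \<preceq> a \<curlyvee> b"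
  by (rule absorb1)

lemma join_above2: "\<lbrakk>a \<in> carrier A; b \<in> carrier A\<rbrakk> \<Longrightarrow> b \<preceq> a \<curlyvee> b"
  by (metis absorb3 left_handed meet_closed meet_join_distrib meet_idem)

lemma join_below_iff:
  assumes "a \<in> carrier A" "b \<in> carrier A" "c \<in> carrier A"
  shows "a \<curlyvee> b \<preceq> c \<longleftrightarrow> a \<preceq> c \<and> b \<preceq> c"
  using assms by (metis below_trans join_above1 join_above2 join_closed join_meet_distrib)

lemma zero_below: "a \<in> carrier A \<Longrightarrow> \<zero> \<preceq> a"
  by (metis absorb1 zero_closed zero_left)

lemma below_zero: "\<lbrakk>a \<in> carrier A; a \<preceq> \<zero>\<rbrakk> \<Longrightarrow> a = \<zero>"
  by (metis absorb3 zero_closed zero_right)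

text \<open>
  Left-handedness transfers from the meet to the join: by absorption the two sides \<open>u, v\<close> satisfy
  \<open>u \<curlywedge> v = v\<close> and \<open>v \<curlywedge> u = u\<close>, and then \<open>u \<curlywedge> v \<curlywedge> u = u \<curlywedge> v\<close> says that they are equal.
\<close>
lemma join_left_handed:
  assumes "x \<in> carrier A" "y \<in> carrier A"
  shows "x \<curlyvee> y \<curlyvee> x = y \<curlyvee> x"
proof -
  let ?u = "x \<curlyvee> y \<curlyvee> x" and ?v = "y \<curlyvee> x"
  have "?v \<curlyvee> ?u = ?v" using assms by (metis join_assoc join_closed join_idem)
  then have "?v \<curlywedge> ?u = ?u" using assms by (metis absorb4 join_closed)
  moreover have "?u \<curlywedge> ?v = ?v" using assms by (metis absorb4 join_assoc join_closed)
  ultimately show ?thesis using assms by (metis left_handed join_closed)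
qed

text \<open>
  This is the key use of strong distributivity: if the equivalent elements \<open>a\<close> and \<open>b\<close> lie
  naturally below \<open>x\<close>, then distributing \<open>(x \<curlyvee> a) \<curlywedge> b = x \<curlywedge> b\<close> gives \<open>b = b \<curlyvee> a\<close>, and the
  join of two equivalent elements is the right one of them. So every class has at most one member naturally below a given \<open>x\<close>, which yields normality
  and the commutativity of the elements naturally below \<open>x\<close>.
\<close>
lemma eq_if_D_and_below:
  assumes c: "a \<in> carrier A" "b \<in> carrier A" "x \<in> carrier A"
    and D: "a \<preceq> b" "b \<preceq> a" and le: "natural_le A a x" "natural_le A b x"
  shows "a = b"
proof -
  have "x \<curlyvee> a = x" using c le by (metis absorb2 natural_le_def)
  then have "b = (x \<curlyvee> a) \<curlywedge> b" using le by (simp add: natural_le_def)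
  also have "\<dots> = b \<curlyvee> a" using c D le by (simp add: join_meet_distrib natural_le_def)
  also have "\<dots> = a" using c D by (metis absorb3)
  finally show ?thesis by simp
qed

lemma natural_le_meet: "\<lbrakk>x \<in> carrier A; y \<in> carrier A\<rbrakk> \<Longrightarrow> natural_le A (x \<curlywedge> y) x"
  by (metis left_handed meet_assoc meet_idem natural_le_def)

lemma meet_normal:
  assumes "x \<in> carrier A" "y \<in> carrier A" "z \<in> carrier A"
  shows "x \<curlywedge> y \<curlywedge> z = x \<curlywedge> z \<curlywedge> y"
proof (rule eq_if_D_and_below)
  have [simp]: "x \<curlywedge> y \<curlywedge> z \<preceq> z" "x \<curlywedge> y \<curlywedge> z \<preceq> x \<curlywedge> y" "x \<curlywedge> z \<curlywedge> y \<preceq> y" "x \<curlywedge> z \<curlywedge> y \<preceq> x \<curlywedge> z"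
    using assms by (simp_all add: meet_below1 meet_below2)
  have [simp]: "x \<curlywedge> y \<curlywedge> z \<preceq> x" "x \<curlywedge> y \<curlywedge> z \<preceq> y" "x \<curlywedge> z \<curlywedge> y \<preceq> x" "x \<curlywedge> z \<curlywedge> y \<preceq> z"
    using assms \<open>x \<curlywedge> y \<curlywedge> z \<preceq> x \<curlywedge> y\<close> \<open>x \<curlywedge> z \<curlywedge> y \<preceq> x \<curlywedge> z\<close> by (metis below_meet_iff meet_closed)+
  show "x \<curlywedge> y \<curlywedge> z \<preceq> x \<curlywedge> z \<curlywedge> y" "x \<curlywedge> z \<curlywedge> y \<preceq> x \<curlywedge> y \<curlywedge> z"
    using assms by (simp_all add: below_meet_iff)
  show "natural_le A (x \<curlywedge> y \<curlywedge> z) x" "natural_le A (x \<curlywedge> z \<curlywedge> y) x"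
    using assms by (metis natural_le_meet meet_assoc meet_closed)+
qed (use assms in auto)

lemma commuting_below:
  assumes c: "x \<in> carrier A" "a \<in> carrier A" "b \<in> carrier A"
    and le: "natural_le A a x" "natural_le A b x"
  shows "a \<curlywedge> b = b \<curlywedge> a" "a \<curlyvee> b = b \<curlyvee> a"
proof -
  show "a \<curlywedge> b = b \<curlywedge> a"
    using meet_normal[OF c] le by (simp add: natural_le_def)
  have le': "natural_le A (a \<curlyvee> b) x" "natural_le A (b \<curlyvee> a) x"
    using c le by (simp_all add: natural_le_def join_meet_distrib meet_join_distrib)
  show "a \<curlyvee> b = b \<curlyvee> a"
    by (rule eq_if_D_and_below[OF _ _ c(1) _ _ le'])
      (use c in \<open>simp_all add: join_below_iff join_above1 join_above2\<close>)
qed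

lemma natural_le_commutes:
  assumes "a \<in> carrier A" "b \<in> carrier A" "natural_le A a b"
  shows "a \<curlywedge> b = b \<curlywedge> a" "a \<curlyvee> b = b \<curlyvee> a"
  using commuting_below[OF assms(2) assms(1,2,3)] assms(2) by (simp_all add: natural_le_def)

lemma natural_le_refl: "a \<in> carrier A \<Longrightarrow> natural_le A a a"
  by (simp add: natural_le_def)

lemma natural_le_antisym:
  assumes "natural_le A a b" "natural_le A b a"
  shows "a = b"
  using assms unfolding natural_le_def by metis

lemma natural_le_trans:
  "\<lbrakk>a \<in> carrier A; b \<in> carrier A; c \<in> carrier A; natural_le A a b; natural_le A b c\<rbrakk>
    \<Longrightarrow> natural_le A a c"
  unfolding natural_le_def by (metis meet_assoc)

text \<open>
  Chains for the natural order commute, so join completeness and Zorn's lemma give an element \<open>m\<close>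
  that is maximal for the natural order. It is greatest for \<open>\<preceq>\<close> because \<open>m\<close> lies
  naturally below \<open>a \<curlyvee> m\<close>, which forces \<open>a \<curlyvee> m = m\<close>.
\<close>
lemma ex_top: "\<exists>m\<in>carrier A. \<forall>a\<in>carrier A. a \<preceq> m"
proof -
  let ?r = "relation_of (natural_le A) (carrier A)"
  have po: "partial_order_on (carrier A) ?r"
    unfolding partial_order_on_def preorder_on_def refl_on_def trans_def antisym_def relation_of_def
    using natural_le_refl natural_le_trans natural_le_antisym by auto
  have "\<exists>u\<in>carrier A. \<forall>a\<in>C. natural_le A a u" if C: "C \<in> Chains ?r" for C
  proof (cases "C = {}")
    case True
    then show ?thesis using zero_closed by blast
  next
    case False
    have sub: "C \<subseteq> carrier A" using C by (auto simp: Chains_def relation_of_def)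
    have "natural_le A x y \<or> natural_le A y x" if "x \<in> C" "y \<in> C" for x y
      using C that by (auto simp: Chains_def relation_of_def)
    then have "commuting_subset A C"
      unfolding commuting_subset_def using sub False
      using natural_le_commutes by (metis subsetD)
    then obtain s where "is_supremum A s C" using join_complete by blast
    then show ?thesis using is_supremum_iff[OF sub] by blast
  qed
  from predicate_Zorn[OF po this] obtain m where m: "m \<in> carrier A"
    and max: "\<And>a. \<lbrakk>a \<in> carrier A; natural_le A m a\<rbrakk> \<Longrightarrow> a = m" by blast
  have "a \<preceq> m" if a: "a \<in> carrier A" for a
  proof -
    have "m \<curlywedge> (a \<curlyvee> m) = m"
      using a m by (simp add: meet_join_distrib meet_join_absorb)
    moreover have "(a \<curlyvee> m) \<curlywedge> m = m" using a m by (rule absorb4)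
    ultimately have "a \<curlyvee> m = m"
      using max[of "a \<curlyvee> m"] a m unfolding natural_le_def by (meson join_closed)
    then show ?thesis using a m by (metis absorb1)
  qed
  then show ?thesis using m by blast
qed

lemma green_D_iff: "(a, b) \<in> green_D A \<longleftrightarrow> a \<in> carrier A \<and> b \<in> carrier A \<and> a \<preceq> b \<and> b \<preceq> a"
  unfolding green_D_def using left_handed by auto

lemma equiv_green_D: "equiv (carrier A) (green_D A)"
  unfolding equiv_def refl_on_def sym_def trans_def
  by (auto simp: green_D_iff intro: below_trans)

lemma mem_D_class_iff: "b \<in> D_class A a \<longleftrightarrow> a \<in> carrier A \<and> b \<in> carrier A \<and> a \<preceq> b \<and> b \<preceq> a"
  by (simp add: D_class_def green_D_iff)

lemma D_class_self: "a \<in> carrier A \<Longrightarrow> a \<in> D_class A a"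
  by (simp add: mem_D_class_iff)

lemma D_class_eq_iff:
  "\<lbrakk>a \<in> carrier A; b \<in> carrier A\<rbrakk> \<Longrightarrow> D_class A a = D_class A b \<longleftrightarrow> a \<preceq> b \<and> b \<preceq> a"
  using eq_equiv_class_iff[OF equiv_green_D] by (simp add: D_class_def green_D_iff)

lemma carrier_shadow: "carrier (shadow A) = D_class A ` carrier A"
  by (auto simp: shadow_def quotient_def D_class_def)

lemma D_class_in_shadow: "a \<in> carrier A \<Longrightarrow> D_class A a \<in> carrier (shadow A)"
  by (simp add: carrier_shadow)

lemma shadow_le_iff:
  assumes "a \<in> carrier A" "b \<in> carrier A"
  shows "D_class A a \<sqsubseteq>\<^bsub>shadow A\<^esub> D_class A b \<longleftrightarrow> a \<preceq> b"
proof
  assume "a \<preceq> b"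
  then show "D_class A a \<sqsubseteq>\<^bsub>shadow A\<^esub> D_class A b"
    using assms D_class_self unfolding shadow_def gorder.simps by metis
next
  assume "D_class A a \<sqsubseteq>\<^bsub>shadow A\<^esub> D_class A b"
  then obtain a' b' where ab: "a' \<in> D_class A a" "b' \<in> D_class A b" "a' \<curlywedge> b' \<in> D_class A a"
    by (auto simp: shadow_def)
  then have "a' \<in> carrier A" "b' \<in> carrier A" "a \<preceq> a' \<curlywedge> b'" "b' \<preceq> b"
    by (simp_all add: mem_D_class_iff)
  then show "a \<preceq> b" using assms by (metis below_meet_iff below_trans)
qed

lemma mem_max_D_class_iff:
  "m \<in> max_D_class A \<longleftrightarrow> m \<in> carrier A \<and> (\<forall>a\<in>carrier A. a \<preceq> m)"
proof (cases "m \<in> carrier A")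
  case True
  then have "greatest (shadow A) (D_class A m) (carrier (shadow A)) \<longleftrightarrow>
      (\<forall>a\<in>carrier A. D_class A a \<sqsubseteq>\<^bsub>shadow A\<^esub> D_class A m)"
    by (simp add: greatest_def carrier_shadow)
  then show ?thesis using True by (simp add: max_D_class_def shadow_le_iff)
qed (simp add: max_D_class_def)

lemma max_D_class_nonempty: "max_D_class A \<noteq> {}"
  using ex_top mem_max_D_class_iff by blast

text \<open>
  The map \<open>a \<mapsto> m \<curlywedge> a\<close> picks from each class its representative naturally below the top element \<open>m\<close>. As these
  representatives commute, their supremum exists in \<open>A\<close>, and it represents the least upper bound
  of the classes.
\<close>
lemma shadow_lub_meets:
  assumes m: "m \<in> max_D_class A" and S: "S \<subseteq> carrier A" "S \<noteq> {}"
  shows "commuting_subset A ((\<curlywedge>) m ` S)"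
    and "is_supremum A s ((\<curlywedge>) m ` S) \<Longrightarrow>
      s \<in> carrier A \<and> (\<forall>c\<in>carrier A. s \<preceq> c \<longleftrightarrow> (\<forall>a\<in>S. a \<preceq> c))"
proof -
  have mc: "m \<in> carrier A" and top: "\<And>a. a \<in> carrier A \<Longrightarrow> a \<preceq> m"
    using m by (auto simp: mem_max_D_class_iff)
  have sub: "(\<curlywedge>) m ` S \<subseteq> carrier A" using mc S by auto
  show "commuting_subset A ((\<curlywedge>) m ` S)"
    unfolding commuting_subset_def
  proof (intro conjI ballI)
    fix x y assume "x \<in> (\<curlywedge>) m ` S" "y \<in> (\<curlywedge>) m ` S"
    then have "x \<in> carrier A" "y \<in> carrier A" "natural_le A x m" "natural_le A y m"
      using sub S natural_le_meet[OF mc] by auto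
    then show "x \<curlywedge> y = y \<curlywedge> x" "x \<curlyvee> y = y \<curlyvee> x" using commuting_below[OF mc] by auto
  qed (use sub S in auto)
  assume "is_supremum A s ((\<curlywedge>) m ` S)"
  then have s: "s \<in> carrier A" and up: "\<And>a. a \<in> S \<Longrightarrow> natural_le A (m \<curlywedge> a) s"
    and least: "\<And>u. \<lbrakk>u \<in> carrier A; \<And>a. a \<in> S \<Longrightarrow> natural_le A (m \<curlywedge> a) u\<rbrakk> \<Longrightarrow> natural_le A s u"
    using is_supremum_iff[OF sub] by auto
  have below_s: "a \<preceq> s" if "a \<in> S" for a
  proof -
    have a: "a \<in> carrier A" using that S by blast
    then have "a \<preceq> m \<curlywedge> a" using mc top by (simp add: below_meet_iff)
    moreover have "m \<curlywedge> a \<preceq> s" using up[OF that] by (simp add: natural_le_def)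
    ultimately show ?thesis using a mc s by (metis below_trans meet_closed)
  qed
  have "s \<preceq> c" if c: "c \<in> carrier A" and le: "\<And>a. a \<in> S \<Longrightarrow> a \<preceq> c" for c
  proof -
    have "natural_le A (m \<curlywedge> a) (m \<curlywedge> c)" if "a \<in> S" for a
    proof -
      have a: "a \<in> carrier A" using that S by blast
      have "m \<curlywedge> a = m \<curlywedge> c \<curlywedge> a" 
        using le[OF that] a c mc by (metis meet_assoc meet_normal)
      also have "natural_le A \<dots> (m \<curlywedge> c)"
        using a c mc by (simp add: natural_le_meet)
      finally show ?thesis .
    qed
    then have "natural_le A s (m \<curlywedge> c)" using least c mc by simp
    then have "s \<preceq> m \<curlywedge> c" by (simp add: natural_le_def)
    then show ?thesis using c mc s by (simp add: below_meet_iff)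
  qed
  then show "s \<in> carrier A \<and> (\<forall>c\<in>carrier A. s \<preceq> c \<longleftrightarrow> (\<forall>a\<in>S. a \<preceq> c))"
    using s below_s S by (meson below_trans subsetD)
qed

text \<open>
  Suprema in \<open>A\<close> of commuting subsets are also least upper bounds of classes: if every member
  satisfies \<open>a \<curlywedge> c = a\<close>, then the infinite distributive law turns \<open>s \<curlywedge> c\<close> into a supremum of the
  same set.
\<close>
lemma sup_below_iff:
  assumes S: "commuting_subset A S" and s: "is_supremum A s S" and c: "c \<in> carrier A"
  shows "s \<preceq> c \<longleftrightarrow> (\<forall>a\<in>S. a \<preceq> c)"
proof -
  have sub: "S \<subseteq> carrier A" "S \<noteq> {}" using S by (auto simp: commuting_subset_def)
  have sc: "s \<in> carrier A" and up: "\<And>a. a \<in> S \<Longrightarrow> natural_le A a s"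
    using is_supremum_iff[OF sub(1)] s by auto
  have "s \<preceq> c" if le: "\<And>a. a \<in> S \<Longrightarrow> a \<preceq> c"
  proof -
    have "is_supremum A (s \<curlywedge> c) ((\<lambda>x. x \<curlywedge> c) ` S)"
      by (rule sup_meet_distrib[OF S s c])
    also have "(\<lambda>x. x \<curlywedge> c) ` S = S" using le by auto
    finally show "s \<preceq> c" using is_supremum_unique[OF sub(1) _ s] by blast
  qed
  then show ?thesis using up sc c sub unfolding natural_le_def by (meson below_trans subsetD)
qed

end

section \<open>Points of the commutative shadow\<close>

text \<open>
  Points of the shadow, seen as predicates on \<open>A\<close>. The clauses for \<open>\<zero>\<close> and for the maximal
  class account for the empty join and the empty meet, because commuting subsets are nonempty.
\<close>
definition completely_prime_filter :: "'a skew \<Rightarrow> ('a \<Rightarrow> bool) \<Rightarrow> bool" where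
  "completely_prime_filter A P \<longleftrightarrow>
     (\<forall>a\<in>carrier A. \<forall>b\<in>carrier A. P (a \<curlywedge>\<^bsub>A\<^esub> b) \<longleftrightarrow> P a \<and> P b) \<and>
     \<not> P \<zero>\<^bsub>A\<^esub> \<and> (\<forall>m\<in>max_D_class A. P m) \<and>
     (\<forall>S s. commuting_subset A S \<and> is_supremum A s S \<longrightarrow> (P s \<longleftrightarrow> (\<exists>a\<in>S. P a)))"

text \<open>
  The point of the shadow that corresponds to a filter. A filter is upward closed for \<open>\<preceq>\<close> and hence
  a union of classes, so one member of a class decides.
\<close>
definition point_of :: "'a skew \<Rightarrow> ('a \<Rightarrow> bool) \<Rightarrow> 'a set \<Rightarrow> bool" where
  "point_of A P = (\<lambda>C\<in>carrier (shadow A). \<exists>a\<in>C. P a)"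

context left_handed_noncommutative_frame
begin

lemma max_D_class_closed: "m \<in> max_D_class A \<Longrightarrow> m \<in> carrier A"
  by (simp add: mem_max_D_class_iff)

lemma ex_lub:
  assumes S: "S \<subseteq> carrier A"
  shows "\<exists>s\<in>carrier A. \<forall>c\<in>carrier A. s \<preceq> c \<longleftrightarrow> (\<forall>a\<in>S. a \<preceq> c)"
proof (cases "S = {}")
  case True
  then show ?thesis using zero_below zero_closed by blast
next
  case False
  obtain m where m: "m \<in> max_D_class A" using max_D_class_nonempty by blast
  show ?thesis
    using join_complete[OF shadow_lub_meets(1)[OF m S False]] shadow_lub_meets(2)[OF m S False]
    by blast
qed

text \<open>
  Points are defined by bounds in the set of classes; this lemma and the next one express these
  bounds by representatives and \<open>\<preceq>\<close>.
\<close>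
lemma shadow_glb_iff:
  assumes "S \<subseteq> carrier A" "c \<in> carrier A"
  shows "greatest (shadow A) (D_class A c) (Lower (shadow A) (D_class A ` S)) \<longleftrightarrow>
           (\<forall>x\<in>carrier A. x \<preceq> c \<longleftrightarrow> (\<forall>a\<in>S. x \<preceq> a))"
proof -
  have inter: "D_class A ` S \<inter> carrier (shadow A) = D_class A ` S"
    using assms(1) by (auto simp: carrier_shadow)
  have Lower: "Lower (shadow A) (D_class A ` S) = D_class A ` {x \<in> carrier A. \<forall>a\<in>S. x \<preceq> a}"
    unfolding Lower_def inter Ball_def[symmetric] using assms(1)
    by (auto simp: carrier_shadow shadow_le_iff subset_iff)
  show ?thesis (is "?L \<longleftrightarrow> ?R")
  proof
    assume L: ?L
    then have "D_class A c \<in> D_class A ` {x \<in> carrier A. \<forall>a\<in>S. x \<preceq> a}"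
      by (simp add: greatest_def Lower)
    then obtain x where x: "x \<in> carrier A" "\<forall>a\<in>S. x \<preceq> a" "c \<preceq> x"
      using assms by (auto simp: D_class_eq_iff)
    then have "\<forall>a\<in>S. c \<preceq> a" using assms by (meson below_trans subsetD)
    moreover have "x \<preceq> c" if "x \<in> carrier A" "\<forall>a\<in>S. x \<preceq> a" for x
      using L that assms by (auto simp: greatest_def Lower shadow_le_iff)
    ultimately show ?R using assms by (meson below_trans subsetD)
  next
    assume R: ?R
    then have "c \<in> {x \<in> carrier A. \<forall>a\<in>S. x \<preceq> a}"
      using assms(2) meet_idem[of c] by blast
    then show ?L unfolding greatest_def Lower using R assms
      by (auto simp: shadow_le_iff carrier_shadow)
  qed
qed

lemma shadow_lub_iff:
  assumes "S \<subseteq> carrier A" "c \<in> carrier A"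
  shows "least (shadow A) (D_class A c) (Upper (shadow A) (D_class A ` S)) \<longleftrightarrow>
           (\<forall>x\<in>carrier A. c \<preceq> x \<longleftrightarrow> (\<forall>a\<in>S. a \<preceq> x))"
proof -
  have inter: "D_class A ` S \<inter> carrier (shadow A) = D_class A ` S"
    using assms(1) by (auto simp: carrier_shadow)
  have Upper: "Upper (shadow A) (D_class A ` S) = D_class A ` {x \<in> carrier A. \<forall>a\<in>S. a \<preceq> x}"
    unfolding Upper_def inter Ball_def[symmetric] using assms(1)
    by (auto simp: carrier_shadow shadow_le_iff subset_iff)
  show ?thesis (is "?L \<longleftrightarrow> ?R")
  proof
    assume L: ?L
    then have "D_class A c \<in> D_class A ` {x \<in> carrier A. \<forall>a\<in>S. a \<preceq> x}"
      by (simp add: least_def Upper)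
    then obtain x where x: "x \<in> carrier A" "\<forall>a\<in>S. a \<preceq> x" "x \<preceq> c"
      using assms by (auto simp: D_class_eq_iff)
    then have "\<forall>a\<in>S. a \<preceq> c" using assms by (meson below_trans subsetD)
    moreover have "c \<preceq> x" if "x \<in> carrier A" "\<forall>a\<in>S. a \<preceq> x" for x
      using L that assms by (auto simp: least_def Upper shadow_le_iff)
    ultimately show ?R using assms by (meson below_trans subsetD)
  next
    assume R: ?R
    then have "c \<in> {x \<in> carrier A. \<forall>a\<in>S. a \<preceq> x}"
      using assms(2) meet_idem[of c] by blast
    then show ?L unfolding least_def Upper using R assms
      by (auto simp: shadow_le_iff carrier_shadow)
  qed
qed

lemma point_glb:
  assumes "p \<in> points A" "S \<subseteq> carrier A" "finite S" "c \<in> carrier A"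
    and "\<And>x. x \<in> carrier A \<Longrightarrow> x \<preceq> c \<longleftrightarrow> (\<forall>a\<in>S. x \<preceq> a)"
  shows "p (D_class A c) \<longleftrightarrow> (\<forall>a\<in>S. p (D_class A a))"
proof -
  have "greatest (shadow A) (D_class A c) (Lower (shadow A) (D_class A ` S))"
    using assms by (simp add: shadow_glb_iff)
  moreover have "D_class A ` S \<subseteq> carrier (shadow A)" "finite (D_class A ` S)"
    using assms by (auto simp: carrier_shadow)
  ultimately have "p (D_class A c) \<longleftrightarrow> (\<forall>C\<in>D_class A ` S. p C)"
    using assms(1) unfolding points_def by blast
  then show ?thesis by simp
qed

lemma point_lub:
  assumes "p \<in> points A" "S \<subseteq> carrier A" "c \<in> carrier A"
    and "\<And>x. x \<in> carrier A \<Longrightarrow> c \<preceq> x \<longleftrightarrow> (\<forall>a\<in>S. a \<preceq> x)"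
  shows "p (D_class A c) \<longleftrightarrow> (\<exists>a\<in>S. p (D_class A a))"
proof -
  have "least (shadow A) (D_class A c) (Upper (shadow A) (D_class A ` S))"
    using assms by (simp add: shadow_lub_iff)
  moreover have "D_class A ` S \<subseteq> carrier (shadow A)"
    using assms by (auto simp: carrier_shadow)
  ultimately have "p (D_class A c) \<longleftrightarrow> (\<exists>C\<in>D_class A ` S. p C)"
    using assms(1) unfolding points_def by blast
  then show ?thesis by simp
qed

lemma point_meet:
  "\<lbrakk>p \<in> points A; a \<in> carrier A; b \<in> carrier A\<rbrakk>
    \<Longrightarrow> p (D_class A (a \<curlywedge> b)) \<longleftrightarrow> p (D_class A a) \<and> p (D_class A b)"
  using point_glb[of p "{a, b}" "a \<curlywedge> b"] by (simp add: below_meet_iff)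

lemma point_join:
  "\<lbrakk>p \<in> points A; a \<in> carrier A; b \<in> carrier A\<rbrakk>
    \<Longrightarrow> p (D_class A (a \<curlyvee> b)) \<longleftrightarrow> p (D_class A a) \<or> p (D_class A b)"
  using point_lub[of p "{a, b}" "a \<curlyvee> b"] by (simp add: join_below_iff)

lemma point_zero: "p \<in> points A \<Longrightarrow> \<not> p (D_class A \<zero>)"
  using point_lub[of p "{}" \<zero>] by (simp add: zero_below)

lemma point_top: "\<lbrakk>p \<in> points A; m \<in> max_D_class A\<rbrakk> \<Longrightarrow> p (D_class A m)"
  using point_glb[of p "{}" m] by (simp add: mem_max_D_class_iff)

lemma point_sup:
  assumes "p \<in> points A" "commuting_subset A S" "is_supremum A s S"
  shows "p (D_class A s) \<longleftrightarrow> (\<exists>a\<in>S. p (D_class A a))"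
proof (rule point_lub)
  show "S \<subseteq> carrier A" using assms(2) by (simp add: commuting_subset_def)
  then show "s \<in> carrier A" using assms(3) by (simp add: is_supremum_iff)
qed (use assms(1) sup_below_iff[OF assms(2,3)] in auto)

lemma points_eqI:
  assumes "p \<in> points A" "q \<in> points A"
    and "\<And>a. a \<in> carrier A \<Longrightarrow> p (D_class A a) \<longleftrightarrow> q (D_class A a)"
  shows "p = q"
proof (rule extensionalityI)
  show "p \<in> extensional (carrier (shadow A))" "q \<in> extensional (carrier (shadow A))"
    using assms(1,2) by (simp_all add: points_def)
qed (use assms(3) in \<open>auto simp: carrier_shadow\<close>)

lemma completely_prime_filter_mono:
  assumes "completely_prime_filter A P" "a \<in> carrier A" "b \<in> carrier A" "a \<preceq> b" "P a"
  shows "P b"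
  using assms unfolding completely_prime_filter_def by metis

lemma point_of_D_class:
  assumes "completely_prime_filter A P" "a \<in> carrier A"
  shows "point_of A P (D_class A a) \<longleftrightarrow> P a"
proof -
  have "point_of A P (D_class A a) \<longleftrightarrow> (\<exists>b\<in>D_class A a. P b)"
    using assms(2) by (simp add: point_of_def D_class_in_shadow)
  also have "\<dots> \<longleftrightarrow> P a"
    using D_class_self[OF assms(2)] completely_prime_filter_mono[OF assms(1)] mem_D_class_iff by blast
  finally show ?thesis .
qed

text \<open>
  A greatest lower bound is unique up to equivalence, so it is enough to produce for each finite
  set one that is compatible with the filter. Iterated meets do this; the empty meet is an element
  of the maximal class.
\<close>
lemma finite_glb_filter:
  assumes P: "completely_prime_filter A P" and "finite T" "T \<subseteq> carrier A"
  shows "\<exists>d\<in>carrier A. (\<forall>x\<in>carrier A. x \<preceq> d \<longleftrightarrow> (\<forall>a\<in>T. x \<preceq> a)) \<and> (P d \<longleftrightarrow> (\<forall>a\<in>T. P a))"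
  using assms(2,3)
proof (induction T rule: finite_induct)
  case empty
  obtain m where "m \<in> max_D_class A" using max_D_class_nonempty by blast
  then show ?case
    using P by (intro bexI[of _ m]) (auto simp: completely_prime_filter_def mem_max_D_class_iff)
next
  case (insert a T)
  then obtain d where d: "d \<in> carrier A" "\<forall>x\<in>carrier A. x \<preceq> d \<longleftrightarrow> (\<forall>a\<in>T. x \<preceq> a)"
    "P d \<longleftrightarrow> (\<forall>a\<in>T. P a)" by auto
  have a: "a \<in> carrier A" using insert.prems by simp
  have "P (a \<curlywedge> d) \<longleftrightarrow> P a \<and> P d"
    using P a d(1) by (simp add: completely_prime_filter_def)
  then show ?case using d a by (intro bexI[of _ "a \<curlywedge> d"]) (simp_all add: below_meet_iff)
qed

text \<open>
  Bounds of a set of classes are computed with representatives: greatest lower bounds of finite sets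
  by iterated meets, least upper bounds as suprema of the commuting representatives naturally below an
  element of the maximal class.
\<close>
lemma point_of_in_points:
  assumes P: "completely_prime_filter A P"
  shows "point_of A P \<in> points A"
  unfolding points_def
proof (intro CollectI conjI allI impI; (elim conjE)?)
  show "point_of A P \<in> extensional (carrier (shadow A))" by (simp add: point_of_def)
next
  fix \<S> M assume "\<S> \<subseteq> carrier (shadow A)" "finite \<S>"
    and glb: "greatest (shadow A) M (Lower (shadow A) \<S>)"
  then obtain T where T: "T \<subseteq> carrier A" "finite T" "\<S> = D_class A ` T"
    unfolding carrier_shadow by (metis finite_subset_image)
  have "M \<in> carrier (shadow A)" using glb by (auto simp: greatest_def Lower_def)
  then obtain c where c: "c \<in> carrier A" "M = D_class A c" by (auto simp: carrier_shadow)
  obtain d where d: "d \<in> carrier A" "\<forall>x\<in>carrier A. x \<preceq> d \<longleftrightarrow> (\<forall>a\<in>T. x \<preceq> a)"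
    "P d \<longleftrightarrow> (\<forall>a\<in>T. P a)" using finite_glb_filter[OF P T(2,1)] by blast
  have "\<forall>x\<in>carrier A. x \<preceq> c \<longleftrightarrow> x \<preceq> d"
    using glb T c d by (simp add: shadow_glb_iff)
  then have "c \<preceq> d" "d \<preceq> c" using c(1) d(1) by (metis meet_idem)+
  then have "P c \<longleftrightarrow> P d" using completely_prime_filter_mono[OF P] c d by blast
  moreover have "(\<forall>C\<in>\<S>. point_of A P C) \<longleftrightarrow> (\<forall>a\<in>T. P a)"
    using T point_of_D_class[OF P] by (simp add: subset_iff)
  ultimately show "point_of A P M \<longleftrightarrow> (\<forall>C\<in>\<S>. point_of A P C)"
    using c d point_of_D_class[OF P] by simp
next
  fix \<S> M assume "\<S> \<subseteq> carrier (shadow A)"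
    and lub: "least (shadow A) M (Upper (shadow A) \<S>)"
  then obtain T where T: "T \<subseteq> carrier A" "\<S> = D_class A ` T"
    unfolding carrier_shadow by (metis subset_imageE)
  have "M \<in> carrier (shadow A)" using lub by (auto simp: least_def Upper_def)
  then obtain c where c: "c \<in> carrier A" "M = D_class A c" by (auto simp: carrier_shadow)
  have c_lub: "\<forall>x\<in>carrier A. c \<preceq> x \<longleftrightarrow> (\<forall>a\<in>T. a \<preceq> x)"
    using lub T c by (simp add: shadow_lub_iff)
  have "P c \<longleftrightarrow> (\<exists>a\<in>T. P a)"
  proof (cases "T = {}")
    case True
    then have "c \<preceq> \<zero>" using c_lub by (simp add: zero_closed)
    then have "c = \<zero>" using c by (simp add: below_zero)
    then show ?thesis using P True by (simp add: completely_prime_filter_def)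
  next
    case False
    obtain m where m: "m \<in> max_D_class A" using max_D_class_nonempty by blast
    have com: "commuting_subset A ((\<curlywedge>) m ` T)" by (rule shadow_lub_meets(1)[OF m T(1) False])
    then obtain s where s: "is_supremum A s ((\<curlywedge>) m ` T)" using join_complete by blast
    have s_lub: "s \<in> carrier A" "\<forall>c\<in>carrier A. s \<preceq> c \<longleftrightarrow> (\<forall>a\<in>T. a \<preceq> c)"
      using shadow_lub_meets(2)[OF m T(1) False s] by auto
    have "\<forall>x\<in>carrier A. c \<preceq> x \<longleftrightarrow> s \<preceq> x" using c_lub s_lub(2) by simp
    then have "c \<preceq> s" "s \<preceq> c" using c(1) s_lub(1) by (metis meet_idem)+
    then have "P c \<longleftrightarrow> P s" using completely_prime_filter_mono[OF P] c s_lub by blast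
    also have "\<dots> \<longleftrightarrow> (\<exists>a\<in>T. P (m \<curlywedge> a))"
      using P com s by (simp add: completely_prime_filter_def)
    also have "\<dots> \<longleftrightarrow> (\<exists>a\<in>T. P a)"
    proof (rule bex_cong[OF refl])
      fix a assume "a \<in> T"
      then show "P (m \<curlywedge> a) \<longleftrightarrow> P a"
        using P m T(1) max_D_class_closed[OF m] by (simp add: completely_prime_filter_def subset_iff)
    qed
    finally show ?thesis .
  qed
  moreover have "(\<exists>C\<in>\<S>. point_of A P C) \<longleftrightarrow> (\<exists>a\<in>T. P a)"
    using T point_of_D_class[OF P] by (auto simp: subset_iff)
  ultimately show "point_of A P M \<longleftrightarrow> (\<exists>C\<in>\<S>. point_of A P C)"
    using c point_of_D_class[OF P] by simp
qed

lemma mem_basic_open: "p \<in> basic_open A a \<longleftrightarrow> p \<in> points A \<and> p (D_class A a)"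
  by (simp add: basic_open_def)

lemma basic_open_meet:
  "\<lbrakk>a \<in> carrier A; b \<in> carrier A\<rbrakk> \<Longrightarrow> basic_open A (a \<curlywedge> b) = basic_open A a \<inter> basic_open A b"
  using point_meet by (auto simp: basic_open_def)

lemma basic_open_join:
  "\<lbrakk>a \<in> carrier A; b \<in> carrier A\<rbrakk> \<Longrightarrow> basic_open A (a \<curlyvee> b) = basic_open A a \<union> basic_open A b"
  using point_join by (auto simp: basic_open_def)

lemma basic_open_zero: "basic_open A \<zero> = {}"
  using point_zero by (auto simp: basic_open_def)

lemma basic_open_top: "m \<in> max_D_class A \<Longrightarrow> basic_open A m = points A"
  using point_top by (auto simp: basic_open_def)

lemma basic_open_sup:
  "\<lbrakk>commuting_subset A S; is_supremum A s S\<rbrakk> \<Longrightarrow> basic_open A s = (\<Union>a\<in>S. basic_open A a)"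
  using point_sup by (auto simp: basic_open_def)

text \<open>
  The sets \<open>U\<^sub>a\<close> are closed under unions because every set of classes has a least upper bound and
  points preserve it.
\<close>
lemma openin_pt_space: "openin (pt_space A) U \<longleftrightarrow> (\<exists>a\<in>carrier A. U = basic_open A a)"
proof -
  have "istopology (\<lambda>U. \<exists>a\<in>carrier A. U = basic_open A a)"
    unfolding istopology_def
  proof (intro conjI allI impI)
    fix U V assume "\<exists>a\<in>carrier A. U = basic_open A a" "\<exists>a\<in>carrier A. V = basic_open A a"
    then show "\<exists>a\<in>carrier A. U \<inter> V = basic_open A a"
      using basic_open_meet meet_closed by metis
  next
    fix \<K> assume K: "\<forall>U\<in>\<K>. \<exists>a\<in>carrier A. U = basic_open A a"
    define S where "S = {a \<in> carrier A. basic_open A a \<in> \<K>}"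
    have S: "S \<subseteq> carrier A" by (auto simp: S_def)
    obtain s where s: "s \<in> carrier A" "\<forall>c\<in>carrier A. s \<preceq> c \<longleftrightarrow> (\<forall>a\<in>S. a \<preceq> c)"
      using ex_lub[OF S] by blast
    have "p (D_class A s) \<longleftrightarrow> (\<exists>a\<in>S. p (D_class A a))" if "p \<in> points A" for p
      using point_lub[OF that S s(1)] s(2) by blast
    then have "basic_open A s = (\<Union>a\<in>S. basic_open A a)"
      by (auto simp: basic_open_def)
    also have "\<dots> = \<Union>\<K>" using K by (force simp: S_def)
    finally show "\<exists>a\<in>carrier A. \<Union>\<K> = basic_open A a" using s by blast
  qed
  then show ?thesis by (simp add: pt_space_def)
qed

lemma topspace_pt_space: "topspace (pt_space A) = points A"
proof -
  obtain m where "m \<in> max_D_class A" using max_D_class_nonempty by blast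
  then have "openin (pt_space A) (points A)"
    unfolding openin_pt_space using basic_open_top max_D_class_closed by blast
  moreover have "topspace (pt_space A) \<subseteq> points A"
    unfolding topspace_def openin_pt_space by (auto simp: basic_open_def)
  ultimately show ?thesis by (simp add: openin_subset subset_antisym)
qed

end

section \<open>The front topology\<close>

lemma locally_closedin_Int:
  assumes "locally_closedin Y Z" "locally_closedin Y W"
  shows "locally_closedin Y (Z \<inter> W)"
proof -
  obtain U C V D where "openin Y U" "closedin Y C" "Z = U \<inter> C" "openin Y V" "closedin Y D" "W = V \<inter> D"
    using assms by (auto simp: locally_closedin_def)
  then show ?thesis unfolding locally_closedin_def
    by (intro exI[of _ "U \<inter> V"] exI[of _ "C \<inter> D"]) auto
qed

lemma openin_front: "openin (front Y) = arbitrary union_of (locally_closedin Y)"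
  unfolding front_def by (intro topology_inverse' istopology_base locally_closedin_Int)

lemma openin_front_iff:
  "openin (front Y) W \<longleftrightarrow> (\<forall>y\<in>W. \<exists>Z. locally_closedin Y Z \<and> y \<in> Z \<and> Z \<subseteq> W)"
  unfolding openin_front by (simp add: arbitrary_union_of_alt)

lemma openin_front_locally_closed: "locally_closedin Y Z \<Longrightarrow> openin (front Y) Z"
  by (auto simp: openin_front_iff)

lemma locally_closedin_Diff:
  assumes "openin Y U" "openin Y V"
  shows "locally_closedin Y (U - V)"
  unfolding locally_closedin_def using assms openin_subset[OF assms(1)]
  by (intro exI[of _ U] exI[of _ "topspace Y - V"]) auto

lemma locally_closedin_open: "openin Y U \<Longrightarrow> locally_closedin Y U"
  using locally_closedin_Diff[of Y U "{}"] by simp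

lemma openin_front_Diff: "\<lbrakk>openin Y U; openin Y V\<rbrakk> \<Longrightarrow> openin (front Y) (U - V)"
  by (intro openin_front_locally_closed locally_closedin_Diff)

lemma openin_front_open: "openin Y U \<Longrightarrow> openin (front Y) U"
  by (intro openin_front_locally_closed locally_closedin_open)

lemma topspace_front [simp]: "topspace (front Y) = topspace Y"
proof
  show "topspace (front Y) \<subseteq> topspace Y"
  proof
    fix y assume "y \<in> topspace (front Y)"
    then obtain Z where "locally_closedin Y Z" "y \<in> Z"
      using openin_topspace[of "front Y"] unfolding openin_front_iff by blast
    then show "y \<in> topspace Y" using openin_subset unfolding locally_closedin_def by blast
  qed
qed (intro openin_subset openin_front_open openin_topspace)

lemma continuous_map_front:
  assumes f: "continuous_map Y Z f"
  shows "continuous_map (front Y) (front Z) f"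
  unfolding continuous_map_def topspace_front
proof (intro conjI allI impI)
  show "f \<in> topspace Y \<rightarrow> topspace Z" using f by (simp add: continuous_map_def)
next
  fix W assume W: "openin (front Z) W"
  show "openin (front Y) {y \<in> topspace Y. f y \<in> W}"
    unfolding openin_front_iff
  proof
    fix y assume y: "y \<in> {y \<in> topspace Y. f y \<in> W}"
    then obtain U C where UC: "openin Z U" "closedin Z C" "f y \<in> U \<inter> C" "U \<inter> C \<subseteq> W"
      using W unfolding openin_front_iff locally_closedin_def by auto
    have "locally_closedin Y ({y \<in> topspace Y. f y \<in> U} \<inter> {y \<in> topspace Y. f y \<in> C})"
      unfolding locally_closedin_def
      using openin_continuous_map_preimage[OF f UC(1)] closedin_continuous_map_preimage[OF f UC(2)]
      by blast
    then show "\<exists>K. locally_closedin Y K \<and> y \<in> K \<and> K \<subseteq> {y \<in> topspace Y. f y \<in> W}"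
      using y UC by (intro exI conjI) auto
  qed
qed

section \<open>Germs of sections\<close>

text \<open>
  The germ at \<open>y\<close> is encoded as the class of all sections, over front-open neighbourhoods of \<open>y\<close>,
  that agree with \<open>s\<close> near \<open>y\<close>. Equality of germs is thus equality of sets, also for sections
  over different sets.
\<close>
definition germ_at :: "('y, 's) fspace \<Rightarrow> 'y set \<Rightarrow> 's \<Rightarrow> 'y \<Rightarrow> ('y set \<times> 's) set" where
  "germ_at X U s y = {(V, t). fopen X V \<and> y \<in> V \<and> t \<in> sections X V \<and>
     (\<exists>N. fopen X N \<and> y \<in> N \<and> N \<subseteq> U \<inter> V \<and> restr X U N s = restr X V N t)}"

context sheaf_on_front
begin

lemma fopen_Int: "\<lbrakk>fopen X U; fopen X V\<rbrakk> \<Longrightarrow> fopen X (U \<inter> V)"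
  by (rule openin_Int)

lemma agree_on_smaller:
  assumes "fopen X U" "fopen X V" "fopen X N" "fopen X M" "M \<subseteq> N" "N \<subseteq> U \<inter> V"
    "s \<in> sections X U" "t \<in> sections X V" "restr X U N s = restr X V N t"
  shows "restr X U M s = restr X V M t"
  using assms restr_comp[of U N M s] restr_comp[of V N M t] by simp

lemma germ_at_subset:
  assumes o: "fopen X U" "fopen X V" and s: "s \<in> sections X U" "t \<in> sections X V"
    and N: "fopen X N" "y \<in> N" "N \<subseteq> U \<inter> V" "restr X U N s = restr X V N t"
  shows "germ_at X U s y \<subseteq> germ_at X V t y"
proof clarify
  fix W w assume "(W, w) \<in> germ_at X U s y"
  then obtain M where W: "fopen X W" "y \<in> W" "w \<in> sections X W"
    and M: "fopen X M" "y \<in> M" "M \<subseteq> U \<inter> W" "restr X U M s = restr X W M w"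
    by (auto simp: germ_at_def)
  have i: "fopen X (N \<inter> M)" using N M by (simp add: fopen_Int)
  have "restr X V (N \<inter> M) t = restr X U (N \<inter> M) s"
    using agree_on_smaller[OF o N(1) i _ N(3) s N(4)] by simp
  also have "\<dots> = restr X W (N \<inter> M) w"
    using agree_on_smaller[OF o(1) W(1) M(1) i _ M(3) s(1) W(3) M(4)] by simp
  finally show "(W, w) \<in> germ_at X V t y"
    using W M N i unfolding germ_at_def by blast
qed

lemma germ_at_eq_iff:
  assumes "fopen X U" "fopen X V" "s \<in> sections X U" "t \<in> sections X V" "y \<in> U"
  shows "germ_at X U s y = germ_at X V t y \<longleftrightarrow>
    (\<exists>N. fopen X N \<and> y \<in> N \<and> N \<subseteq> U \<inter> V \<and> restr X U N s = restr X V N t)" (is "_ \<longleftrightarrow> ?R")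
proof
  assume e: "germ_at X U s y = germ_at X V t y"
  have "(U, s) \<in> germ_at X U s y" using assms unfolding germ_at_def by blast
  then have "(U, s) \<in> germ_at X V t y" using e by simp
  then obtain N where "fopen X N" "y \<in> N" "N \<subseteq> V \<inter> U" "restr X V N t = restr X U N s"
    by (auto simp: germ_at_def)
  then show ?R by (metis Int_commute)
next
  assume ?R
  then obtain N where N: "fopen X N" "y \<in> N" "N \<subseteq> U \<inter> V" "restr X U N s = restr X V N t"
    by blast
  have N': "N \<subseteq> V \<inter> U" using N(3) by blast
  show "germ_at X U s y = germ_at X V t y"
    using germ_at_subset[OF assms(1,2,3,4) N]
      germ_at_subset[OF assms(2,1,4,3) N(1,2) N' N(4)[symmetric]] by blast
qed

lemma germ_at_restr:
  assumes "fopen X U" "fopen X V" "V \<subseteq> U" "s \<in> sections X U" "y \<in> V"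
  shows "germ_at X V (restr X U V s) y = germ_at X U s y"
proof -
  have "restr X U V s \<in> sections X V" using assms restr_closed by blast
  moreover have "restr X V V (restr X U V s) = restr X U V s"
    using assms by (simp add: restr_id restr_closed)
  ultimately show ?thesis
    using assms by (subst germ_at_eq_iff) (auto intro!: exI[of _ V])
qed

lemma section_eqI:
  assumes U: "fopen X U" and s: "s \<in> sections X U" and t: "t \<in> sections X U"
    and germs: "\<And>y. y \<in> U \<Longrightarrow> germ_at X U s y = germ_at X U t y"
  shows "s = t"
proof -
  let ?\<U> = "{N. fopen X N \<and> N \<subseteq> U \<and> restr X U N s = restr X U N t}"
  have "y \<in> \<Union>?\<U>" if "y \<in> U" for y
    using germs[OF that] germ_at_eq_iff[OF U U s t that] by auto
  then have Un: "\<Union>?\<U> = U" by blast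
  have "\<exists>!r. r \<in> sections X (\<Union>?\<U>) \<and> (\<forall>N\<in>?\<U>. restr X (\<Union>?\<U>) N r = restr X U N s)"
  proof (rule gluing)
    fix N M assume N: "N \<in> ?\<U>" and M: "M \<in> ?\<U>"
    then have i: "fopen X (N \<inter> M)" by (simp add: fopen_Int)
    have "restr X N (N \<inter> M) (restr X U N s) = restr X U (N \<inter> M) s"
      using N i U s by (intro restr_comp) auto
    moreover have "restr X M (N \<inter> M) (restr X U M s) = restr X U (N \<inter> M) s"
      using M i U s by (intro restr_comp) auto
    ultimately show "restr X N (N \<inter> M) (restr X U N s) = restr X M (N \<inter> M) (restr X U M s)"
      by simp
  next
    show "restr X U N s \<in> sections X N" if "N \<in> ?\<U>" for N
      using that restr_closed[OF U _ _ s] by blast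
  qed simp
  moreover have "s \<in> sections X U \<and> (\<forall>N\<in>?\<U>. restr X U N s = restr X U N s)"
    "t \<in> sections X U \<and> (\<forall>N\<in>?\<U>. restr X U N t = restr X U N s)" using s t by auto
  ultimately show ?thesis unfolding Un by blast
qed

lemma restr_eq_iff:
  assumes o: "fopen X U" "fopen X V" "fopen X N" "N \<subseteq> U" "N \<subseteq> V"
    and s: "s \<in> sections X U" "t \<in> sections X V"
  shows "restr X U N s = restr X V N t \<longleftrightarrow> (\<forall>y\<in>N. germ_at X U s y = germ_at X V t y)"
proof
  assume "\<forall>y\<in>N. germ_at X U s y = germ_at X V t y"
  then show "restr X U N s = restr X V N t"
    using o s by (intro section_eqI[OF o(3)]) (auto simp: restr_closed germ_at_restr)
next
  assume "restr X U N s = restr X V N t"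
  then show "\<forall>y\<in>N. germ_at X U s y = germ_at X V t y"
    using germ_at_restr o s by metis
qed

text \<open>
  The sheaf axiom in terms of germs. Sections over two members of the cover agree on the overlap
  because they have the same germs \<open>g\<close> there, so compatibility is automatic.
\<close>
theorem glue_germs:
  assumes "\<And>y. y \<in> U \<Longrightarrow> \<exists>W t. fopen X W \<and> y \<in> W \<and> W \<subseteq> U \<and> t \<in> sections X W \<and>
             (\<forall>z\<in>W. germ_at X W t z = g z)"
  shows "\<exists>!s. s \<in> sections X U \<and> (\<forall>y\<in>U. germ_at X U s y = g y)"
proof -
  let ?P = "\<lambda>W t. t \<in> sections X W \<and> (\<forall>z\<in>W. germ_at X W t z = g z)"
  define \<U> where "\<U> = {W. fopen X W \<and> W \<subseteq> U \<and> (\<exists>t. ?P W t)}"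
  define \<sigma> where "\<sigma> W = (SOME t. ?P W t)" for W
  have \<sigma>: "?P W (\<sigma> W)" if "W \<in> \<U>" for W
  proof -
    have "\<exists>t. ?P W t" using that unfolding \<U>_def by blast
    then show ?thesis unfolding \<sigma>_def by (rule someI_ex)
  qed
  have cover: "\<exists>W\<in>\<U>. y \<in> W" if "y \<in> U" for y
    using assms[OF that] unfolding \<U>_def by (elim exE) auto
  moreover have fopen_\<U>: "fopen X W" "W \<subseteq> U" if "W \<in> \<U>" for W
    using that by (simp_all add: \<U>_def)
  ultimately have Un: "\<Union>\<U> = U" by auto
  have "fopen X (\<Union>\<U>)" using fopen_\<U> by (intro openin_Union)
  then have U: "fopen X U" by (simp only: Un)
  have "\<exists>!r. r \<in> sections X (\<Union>\<U>) \<and> (\<forall>W\<in>\<U>. restr X (\<Union>\<U>) W r = \<sigma> W)"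
  proof (rule gluing)
    fix W V assume WV: "W \<in> \<U>" "V \<in> \<U>"
    then have o: "fopen X W" "fopen X V" "fopen X (W \<inter> V)" by (simp_all add: fopen_Int fopen_\<U>)
    have "\<sigma> W \<in> sections X W" "\<sigma> V \<in> sections X V"
      "\<forall>z\<in>W \<inter> V. germ_at X W (\<sigma> W) z = germ_at X V (\<sigma> V) z"
      using \<sigma>[OF WV(1)] \<sigma>[OF WV(2)] by simp_all
    then show "restr X W (W \<inter> V) (\<sigma> W) = restr X V (W \<inter> V) (\<sigma> V)"
      using restr_eq_iff[OF o] by blast
  next
    show "\<sigma> W \<in> sections X W" if "W \<in> \<U>" for W using \<sigma>[OF that] by blast
  qed (rule fopen_\<U>)
  then obtain r where r: "r \<in> sections X U" "\<And>W. W \<in> \<U> \<Longrightarrow> restr X U W r = \<sigma> W"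
    unfolding Un by blast
  have germs: "germ_at X U r y = g y" if y: "y \<in> U" for y
  proof -
    obtain W where W: "W \<in> \<U>" "y \<in> W" using cover[OF y] by (elim bexE)
    then have "germ_at X U r y = germ_at X W (\<sigma> W) y"
      using r(2) germ_at_restr[OF U _ _ r(1), of W y] fopen_\<U> by simp
    then show ?thesis using \<sigma>[OF W(1)] W(2) by simp
  qed
  show ?thesis
  proof (rule ex1I[of _ r])
    show "r \<in> sections X U \<and> (\<forall>y\<in>U. germ_at X U r y = g y)" using r germs by blast
    show "s = r" if "s \<in> sections X U \<and> (\<forall>y\<in>U. germ_at X U s y = g y)" for s
      using that r germs by (intro section_eqI[OF U]) auto
  qed
qed

end

section \<open>The noncommutative frame of partial sections\<close>

text \<open>
  The representation of elements of \<open>H X\<close> by partial functions. Meet and join of \<open>H X\<close> become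
  restriction and overriding of partial functions, and the natural order becomes extension.
\<close>
definition germ_map :: "('y, 's) fspace \<Rightarrow> 'y set \<times> 's \<Rightarrow> 'y \<rightharpoonup> ('y set \<times> 's) set" where
  "germ_map X x y = (if y \<in> fst x then Some (germ_at X (fst x) (snd x) y) else None)"

lemma dom_germ_map [simp]: "dom (germ_map X x) = fst x"
  by (auto simp: germ_map_def dom_def)

lemma germ_map_None_iff: "germ_map X x p = None \<longleftrightarrow> p \<notin> fst x"
  by (simp add: germ_map_def)

lemma mem_H_obj: "x \<in> carrier (H_obj X) \<longleftrightarrow> openin (space X) (fst x) \<and> snd x \<in> sections X (fst x)"
  by (auto simp: H_obj_def)

lemma H_obj_D:
  assumes "x \<in> carrier (H_obj X)"
  shows "openin (space X) (fst x)" "fopen X (fst x)" "snd x \<in> sections X (fst x)"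
  using assms by (auto simp: mem_H_obj openin_front_open)

lemma fst_meet [simp]: "fst (x \<curlywedge>\<^bsub>H_obj X\<^esub> y) = fst x \<inter> fst y"
  by (cases x; cases y) (simp add: H_obj_def)

lemma fst_join [simp]: "fst (x \<curlyvee>\<^bsub>H_obj X\<^esub> y) = fst x \<union> fst y"
  by (cases x; cases y) (simp add: H_obj_def)

lemma fst_zero [simp]: "fst \<zero>\<^bsub>H_obj X\<^esub> = {}"
  by (simp add: H_obj_def)

context sheaf_on_front
begin

lemma germ_map_inj:
  assumes x: "x \<in> carrier (H_obj X)" and y: "y \<in> carrier (H_obj X)" and e: "germ_map X x = germ_map X y"
  shows "x = y"
proof -
  have f: "fst x = fst y" using e dom_germ_map by metis
  have "snd x = snd y"
  proof (rule section_eqI)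
    fix z assume "z \<in> fst y"
    then show "germ_at X (fst y) (snd x) z = germ_at X (fst y) (snd y) z"
      using fun_cong[OF e, of z] f by (simp add: germ_map_def)
  qed (use x y f in \<open>auto dest: H_obj_D\<close>)
  then show ?thesis using f by (simp add: prod_eq_iff)
qed

lemma H_meet_closed:
  assumes "x \<in> carrier (H_obj X)" "y \<in> carrier (H_obj X)"
  shows "x \<curlywedge>\<^bsub>H_obj X\<^esub> y \<in> carrier (H_obj X)"
  using assms H_obj_D[OF assms(1)] H_obj_D[OF assms(2)]
  by (cases x; cases y) (auto simp: H_obj_def intro!: restr_closed fopen_Int)

lemma germ_map_meet:
  assumes "x \<in> carrier (H_obj X)" "y \<in> carrier (H_obj X)"
  shows "germ_map X (x \<curlywedge>\<^bsub>H_obj X\<^esub> y) p = (case germ_map X y p of None \<Rightarrow> None | Some _ \<Rightarrow> germ_map X x p)"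
  using H_obj_D[OF assms(1)] H_obj_D[OF assms(2)]
  by (cases x; cases y) (auto simp: H_obj_def germ_map_def germ_at_restr fopen_Int)

text \<open>
  The join is glued from the restriction of \<open>s\<close> to \<open>U - V\<close> and from \<open>t\<close>. Here the front topology
  is essential: it makes the difference \<open>U - V\<close> of two open sets open.
\<close>
lemma join_section:
  assumes x: "(U, s) \<in> carrier (H_obj X)" and y: "(V, t) \<in> carrier (H_obj X)"
  shows "\<exists>!r. r \<in> sections X (U \<union> V) \<and>
           restr X (U \<union> V) (U - V) r = restr X U (U - V) s \<and> restr X (U \<union> V) V r = t"
proof -
  note xD = H_obj_D[OF x, simplified] and yD = H_obj_D[OF y, simplified]
  have D: "fopen X (U - V)" using xD yD by (simp add: openin_front_Diff)
  have Un: "fopen X (U \<union> V)" using xD yD by blast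
  define g where "g z = (if z \<in> V then germ_at X V t z else germ_at X U s z)" for z
  have "\<exists>!r. r \<in> sections X (U \<union> V) \<and> (\<forall>z\<in>U \<union> V. germ_at X (U \<union> V) r z = g z)"
  proof (rule glue_germs)
    fix z assume z: "z \<in> U \<union> V"
    show "\<exists>W w. fopen X W \<and> z \<in> W \<and> W \<subseteq> U \<union> V \<and> w \<in> sections X W \<and> (\<forall>z\<in>W. germ_at X W w z = g z)"
    proof (cases "z \<in> V")
      case True
      then show ?thesis using yD by (intro exI[of _ V] exI[of _ t]) (auto simp: g_def)
    next
      case False
      then show ?thesis using z xD D
        by (intro exI[of _ "U - V"] exI[of _ "restr X U (U - V) s"])
          (auto simp: g_def germ_at_restr restr_closed)
    qed
  qed
  then obtain r where r: "r \<in> sections X (U \<union> V)" "\<forall>z\<in>U \<union> V. germ_at X (U \<union> V) r z = g z"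
    and uniq: "\<And>r'. \<lbrakk>r' \<in> sections X (U \<union> V); \<forall>z\<in>U \<union> V. germ_at X (U \<union> V) r' z = g z\<rbrakk> \<Longrightarrow> r' = r"
    by blast
  have key: "(\<forall>z\<in>U \<union> V. germ_at X (U \<union> V) r z = g z) \<longleftrightarrow>
      restr X (U \<union> V) (U - V) r = restr X U (U - V) s \<and> restr X (U \<union> V) V r = t"
    if r: "r \<in> sections X (U \<union> V)" for r
  proof -
    have "restr X (U \<union> V) (U - V) r = restr X U (U - V) s \<longleftrightarrow>
        (\<forall>z\<in>U - V. germ_at X (U \<union> V) r z = germ_at X U s z)"
      using restr_eq_iff[OF Un xD(2) D _ _ r xD(3)] by blast
    moreover have "restr X (U \<union> V) V r = restr X V V t \<longleftrightarrow>
        (\<forall>z\<in>V. germ_at X (U \<union> V) r z = germ_at X V t z)"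
      using restr_eq_iff[OF Un yD(2) yD(2) _ _ r yD(3)] by blast
    moreover have "(\<forall>z\<in>U \<union> V. germ_at X (U \<union> V) r z = g z) \<longleftrightarrow>
        (\<forall>z\<in>U - V. germ_at X (U \<union> V) r z = germ_at X U s z) \<and>
        (\<forall>z\<in>V. germ_at X (U \<union> V) r z = germ_at X V t z)"
      by (auto simp: g_def)
    ultimately show ?thesis using restr_id[OF yD(2,3)] by simp
  qed
  show ?thesis
  proof (rule ex1I)
    show "r \<in> sections X (U \<union> V) \<and>
        restr X (U \<union> V) (U - V) r = restr X U (U - V) s \<and> restr X (U \<union> V) V r = t"
      by (rule conjI[OF r(1) iffD1[OF key[OF r(1)] r(2)]])
  next
    fix r' assume r': "r' \<in> sections X (U \<union> V) \<and>
        restr X (U \<union> V) (U - V) r' = restr X U (U - V) s \<and> restr X (U \<union> V) V r' = t"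
    show "r' = r"
      by (rule uniq[OF conjunct1[OF r'] iffD2[OF key[OF conjunct1[OF r']] conjunct2[OF r']]])
  qed
qed

lemma H_join:
  assumes x: "x \<in> carrier (H_obj X)" and y: "y \<in> carrier (H_obj X)"
  shows "x \<curlyvee>\<^bsub>H_obj X\<^esub> y \<in> carrier (H_obj X)"
    and "germ_map X (x \<curlyvee>\<^bsub>H_obj X\<^esub> y) p =
      (case germ_map X y p of None \<Rightarrow> germ_map X x p | Some g \<Rightarrow> Some g)"
proof -
  obtain U s V t where xy: "x = (U, s)" "y = (V, t)" by (cases x; cases y)
  note xD = H_obj_D[OF x[unfolded xy], simplified] and yD = H_obj_D[OF y[unfolded xy], simplified]
  have D: "fopen X (U - V)" using xD yD by (simp add: openin_front_Diff)
  have Un: "fopen X (U \<union> V)" using xD yD by blast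
  let ?P = "\<lambda>r. r \<in> sections X (U \<union> V) \<and>
           restr X (U \<union> V) (U - V) r = restr X U (U - V) s \<and> restr X (U \<union> V) V r = t"
  define r where "r = (THE r. ?P r)"
  have r: "?P r" unfolding r_def by (rule theI') (rule join_section[OF x[unfolded xy] y[unfolded xy]])
  have j: "x \<curlyvee>\<^bsub>H_obj X\<^esub> y = (U \<union> V, r)" by (simp add: xy H_obj_def r_def)
  show "x \<curlyvee>\<^bsub>H_obj X\<^esub> y \<in> carrier (H_obj X)"
    using r xD yD by (simp add: j mem_H_obj openin_Un)
  have "germ_at X (U \<union> V) r p = germ_at X V t p" if "p \<in> V"
    using germ_at_restr[of "U \<union> V" V r p] that r Un yD by simp
  moreover have "germ_at X (U \<union> V) r p = germ_at X U s p" if "p \<in> U - V"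
    using germ_at_restr[of "U \<union> V" "U - V" r p] germ_at_restr[of U "U - V" s p] that r Un D xD by auto
  ultimately show "germ_map X (x \<curlyvee>\<^bsub>H_obj X\<^esub> y) p =
      (case germ_map X y p of None \<Rightarrow> germ_map X x p | Some g \<Rightarrow> Some g)"
    unfolding j by (simp add: germ_map_def xy)
qed

lemma H_zero_closed: "\<zero>\<^bsub>H_obj X\<^esub> \<in> carrier (H_obj X)"
proof -
  have "\<exists>!s. s \<in> sections X {} \<and> (\<forall>y\<in>{}. germ_at X {} s y = {})"
    by (rule glue_germs) simp
  then have "\<exists>!s. s \<in> sections X {}" by simp
  then have "(THE s. s \<in> sections X {}) \<in> sections X {}" by (rule theI')
  then show ?thesis by (simp add: H_obj_def)
qed

lemma germ_map_zero: "germ_map X \<zero>\<^bsub>H_obj X\<^esub> p = None"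
  by (simp add: germ_map_def)

lemmas H_closed = H_meet_closed H_join(1) H_zero_closed
lemmas germ_map_simps = germ_map_meet H_join(2) germ_map_zero

lemma germ_map_meet_on:
  assumes "x \<in> carrier (H_obj X)" "y \<in> carrier (H_obj X)" "p \<in> fst y"
  shows "germ_map X (x \<curlywedge>\<^bsub>H_obj X\<^esub> y) p = germ_map X x p"
  using germ_map_meet[OF assms(1,2), of p] assms(3) germ_map_None_iff[of X y p]
  by (cases "germ_map X y p") simp_all

lemma germ_map_join_on:
  assumes "x \<in> carrier (H_obj X)" "y \<in> carrier (H_obj X)" "p \<in> fst y"
  shows "germ_map X (x \<curlyvee>\<^bsub>H_obj X\<^esub> y) p = germ_map X y p"
  using H_join(2)[OF assms(1,2), of p] assms(3) germ_map_None_iff[of X y p]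
  by (cases "germ_map X y p") simp_all

lemma germ_map_join_off:
  assumes "x \<in> carrier (H_obj X)" "y \<in> carrier (H_obj X)" "p \<notin> fst y"
  shows "germ_map X (x \<curlyvee>\<^bsub>H_obj X\<^esub> y) p = germ_map X x p"
  using H_join(2)[OF assms(1,2), of p] assms(3) germ_map_None_iff[of X y p] by simp

lemma H_natural_le_iff:
  assumes "x \<in> carrier (H_obj X)" "y \<in> carrier (H_obj X)"
  shows "natural_le (H_obj X) x y \<longleftrightarrow> germ_map X x \<subseteq>\<^sub>m germ_map X y"
proof
  assume "natural_le (H_obj X) x y"
  then have e: "x \<curlywedge>\<^bsub>H_obj X\<^esub> y = x" "y \<curlywedge>\<^bsub>H_obj X\<^esub> x = x" by (simp_all add: natural_le_def)
  show "germ_map X x \<subseteq>\<^sub>m germ_map X y"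
    unfolding map_le_def
  proof
    fix p assume "p \<in> dom (germ_map X x)"
    then show "germ_map X x p = germ_map X y p"
      using germ_map_meet[OF assms(2,1), of p] e
      by (cases "germ_map X x p") (auto simp: germ_map_None_iff)
  qed
next
  assume le: "germ_map X x \<subseteq>\<^sub>m germ_map X y"
  have "germ_map X (x \<curlywedge>\<^bsub>H_obj X\<^esub> y) p = germ_map X x p" "germ_map X (y \<curlywedge>\<^bsub>H_obj X\<^esub> x) p = germ_map X x p" for p
    using le assms by (cases "germ_map X x p"; force simp: germ_map_meet map_le_def dom_def split: option.split)+
  then show "natural_le (H_obj X) x y"
    unfolding natural_le_def using assms by (auto intro!: germ_map_inj H_closed)
qed

lemma H_commuting_agree:
  assumes "commuting_subset (H_obj X) S" "x \<in> S" "y \<in> S" "p \<in> fst x" "p \<in> fst y"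
  shows "germ_map X x p = germ_map X y p"
proof -
  have xy: "x \<in> carrier (H_obj X)" "y \<in> carrier (H_obj X)"
    and "x \<curlywedge>\<^bsub>H_obj X\<^esub> y = y \<curlywedge>\<^bsub>H_obj X\<^esub> x"
    using assms by (auto simp: commuting_subset_def)
  then have "germ_map X (x \<curlywedge>\<^bsub>H_obj X\<^esub> y) p = germ_map X (y \<curlywedge>\<^bsub>H_obj X\<^esub> x) p" by simp
  then show ?thesis using xy assms(4,5)
    by (cases "germ_map X x p"; cases "germ_map X y p") (auto simp: germ_map_meet germ_map_None_iff)
qed

lemma H_supremumI:
  assumes S: "S \<subseteq> carrier (H_obj X)" and z: "z \<in> carrier (H_obj X)" "fst z = (\<Union>x\<in>S. fst x)"
    and le: "\<And>x. x \<in> S \<Longrightarrow> germ_map X x \<subseteq>\<^sub>m germ_map X z"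
  shows "is_supremum (H_obj X) z S"
  unfolding is_supremum_iff[OF S]
proof (intro conjI ballI impI)
  show "natural_le (H_obj X) x z" if "x \<in> S" for x
    using le[OF that] subsetD[OF S that] z by (simp add: H_natural_le_iff)
  fix u assume u: "u \<in> carrier (H_obj X)" "\<forall>x\<in>S. natural_le (H_obj X) x u"
  have "germ_map X z p = germ_map X u p" if "p \<in> fst z" for p
  proof -
    obtain x where x: "x \<in> S" "p \<in> fst x" using \<open>p \<in> fst z\<close> unfolding z(2) by (elim UN_E)
    have "germ_map X x \<subseteq>\<^sub>m germ_map X u" using u x S by (auto simp flip: H_natural_le_iff)
    then show ?thesis using le[OF x(1)] x(2) by (simp add: map_le_def)
  qed
  then show "natural_le (H_obj X) z u" using z u by (simp add: H_natural_le_iff map_le_def)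
qed (rule z)

text \<open>
  Commuting elements have the same germs wherever both are defined, so their germs glue to a
  section over the union of their domains.
\<close>
lemma H_union:
  assumes S: "commuting_subset (H_obj X) S"
  shows "\<exists>z\<in>carrier (H_obj X). fst z = (\<Union>x\<in>S. fst x) \<and> (\<forall>x\<in>S. germ_map X x \<subseteq>\<^sub>m germ_map X z)"
proof -
  have sub: "S \<subseteq> carrier (H_obj X)" using S by (simp add: commuting_subset_def)
  let ?U = "\<Union>x\<in>S. fst x"
  define g where "g p = the (germ_map X (SOME x. x \<in> S \<and> p \<in> fst x) p)" for p
  have g: "germ_map X x p = Some (g p)" if "x \<in> S" "p \<in> fst x" for x p
  proof -
    let ?x = "SOME x. x \<in> S \<and> p \<in> fst x"
    have "?x \<in> S \<and> p \<in> fst ?x" using that by (intro someI[of "\<lambda>x. x \<in> S \<and> p \<in> fst x"]) simp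
    then have "germ_map X x p = germ_map X ?x p" "\<exists>a. germ_map X ?x p = Some a"
      using H_commuting_agree[OF S that(1) _ that(2)] by (auto simp: germ_map_def)
    then show ?thesis unfolding g_def by auto
  qed
  have "\<exists>!s. s \<in> sections X ?U \<and> (\<forall>p\<in>?U. germ_at X ?U s p = g p)"
  proof (rule glue_germs)
    fix p assume "p \<in> ?U"
    then obtain x where x: "x \<in> S" "p \<in> fst x" by blast
    then show "\<exists>W t. fopen X W \<and> p \<in> W \<and> W \<subseteq> ?U \<and> t \<in> sections X W \<and> (\<forall>z\<in>W. germ_at X W t z = g z)"
      using sub H_obj_D[of x X] g[OF x(1)]
      by (intro exI[of _ "fst x"] exI[of _ "snd x"]) (auto simp: germ_map_def)
  qed
  then obtain s where s: "s \<in> sections X ?U" "\<And>p. p \<in> ?U \<Longrightarrow> germ_at X ?U s p = g p" by blast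
  have "openin (space X) ?U" using sub by (intro openin_Union) (auto dest: H_obj_D)
  then have "(?U, s) \<in> carrier (H_obj X)" using s by (simp add: mem_H_obj)
  moreover have "germ_map X x \<subseteq>\<^sub>m germ_map X (?U, s)" if "x \<in> S" for x
    unfolding map_le_def
  proof
    fix p assume "p \<in> dom (germ_map X x)"
    then have p: "p \<in> fst x" by simp
    then have "p \<in> ?U" using that by blast
    then show "germ_map X x p = germ_map X (?U, s) p"
      using g[OF that p] s(2)[of p] by (simp add: germ_map_def)
  qed
  ultimately show ?thesis by (intro bexI[of _ "(?U, s)"]) auto
qed

lemma H_supremum_iff:
  assumes S: "commuting_subset (H_obj X) S"
  shows "is_supremum (H_obj X) z S \<longleftrightarrow> z \<in> carrier (H_obj X) \<and> fst z = (\<Union>x\<in>S. fst x) \<and>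
           (\<forall>x\<in>S. germ_map X x \<subseteq>\<^sub>m germ_map X z)"
proof
  have sub: "S \<subseteq> carrier (H_obj X)" using S by (simp add: commuting_subset_def)
  show "is_supremum (H_obj X) z S" if "z \<in> carrier (H_obj X) \<and> fst z = (\<Union>x\<in>S. fst x) \<and>
      (\<forall>x\<in>S. germ_map X x \<subseteq>\<^sub>m germ_map X z)"
    using that sub by (intro H_supremumI) auto
  assume z: "is_supremum (H_obj X) z S"
  obtain u where u: "u \<in> carrier (H_obj X)" "fst u = (\<Union>x\<in>S. fst x)"
    "\<forall>x\<in>S. germ_map X x \<subseteq>\<^sub>m germ_map X u" using H_union[OF S] by blast
  then have "is_supremum (H_obj X) u S" using sub by (intro H_supremumI) auto
  then have "z = u" using is_supremum_unique[OF sub z] by simp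
  then show "z \<in> carrier (H_obj X) \<and> fst z = (\<Union>x\<in>S. fst x) \<and> (\<forall>x\<in>S. germ_map X x \<subseteq>\<^sub>m germ_map X z)"
    using u by blast
qed

theorem left_handed_noncommutative_frame_H: "left_handed_noncommutative_frame (H_obj X)"
proof unfold_locales
  fix S z y
  assume S: "commuting_subset (H_obj X) S" and z: "is_supremum (H_obj X) z S" 
    and y: "y \<in> carrier (H_obj X)"
  have sub: "S \<subseteq> carrier (H_obj X)" using S by (simp add: commuting_subset_def)
  have zD: "z \<in> carrier (H_obj X)" "fst z = (\<Union>x\<in>S. fst x)"
    "\<And>x p. \<lbrakk>x \<in> S; p \<in> fst x\<rbrakk> \<Longrightarrow> germ_map X x p = germ_map X z p"
    using z unfolding H_supremum_iff[OF S] map_le_def by auto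
  show "is_supremum (H_obj X) (z \<curlywedge>\<^bsub>H_obj X\<^esub> y) ((\<lambda>x. x \<curlywedge>\<^bsub>H_obj X\<^esub> y) ` S)"
    using sub y zD
    by (intro H_supremumI)
      (auto intro!: H_closed simp: map_le_def germ_map_meet subset_iff split: option.split)
  show "is_supremum (H_obj X) (y \<curlywedge>\<^bsub>H_obj X\<^esub> z) ((\<lambda>x. y \<curlywedge>\<^bsub>H_obj X\<^esub> x) ` S)"
  proof (rule H_supremumI)
    fix w assume "w \<in> (\<lambda>x. y \<curlywedge>\<^bsub>H_obj X\<^esub> x) ` S"
    then obtain x where x: "x \<in> S" "w = y \<curlywedge>\<^bsub>H_obj X\<^esub> x" by blast
    have "germ_map X w p = germ_map X (y \<curlywedge>\<^bsub>H_obj X\<^esub> z) p" if "p \<in> fst x" for p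
      using zD(3)[OF x(1) that] y zD(1) subsetD[OF sub x(1)]
      unfolding x(2) by (simp add: germ_map_meet)
    then show "germ_map X w \<subseteq>\<^sub>m germ_map X (y \<curlywedge>\<^bsub>H_obj X\<^esub> z)"
      unfolding map_le_def x(2) by simp
  qed (use sub y zD in \<open>auto intro!: H_closed\<close>)
next
  show "\<exists>s. is_supremum (H_obj X) s S" if "commuting_subset (H_obj X) S" for S
    using H_union[OF that] unfolding H_supremum_iff[OF that] by blast
qed (auto intro!: H_closed germ_map_inj simp: germ_map_simps H_closed fun_eq_iff split: option.split)

end

text \<open>
  Elements of \<open>H X\<close> are compared in the shadow by their domains alone. A global section makes the
  whole space one of these domains, so the maximal class consists of the global sections.
\<close>
lemma (in sh_object) mem_max_D_class_H:
  "m \<in> max_D_class (H_obj X) \<longleftrightarrow> m \<in> carrier (H_obj X) \<and> fst m = topspace (space X)"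
proof -
  interpret H: left_handed_noncommutative_frame "H_obj X"
    by (rule left_handed_noncommutative_frame_H)
  have below: "a \<curlywedge>\<^bsub>H_obj X\<^esub> m = a \<longleftrightarrow> fst a \<subseteq> fst m"
    if "a \<in> carrier (H_obj X)" "m \<in> carrier (H_obj X)" for a m
  proof
    assume "a \<curlywedge>\<^bsub>H_obj X\<^esub> m = a"
    then show "fst a \<subseteq> fst m" using fst_meet[of X a m] by auto
  next
    assume sub: "fst a \<subseteq> fst m"
    have "germ_map X (a \<curlywedge>\<^bsub>H_obj X\<^esub> m) p = germ_map X a p" for p
      using that sub germ_map_None_iff[of X a p] germ_map_None_iff[of X m p]
      by (cases "germ_map X m p") (auto simp: germ_map_meet)
    then show "a \<curlywedge>\<^bsub>H_obj X\<^esub> m = a" using that by (intro germ_map_inj H_closed) auto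
  qed
  obtain g where g: "g \<in> sections X (topspace (space X))" using global_section by blast
  then have gc: "(topspace (space X), g) \<in> carrier (H_obj X)" by (simp add: mem_H_obj)
  have sub: "fst a \<subseteq> topspace (space X)" if "a \<in> carrier (H_obj X)" for a
    using that by (simp add: mem_H_obj openin_subset)
  show ?thesis
  proof
    assume "m \<in> max_D_class (H_obj X)"
    then have m: "m \<in> carrier (H_obj X)" "\<forall>a\<in>carrier (H_obj X). a \<curlywedge>\<^bsub>H_obj X\<^esub> m = a"
      by (simp_all add: H.mem_max_D_class_iff)
    then have "topspace (space X) \<subseteq> fst m" using below[OF gc m(1)] gc by auto
    then show "m \<in> carrier (H_obj X) \<and> fst m = topspace (space X)" using m(1) sub by blast
  next
    assume "m \<in> carrier (H_obj X) \<and> fst m = topspace (space X)"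
    then show "m \<in> max_D_class (H_obj X)"
      using below sub by (simp add: H.mem_max_D_class_iff)
  qed
qed

section \<open>Morphisms of noncommutative frames\<close>

text \<open>
  The image of a commuting subset commutes again. This makes preservation of suprema stable under
  composition.
\<close>
lemma hom_commuting_image:
  assumes A: "skew_lattice A"
    and c: "\<And>x. x \<in> carrier A \<Longrightarrow> \<phi> x \<in> carrier B"
    and m: "\<And>x y. \<lbrakk>x \<in> carrier A; y \<in> carrier A\<rbrakk> \<Longrightarrow> \<phi> (x \<curlywedge>\<^bsub>A\<^esub> y) = \<phi> x \<curlywedge>\<^bsub>B\<^esub> \<phi> y"
    and j: "\<And>x y. \<lbrakk>x \<in> carrier A; y \<in> carrier A\<rbrakk> \<Longrightarrow> \<phi> (x \<curlyvee>\<^bsub>A\<^esub> y) = \<phi> x \<curlyvee>\<^bsub>B\<^esub> \<phi> y"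
    and S: "commuting_subset A S"
  shows "commuting_subset B (\<phi> ` S)"
proof -
  have sub: "\<And>x. x \<in> S \<Longrightarrow> x \<in> carrier A" "S \<noteq> {}"
    and com: "\<And>x y. \<lbrakk>x \<in> S; y \<in> S\<rbrakk> \<Longrightarrow> x \<curlywedge>\<^bsub>A\<^esub> y = y \<curlywedge>\<^bsub>A\<^esub> x \<and> x \<curlyvee>\<^bsub>A\<^esub> y = y \<curlyvee>\<^bsub>A\<^esub> x"
    using S by (auto simp: commuting_subset_def)
  have "\<phi> x \<curlywedge>\<^bsub>B\<^esub> \<phi> y = \<phi> y \<curlywedge>\<^bsub>B\<^esub> \<phi> x \<and> \<phi> x \<curlyvee>\<^bsub>B\<^esub> \<phi> y = \<phi> y \<curlyvee>\<^bsub>B\<^esub> \<phi> x" if "x \<in> S" "y \<in> S" for x y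
    using com[OF that] sub(1)[OF that(1)] sub(1)[OF that(2)] by (simp flip: m j)
  then show ?thesis using sub c by (auto simp: commuting_subset_def)
qed

lemma lnf_homD:
  assumes "\<phi> \<in> lnf_hom A B"
  shows "\<phi> \<in> extensional (carrier A)"
    and "\<And>x. x \<in> carrier A \<Longrightarrow> \<phi> x \<in> carrier B"
    and "\<And>x y. \<lbrakk>x \<in> carrier A; y \<in> carrier A\<rbrakk> \<Longrightarrow> \<phi> (x \<curlywedge>\<^bsub>A\<^esub> y) = \<phi> x \<curlywedge>\<^bsub>B\<^esub> \<phi> y"
    and "\<And>x y. \<lbrakk>x \<in> carrier A; y \<in> carrier A\<rbrakk> \<Longrightarrow> \<phi> (x \<curlyvee>\<^bsub>A\<^esub> y) = \<phi> x \<curlyvee>\<^bsub>B\<^esub> \<phi> y"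
    and "\<phi> \<zero>\<^bsub>A\<^esub> = \<zero>\<^bsub>B\<^esub>"
    and "\<And>S s. \<lbrakk>commuting_subset A S; is_supremum A s S\<rbrakk> \<Longrightarrow> is_supremum B (\<phi> s) (\<phi> ` S)"
    and "\<And>m. m \<in> max_D_class A \<Longrightarrow> \<phi> m \<in> max_D_class B"
  using assms unfolding lnf_hom_def by (auto simp: PiE_iff)

lemma lnf_homI:
  assumes "\<phi> \<in> extensional (carrier A)"
    and "\<And>x. x \<in> carrier A \<Longrightarrow> \<phi> x \<in> carrier B"
    and "\<And>x y. \<lbrakk>x \<in> carrier A; y \<in> carrier A\<rbrakk> \<Longrightarrow> \<phi> (x \<curlywedge>\<^bsub>A\<^esub> y) = \<phi> x \<curlywedge>\<^bsub>B\<^esub> \<phi> y"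
    and "\<And>x y. \<lbrakk>x \<in> carrier A; y \<in> carrier A\<rbrakk> \<Longrightarrow> \<phi> (x \<curlyvee>\<^bsub>A\<^esub> y) = \<phi> x \<curlyvee>\<^bsub>B\<^esub> \<phi> y"
    and "\<phi> \<zero>\<^bsub>A\<^esub> = \<zero>\<^bsub>B\<^esub>"
    and "\<And>S s. \<lbrakk>commuting_subset A S; is_supremum A s S\<rbrakk> \<Longrightarrow> is_supremum B (\<phi> s) (\<phi> ` S)"
    and "\<And>m. m \<in> max_D_class A \<Longrightarrow> \<phi> m \<in> max_D_class B"
  shows "\<phi> \<in> lnf_hom A B"
  using assms unfolding lnf_hom_def PiE_def by blast

lemma lnf_hom_compose:
  assumes A: "left_handed_noncommutative_frame A"
    and \<phi>: "\<phi> \<in> lnf_hom A B" and \<psi>: "\<psi> \<in> lnf_hom B C"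
  shows "compose (carrier A) \<psi> \<phi> \<in> lnf_hom A C"
proof -
  interpret A: left_handed_noncommutative_frame A by (rule A)
  note \<phi>D = lnf_homD[OF \<phi>] and \<psi>D = lnf_homD[OF \<psi>]
  have app: "compose (carrier A) \<psi> \<phi> x = \<psi> (\<phi> x)" if "x \<in> carrier A" for x
    using that by (rule compose_eq)
  show ?thesis
  proof (rule lnf_homI)
    show "compose (carrier A) \<psi> \<phi> m \<in> max_D_class C" if "m \<in> max_D_class A" for m
      using \<psi>D(7)[OF \<phi>D(7)[OF that]] app[OF A.max_D_class_closed[OF that]] by simp
  next
    fix S s assume S: "commuting_subset A S" and s: "is_supremum A s S"
    have sub: "S \<subseteq> carrier A" using S by (simp add: commuting_subset_def)
    have sc: "s \<in> carrier A" using s by (simp add: is_supremum_iff[OF sub])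
    have im: "compose (carrier A) \<psi> \<phi> ` S = \<psi> ` \<phi> ` S"
      unfolding image_image using sub app by (intro image_cong) auto
    have "commuting_subset B (\<phi> ` S)"
      by (rule hom_commuting_image[OF A.skew_lattice_axioms \<phi>D(2-4) S])
    then show "is_supremum C (compose (carrier A) \<psi> \<phi> s) (compose (carrier A) \<psi> \<phi> ` S)"
      unfolding im app[OF sc] by (rule \<psi>D(6)) (rule \<phi>D(6)[OF S s])
  qed (simp_all add: app \<phi>D(2-5) \<psi>D(2-5))
qed

lemma lnf_id_hom:
  assumes "left_handed_noncommutative_frame A"
  shows "lnf_id A \<in> lnf_hom A A"
proof -
  interpret A: left_handed_noncommutative_frame A by (rule assms)
  show ?thesis
  proof (rule lnf_homI)
    fix S s assume S: "commuting_subset A S" and s: "is_supremum A s S"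
    have sub: "S \<subseteq> carrier A" using S by (simp add: commuting_subset_def)
    have "s \<in> carrier A" using s by (simp add: is_supremum_iff[OF sub])
    moreover have "lnf_id A ` S = S" using sub by (force simp: lnf_id_def)
    ultimately show "is_supremum A (lnf_id A s) (lnf_id A ` S)" using s by (simp add: lnf_id_def)
  qed (simp_all add: lnf_id_def A.max_D_class_closed)
qed

section \<open>Morphisms of sheaves\<close>

lemma sh_homD:
  assumes "(f, l) \<in> sh_hom X Y"
  shows "continuous_map (space X) (space Y) f"
    and "f \<in> extensional (topspace (space X))"
    and "\<And>V s. \<lbrakk>fopen Y V; s \<in> sections Y V\<rbrakk> \<Longrightarrow> l V s \<in> sections X (preim X f V)"
    and "\<And>U V s. \<lbrakk>fopen Y U; fopen Y V; V \<subseteq> U; s \<in> sections Y U\<rbrakk> \<Longrightarrow>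
           l V (restr Y U V s) = restr X (preim X f U) (preim X f V) (l U s)"
    and "l \<in> extensional {V. fopen Y V}"
    and "\<And>V. fopen Y V \<Longrightarrow> l V \<in> extensional (sections Y V)"
  using assms unfolding sh_hom_def by (auto simp: PiE_iff)

lemma sh_homI:
  assumes "continuous_map (space X) (space Y) f" "f \<in> extensional (topspace (space X))"
    and "l \<in> extensional {V. fopen Y V}" "\<And>V. fopen Y V \<Longrightarrow> l V \<in> extensional (sections Y V)"
    and "\<And>V s. \<lbrakk>fopen Y V; s \<in> sections Y V\<rbrakk> \<Longrightarrow> l V s \<in> sections X (preim X f V)"
    and "\<And>U V s. \<lbrakk>fopen Y U; fopen Y V; V \<subseteq> U; s \<in> sections Y U\<rbrakk> \<Longrightarrow>
           l V (restr Y U V s) = restr X (preim X f U) (preim X f V) (l U s)"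
  shows "(f, l) \<in> sh_hom X Y"
  using assms unfolding sh_hom_def by (simp add: PiE_iff)

lemma mem_preim: "y \<in> preim X f V \<longleftrightarrow> y \<in> topspace (space X) \<and> f y \<in> V"
  by (simp add: preim_def)

lemma openin_preim:
  "\<lbrakk>continuous_map (space X) (space Y) f; openin (space Y) V\<rbrakk> \<Longrightarrow> openin (space X) (preim X f V)"
  unfolding preim_def by (rule openin_continuous_map_preimage)

lemma fopen_preim:
  assumes "continuous_map (space X) (space Y) f" "fopen Y V"
  shows "fopen X (preim X f V)"
  using openin_continuous_map_preimage[OF continuous_map_front[OF assms(1)] assms(2)]
  by (simp add: preim_def)

text \<open>
  A sheaf morphism acts on germs: the germ of \<open>l U s\<close> at \<open>y\<close> depends only on the germ of \<open>s\<close>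
  at \<open>f y\<close>, because \<open>l\<close> commutes with restriction to a neighbourhood on which two sections agree.
\<close>
lemma germ_at_hom:
  assumes X: "sheaf_on_front X" and Y: "sheaf_on_front Y" and h: "(f, l) \<in> sh_hom X Y"
    and o: "fopen Y U" "fopen Y V" and s: "s \<in> sections Y U" "t \<in> sections Y V"
    and y: "y \<in> topspace (space X)" "f y \<in> U"
    and e: "germ_at Y U s (f y) = germ_at Y V t (f y)"
  shows "germ_at X (preim X f U) (l U s) y = germ_at X (preim X f V) (l V t) y"
proof -
  note hD = sh_homD[OF h]
  obtain N where N: "fopen Y N" "f y \<in> N" "N \<subseteq> U \<inter> V" "restr Y U N s = restr Y V N t"
    using sheaf_on_front.germ_at_eq_iff[OF Y o s y(2)] e by blast
  have "restr X (preim X f U) (preim X f N) (l U s) = restr X (preim X f V) (preim X f N) (l V t)"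
    using hD(4)[OF o(1) N(1) _ s(1)] hD(4)[OF o(2) N(1) _ s(2)] N(3,4) by simp
  moreover have "y \<in> preim X f N" "preim X f N \<subseteq> preim X f U \<inter> preim X f V" "y \<in> preim X f U"
    using y N by (auto simp: mem_preim)
  ultimately show ?thesis
    using sheaf_on_front.germ_at_eq_iff[OF X fopen_preim[OF hD(1) o(1)] fopen_preim[OF hD(1) o(2)]
        hD(3)[OF o(1) s(1)] hD(3)[OF o(2) s(2)]] fopen_preim[OF hD(1) N(1)] by blast
qed

lemma preim_id: "fopen X V \<Longrightarrow> preim X (\<lambda>y\<in>topspace (space X). y) V = V"
  using openin_subset[of "front (space X)" V] by (auto simp: mem_preim)

lemma preim_compose:
  assumes "continuous_map (space X) (space Y) f"
  shows "preim X (compose (topspace (space X)) g f) V = preim X f (preim Y g V)"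
  using assms by (auto simp: mem_preim continuous_map_def compose_eq)

lemma sh_id_hom:
  assumes "sheaf_on_front X"
  shows "sh_id X \<in> sh_hom X X"
proof -
  interpret sheaf_on_front X by (rule assms)
  show ?thesis
    unfolding sh_id_def
  proof (rule sh_homI)
    show "continuous_map (space X) (space X) (\<lambda>y\<in>topspace (space X). y)"
      by (rule continuous_map_eq[OF continuous_map_id]) simp
  qed (simp_all add: preim_id restr_closed)
qed

lemma sh_comp_hom:
  assumes Z: "sheaf_on_front Z" and k: "k \<in> sh_hom X Y" and h: "h \<in> sh_hom Y Z"
  shows "sh_comp X Y Z h k \<in> sh_hom X Z"
proof -
  obtain f l g m where fl: "k = (f, l)" and gm: "h = (g, m)" by (cases k; cases h)
  note kD = sh_homD[OF k[unfolded fl]] and hD = sh_homD[OF h[unfolded gm]]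
  have pre: "fopen Y (preim Y g V)" if "fopen Z V" for V by (rule fopen_preim[OF hD(1) that])
  let ?n = "\<lambda>V\<in>{V. fopen Z V}. compose (sections Z V) (l (preim Y g V)) (m V)"
  have app: "?n V s = l (preim Y g V) (m V s)" if "fopen Z V" "s \<in> sections Z V" for V s
    using that by (simp add: compose_eq)
  have "(compose (topspace (space X)) g f, ?n) \<in> sh_hom X Z"
  proof (rule sh_homI)
    show "continuous_map (space X) (space Z) (compose (topspace (space X)) g f)"
      by (rule continuous_map_eq[OF continuous_map_compose[OF kD(1) hD(1)]]) (simp add: compose_eq)
  next
    fix V s assume V: "fopen Z V" and s: "s \<in> sections Z V"
    show "?n V s \<in> sections X (preim X (compose (topspace (space X)) g f) V)"
      unfolding app[OF V s] preim_compose[OF kD(1)] by (rule kD(3)[OF pre[OF V] hD(3)[OF V s]])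
  next
    fix U V s assume U: "fopen Z U" and V: "fopen Z V" and sub: "V \<subseteq> U" and s: "s \<in> sections Z U"
    have r: "restr Z U V s \<in> sections Z V" by (rule sheaf_on_front.restr_closed[OF Z U V sub s])
    have sub': "preim Y g V \<subseteq> preim Y g U" using sub by (auto simp: mem_preim)
    show "?n V (restr Z U V s) = restr X (preim X (compose (topspace (space X)) g f) U)
        (preim X (compose (topspace (space X)) g f) V) (?n U s)"
      unfolding app[OF U s] app[OF V r] preim_compose[OF kD(1)] hD(4)[OF U V sub s]
      by (rule kD(4)[OF pre[OF U] pre[OF V] sub' hD(3)[OF U s]])
  qed (simp_all add: compose_def)
  then show ?thesis by (simp add: sh_comp_def fl gm)
qed

section \<open>The functor from sheaves to noncommutative frames\<close>

lemma H_map_apply: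
  "x \<in> carrier (H_obj Y) \<Longrightarrow> H_map X Y (f, l) x = (preim X f (fst x), l (fst x) (snd x))"
  by (cases x) (simp add: H_map_def)

lemma H_map_closed:
  assumes "(f, l) \<in> sh_hom X Y" "x \<in> carrier (H_obj Y)"
  shows "H_map X Y (f, l) x \<in> carrier (H_obj X)"
  using sh_homD[OF assms(1)] H_obj_D[OF assms(2)] assms(2)
  by (simp add: H_map_apply mem_H_obj openin_preim)

lemma fst_H_map:
  "x \<in> carrier (H_obj Y) \<Longrightarrow> fst (H_map X Y (f, l) x) = preim X f (fst x)"
  by (simp add: H_map_apply)

lemma germ_map_H_map:
  assumes X: "sheaf_on_front X" and Y: "sheaf_on_front Y" and h: "(f, l) \<in> sh_hom X Y"
    and x: "x \<in> carrier (H_obj Y)" and z: "z \<in> carrier (H_obj Y)"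
    and e: "germ_map Y x (f y) = germ_map Y z (f y)"
  shows "germ_map X (H_map X Y (f, l) x) y = germ_map X (H_map X Y (f, l) z) y"
proof -
  have f: "f y \<in> fst x \<longleftrightarrow> f y \<in> fst z" using e germ_map_None_iff by metis
  show ?thesis
  proof (cases "y \<in> topspace (space X) \<and> f y \<in> fst x")
    case True
    then have "germ_at Y (fst x) (snd x) (f y) = germ_at Y (fst z) (snd z) (f y)"
      using e f by (simp add: germ_map_def)
    then show ?thesis
      using germ_at_hom[OF X Y h H_obj_D(2)[OF x] H_obj_D(2)[OF z] H_obj_D(3)[OF x] H_obj_D(3)[OF z]]
        True f x z by (simp add: germ_map_def H_map_apply mem_preim)
  next
    case False
    then show ?thesis using f x z by (auto simp: germ_map_def H_map_apply mem_preim)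
  qed
qed

text \<open>
  Each equation holds at every point \<open>y\<close>: the operations of \<open>H Y\<close> select at \<open>f y\<close> the germ of one of the
  operands, and by \<open>germ_map_H_map\<close> the image then has at \<open>y\<close> the germ of the image of this operand.
\<close>
theorem H_map_hom:
  assumes X: "sh_object X" and Y: "sh_object Y" and h: "h \<in> sh_hom X Y"
  shows "H_map X Y h \<in> lnf_hom (H_obj Y) (H_obj X)"
proof -
  obtain f l where fl: "h = (f, l)" by (cases h)
  note h' = h[unfolded fl]
  interpret X: sh_object X by (rule X)
  interpret Y: sh_object Y by (rule Y)
  let ?F = "H_map X Y (f, l)"
  note X' = X.sheaf_on_front_axioms and Y' = Y.sheaf_on_front_axioms
  note cong = germ_map_H_map[OF X' Y' h']
  note closed = H_map_closed[OF h']
  have cont: "y \<in> topspace (space X) \<Longrightarrow> f y \<in> topspace (space Y)" for y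
    using sh_homD(1)[OF h'] by (auto simp: continuous_map_def)
  have None: "germ_map X (?F x) y = None" if "x \<in> carrier (H_obj Y)" "y \<notin> topspace (space X) \<or> f y \<notin> fst x" for x y
    using that by (auto simp: germ_map_None_iff fst_H_map mem_preim)
  have "?F \<in> lnf_hom (H_obj Y) (H_obj X)"
  proof (rule lnf_homI)
    show "?F \<in> extensional (carrier (H_obj Y))" by (simp add: H_map_def)
  next
    fix x y assume xy: "x \<in> carrier (H_obj Y)" "y \<in> carrier (H_obj Y)"
    note xy' = closed[OF xy(1)] closed[OF xy(2)]
    note Ycl = Y.H_meet_closed[OF xy] Y.H_join(1)[OF xy]
    show "?F (x \<curlywedge>\<^bsub>H_obj Y\<^esub> y) = ?F x \<curlywedge>\<^bsub>H_obj X\<^esub> ?F y"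
    proof (rule X.germ_map_inj[OF closed[OF Ycl(1)] X.H_meet_closed[OF xy']], rule ext)
      fix p
      show "germ_map X (?F (x \<curlywedge>\<^bsub>H_obj Y\<^esub> y)) p = germ_map X (?F x \<curlywedge>\<^bsub>H_obj X\<^esub> ?F y) p"
      proof (cases "p \<in> topspace (space X) \<and> f p \<in> fst y")
        case True
        then have "p \<in> fst (?F y)" using xy(2) by (simp add: fst_H_map mem_preim)
        then show ?thesis
          using cong[OF Ycl(1) xy(1) Y.germ_map_meet_on[OF xy]] True
          by (simp add: X.germ_map_meet_on[OF xy'])
      next
        case False
        then have "germ_map X (?F (x \<curlywedge>\<^bsub>H_obj Y\<^esub> y)) p = None" "germ_map X (?F y) p = None"
          using None[OF Ycl(1)] None[OF xy(2)] by auto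
        then show ?thesis using xy' by (simp add: X.germ_map_meet)
      qed
    qed
    show "?F (x \<curlyvee>\<^bsub>H_obj Y\<^esub> y) = ?F x \<curlyvee>\<^bsub>H_obj X\<^esub> ?F y"
    proof (rule X.germ_map_inj[OF closed[OF Ycl(2)] X.H_join(1)[OF xy']], rule ext)
      fix p
      show "germ_map X (?F (x \<curlyvee>\<^bsub>H_obj Y\<^esub> y)) p = germ_map X (?F x \<curlyvee>\<^bsub>H_obj X\<^esub> ?F y) p"
      proof (cases "p \<in> topspace (space X) \<and> f p \<in> fst y")
        case True
        then have "p \<in> fst (?F y)" using xy(2) by (simp add: fst_H_map mem_preim)
        then show ?thesis
          using cong[OF Ycl(2) xy(2) Y.germ_map_join_on[OF xy]] True
          by (simp add: X.germ_map_join_on[OF xy'])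
      next
        case False
        then have "p \<notin> fst (?F y)" using xy(2) by (simp add: fst_H_map mem_preim)
        moreover have "germ_map X (?F (x \<curlyvee>\<^bsub>H_obj Y\<^esub> y)) p = germ_map X (?F x) p"
        proof (cases "p \<in> topspace (space X)")
          case True
          then have "f p \<notin> fst y" using False by simp
          then show ?thesis by (intro cong[OF Ycl(2) xy(1)] Y.germ_map_join_off[OF xy])
        next
          case False
          then show ?thesis using None[OF Ycl(2)] None[OF xy(1)] by simp
        qed
        ultimately show ?thesis by (simp add: X.germ_map_join_off[OF xy'])
      qed
    qed
  next
    show "?F \<zero>\<^bsub>H_obj Y\<^esub> = \<zero>\<^bsub>H_obj X\<^esub>"
    proof (rule X.germ_map_inj[OF closed[OF Y.H_zero_closed] X.H_zero_closed], rule ext)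
      show "germ_map X (?F \<zero>\<^bsub>H_obj Y\<^esub>) p = germ_map X \<zero>\<^bsub>H_obj X\<^esub> p" for p
        using None[OF Y.H_zero_closed] by (simp add: X.germ_map_zero)
    qed
  next
    fix S s assume S: "commuting_subset (H_obj Y) S" and s: "is_supremum (H_obj Y) s S"
    have sub: "\<And>x. x \<in> S \<Longrightarrow> x \<in> carrier (H_obj Y)" using S by (auto simp: commuting_subset_def)
    have sD: "s \<in> carrier (H_obj Y)" "fst s = (\<Union>x\<in>S. fst x)"
      "\<And>x. x \<in> S \<Longrightarrow> germ_map Y x \<subseteq>\<^sub>m germ_map Y s"
      using s unfolding Y.H_supremum_iff[OF S] by auto
    show "is_supremum (H_obj X) (?F s) (?F ` S)"
    proof (rule X.H_supremumI)
      show "?F ` S \<subseteq> carrier (H_obj X)" using sub closed by blast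
      show "?F s \<in> carrier (H_obj X)" by (rule closed[OF sD(1)])
      have "(\<Union>x\<in>?F ` S. fst x) = (\<Union>x\<in>S. preim X f (fst x))"
        using sub by (simp add: fst_H_map)
      also have "\<dots> = preim X f (fst s)" unfolding sD(2) preim_def by blast
      finally show "fst (?F s) = (\<Union>x\<in>?F ` S. fst x)"
        using sD(1) by (simp add: fst_H_map)
    next
      fix w assume "w \<in> ?F ` S"
      then obtain x where x: "x \<in> S" "w = ?F x" by blast
      show "germ_map X w \<subseteq>\<^sub>m germ_map X (?F s)"
        unfolding map_le_def x(2)
      proof
        fix p assume "p \<in> dom (germ_map X (?F x))"
        then have "f p \<in> dom (germ_map Y x)" using sub[OF x(1)] by (simp add: fst_H_map mem_preim)
        then have "germ_map Y x (f p) = germ_map Y s (f p)"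
          using sD(3)[OF x(1)] unfolding map_le_def by blast
        then show "germ_map X (?F x) p = germ_map X (?F s) p"
          by (rule cong[OF sub[OF x(1)] sD(1)])
      qed
    qed
  next
    fix m assume "m \<in> max_D_class (H_obj Y)"
    then have m: "m \<in> carrier (H_obj Y)" "fst m = topspace (space Y)"
      by (simp_all add: Y.mem_max_D_class_H)
    have "preim X f (topspace (space Y)) = topspace (space X)"
      using cont by (auto simp: mem_preim)
    then show "?F m \<in> max_D_class (H_obj X)"
      using closed[OF m(1)] m by (simp add: X.mem_max_D_class_H fst_H_map)
  qed (rule closed)
  then show ?thesis by (simp add: fl)
qed

lemma H_map_id: "H_map X X (sh_id X) = lnf_id (H_obj X)"
proof (rule extensionalityI)
  show "H_map X X (sh_id X) \<in> extensional (carrier (H_obj X))"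
    by (simp add: H_map_def sh_id_def)
  show "lnf_id (H_obj X) \<in> extensional (carrier (H_obj X))" by (simp add: lnf_id_def)
  fix x assume x: "x \<in> carrier (H_obj X)"
  have "preim X (\<lambda>y\<in>topspace (space X). y) (fst x) = fst x"
    using openin_subset[OF H_obj_D(1)[OF x]] by (auto simp: mem_preim)
  then show "H_map X X (sh_id X) x = lnf_id (H_obj X) x"
    using x H_obj_D[OF x] by (simp add: sh_id_def H_map_apply lnf_id_def)
qed

lemma H_map_comp:
  assumes k: "k \<in> sh_hom X Y" and h: "h \<in> sh_hom Y Z"
  shows "H_map X Z (sh_comp X Y Z h k) = compose (carrier (H_obj Z)) (H_map X Y k) (H_map Y Z h)"
proof -
  obtain f l g m where fl: "k = (f, l)" and gm: "h = (g, m)" by (cases k; cases h)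
  note kD = sh_homD[OF k[unfolded fl]]
  show ?thesis
  proof (rule extensionalityI)
    show "H_map X Z (sh_comp X Y Z h k) \<in> extensional (carrier (H_obj Z))"
      by (simp add: H_map_def sh_comp_def fl gm)
    fix x assume x: "x \<in> carrier (H_obj Z)"
    note pre = preim_compose[OF kD(1), of g "fst x"]
    have "compose (carrier (H_obj Z)) (H_map X Y k) (H_map Y Z h) x
        = H_map X Y (f, l) (H_map Y Z (g, m) x)"
      using x by (simp add: compose_eq fl gm)
    also have "\<dots> = (preim X f (preim Y g (fst x)), l (preim Y g (fst x)) (m (fst x) (snd x)))"
      using H_map_apply[OF H_map_closed[OF h[unfolded gm] x], of X f l] x by (simp add: H_map_apply)
    also have "\<dots> = H_map X Z (sh_comp X Y Z h k) x"
      using x H_obj_D[OF x] by (simp add: sh_comp_def fl gm H_map_apply pre compose_eq)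
    finally show "H_map X Z (sh_comp X Y Z h k) x
        = compose (carrier (H_obj Z)) (H_map X Y k) (H_map Y Z h) x" by simp
  qed simp
qed

section \<open>The sheaf of germs of a noncommutative frame\<close>

context left_handed_noncommutative_frame
begin

lemma germ_relI:
  assumes "a \<in> carrier A" "b \<in> carrier A" "p (D_class A a)" "p (D_class A b)"
    and "c \<in> carrier A" "d \<in> carrier A" "\<not> p (D_class A c)" "p (D_class A d)"
    and "(a \<curlywedge> d) \<curlyvee> c = (b \<curlywedge> d) \<curlyvee> c"
  shows "(a, b) \<in> germ_rel A p"
  using assms unfolding germ_rel_def by blast

lemma germ_relE:
  assumes "(a, b) \<in> germ_rel A p"
  obtains c d where "a \<in> carrier A" "b \<in> carrier A" "p (D_class A a)" "p (D_class A b)"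
    "c \<in> carrier A" "d \<in> carrier A" "\<not> p (D_class A c)" "p (D_class A d)"
    "(a \<curlywedge> d) \<curlyvee> c = (b \<curlywedge> d) \<curlyvee> c"
  using assms unfolding germ_rel_def by blast

text \<open>
  The witnesses \<open>c, d\<close> and \<open>c', d'\<close> have to be brought to a common form. Taking \<open>d \<curlywedge> d'\<close> for the
  second one is harmless by normality. For the first one the join \<open>(c' \<curlywedge> d) \<curlyvee> (c \<curlywedge> d')\<close> serves both
  equations, since it absorbs either of its parts when joined with it from the left.
\<close>
lemma germ_rel_trans:
  assumes p: "p \<in> points A" and ab: "(a, b) \<in> germ_rel A p" and be: "(b, e) \<in> germ_rel A p"
  shows "(a, e) \<in> germ_rel A p"
proof -
  obtain c d where 1: "a \<in> carrier A" "b \<in> carrier A" "p (D_class A a)"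
    "c \<in> carrier A" "d \<in> carrier A" "\<not> p (D_class A c)" "p (D_class A d)"
    and e1: "(a \<curlywedge> d) \<curlyvee> c = (b \<curlywedge> d) \<curlyvee> c" using ab by (rule germ_relE)
  obtain c' d' where 2: "e \<in> carrier A" "p (D_class A e)"
    "c' \<in> carrier A" "d' \<in> carrier A" "\<not> p (D_class A c')" "p (D_class A d')"
    and e2: "(b \<curlywedge> d') \<curlyvee> c' = (e \<curlywedge> d') \<curlyvee> c'" using be by (rule germ_relE)
  let ?d = "d \<curlywedge> d'" and ?c = "(c' \<curlywedge> d) \<curlyvee> (c \<curlywedge> d')"
  have weaken: "(x \<curlywedge> ?d) \<curlyvee> ?c = ((x \<curlywedge> d) \<curlyvee> c) \<curlywedge> d' \<curlyvee> ?c" if "x \<in> carrier A" for x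
  proof -
    have "((x \<curlywedge> d) \<curlyvee> c) \<curlywedge> d' \<curlyvee> ?c = (x \<curlywedge> ?d) \<curlyvee> ((c \<curlywedge> d') \<curlyvee> ?c)"
      using that 1 2 by (simp add: join_meet_distrib meet_assoc join_assoc)
    also have "(c \<curlywedge> d') \<curlyvee> ?c = ?c"
      using join_left_handed[of "c \<curlywedge> d'" "c' \<curlywedge> d"] 1 2 by (simp add: join_assoc)
    finally show ?thesis by simp
  qed
  have weaken': "(x \<curlywedge> ?d) \<curlyvee> ?c = ((x \<curlywedge> d') \<curlyvee> c') \<curlywedge> d \<curlyvee> ?c" if "x \<in> carrier A" for x
  proof -
    have "((x \<curlywedge> d') \<curlyvee> c') \<curlywedge> d \<curlyvee> ?c = (x \<curlywedge> d' \<curlywedge> d) \<curlyvee> ((c' \<curlywedge> d) \<curlyvee> ?c)"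
      using that 1 2 by (simp add: join_meet_distrib join_assoc)
    also have "x \<curlywedge> d' \<curlywedge> d = x \<curlywedge> ?d"
      using meet_normal[of x d' d] that 1 2 by (simp add: meet_assoc)
    also have "(c' \<curlywedge> d) \<curlyvee> ?c = ?c"
      using 1 2 by (metis join_assoc join_idem meet_closed)
    finally show ?thesis by simp
  qed
  have "(a \<curlywedge> ?d) \<curlyvee> ?c = (b \<curlywedge> ?d) \<curlyvee> ?c" using weaken 1(1,2) e1 by simp
  also have "\<dots> = (e \<curlywedge> ?d) \<curlyvee> ?c" using weaken' 1(2) 2(1) e2 by simp
  finally show ?thesis
    using 1 2 p by (intro germ_relI[of a e p ?c ?d]) (simp_all add: point_meet point_join)
qed

lemma equiv_germ_rel:
  assumes p: "p \<in> points A"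
  shows "equiv {a \<in> carrier A. p (D_class A a)} (germ_rel A p)"
proof (rule equivI)
  show "germ_rel A p \<subseteq> {a \<in> carrier A. p (D_class A a)} \<times> {a \<in> carrier A. p (D_class A a)}"
    by (auto simp: germ_rel_def)
  show "refl_on {a \<in> carrier A. p (D_class A a)} (germ_rel A p)"
  proof (rule refl_onI)
    show "(a, a) \<in> germ_rel A p" if "a \<in> {a \<in> carrier A. p (D_class A a)}" for a
      using that point_zero[OF p] by (intro germ_relI[of a a p \<zero> a]) simp_all
  qed
  show "sym (germ_rel A p)"
  proof (rule symI)
    show "(b, a) \<in> germ_rel A p" if "(a, b) \<in> germ_rel A p" for a b
      using that by (elim germ_relE) (intro germ_relI; (assumption | rule sym))
  qed
  show "trans (germ_rel A p)" using germ_rel_trans[OF p] by (rule transI)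
qed

lemma fst_basic_section: "p \<in> basic_open A a \<Longrightarrow> fst (basic_section A a p) = p"
  by (simp add: basic_section_def)

lemma basic_section_eq_iff:
  assumes "a \<in> carrier A" "b \<in> carrier A" "p \<in> basic_open A a" "p \<in> basic_open A b"
  shows "basic_section A a p = basic_section A b p \<longleftrightarrow> (a, b) \<in> germ_rel A p"
  using assms eq_equiv_class_iff[OF equiv_germ_rel]
  by (simp add: basic_section_def mem_basic_open)

lemma basic_section_meet:
  assumes "a \<in> carrier A" "b \<in> carrier A" "p \<in> basic_open A a" "p \<in> basic_open A b"
  shows "basic_section A (a \<curlywedge> b) p = basic_section A a p"
proof -
  have p: "p \<in> points A" "p (D_class A a)" "p (D_class A b)"
    using assms by (simp_all add: mem_basic_open)
  have "(a \<curlywedge> b, a) \<in> germ_rel A p"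
    using assms(1,2) p point_zero[OF p(1)]
    by (intro germ_relI[of _ _ p \<zero> b]) (simp_all add: point_meet meet_assoc)
  then show ?thesis
    using assms by (simp add: basic_section_eq_iff basic_open_meet)
qed

lemma basic_section_join_on:
  assumes "a \<in> carrier A" "b \<in> carrier A" "p \<in> basic_open A b"
  shows "basic_section A (a \<curlyvee> b) p = basic_section A b p"
proof -
  have p: "p \<in> points A" "p (D_class A b)"
    using assms by (simp_all add: mem_basic_open)
  have "(a \<curlyvee> b, b) \<in> germ_rel A p"
    using assms(1,2) p point_zero[OF p(1)]
    by (intro germ_relI[of _ _ p \<zero> b]) (simp_all add: point_join absorb4)
  then show ?thesis
    using assms by (simp add: basic_section_eq_iff basic_open_join)
qed

lemma basic_section_join_off:
  assumes "a \<in> carrier A" "b \<in> carrier A" "p \<in> basic_open A a" "p \<notin> basic_open A b"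
  shows "basic_section A (a \<curlyvee> b) p = basic_section A a p"
proof -
  have p: "p \<in> points A" "p (D_class A a)" "\<not> p (D_class A b)"
    using assms by (simp_all add: mem_basic_open)
  have "((a \<curlyvee> b) \<curlywedge> a) \<curlyvee> b = a \<curlyvee> ((b \<curlywedge> a) \<curlyvee> b)"
    using assms(1,2) by (simp add: join_meet_distrib join_assoc)
  also have "\<dots> = (a \<curlywedge> a) \<curlyvee> b" using assms(1,2) by (simp add: meet_join_absorb)
  finally have "(a \<curlyvee> b, a) \<in> germ_rel A p"
    using assms(1,2) p by (intro germ_relI[of _ _ p b a]) (simp_all add: point_join)
  then show ?thesis
    using assms by (simp add: basic_section_eq_iff basic_open_join)
qed

lemma basic_section_natural_le:
  assumes "a \<in> carrier A" "b \<in> carrier A" "natural_le A a b" "p \<in> basic_open A a"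
  shows "p \<in> basic_open A b" "basic_section A a p = basic_section A b p"
proof -
  have a: "a = b \<curlywedge> a" using assms(3) by (simp add: natural_le_def)
  show b: "p \<in> basic_open A b"
    using assms(4) basic_open_meet[OF assms(2,1)] a by auto
  show "basic_section A a p = basic_section A b p"
    using basic_section_meet[OF assms(2,1) b assms(4)] a by simp
qed

text \<open>
  The elements \<open>c\<close> and \<open>d\<close> that witness agreement of germs at \<open>p\<close> witness it at every point of the
  locally closed set where \<open>d\<close> holds and \<open>c\<close> fails. So equality of two basic sections is an open
  condition for the front topology, which is the reason why this topology is used.
\<close>
lemma basic_sections_agree_near:
  assumes ab: "a \<in> carrier A" "b \<in> carrier A" and p: "p \<in> basic_open A a" "p \<in> basic_open A b"
    and e: "basic_section A a p = basic_section A b p"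
  shows "\<exists>Z. openin (front (pt_space A)) Z \<and> p \<in> Z \<and> Z \<subseteq> basic_open A a \<inter> basic_open A b \<and>
    (\<forall>q\<in>Z. basic_section A a q = basic_section A b q)"
proof -
  obtain c d where cd: "c \<in> carrier A" "d \<in> carrier A" "\<not> p (D_class A c)" "p (D_class A d)"
    and e': "(a \<curlywedge> d) \<curlyvee> c = (b \<curlywedge> d) \<curlyvee> c"
    using e unfolding basic_section_eq_iff[OF ab p] by (elim germ_relE)
  let ?Z = "basic_open A (a \<curlywedge> b \<curlywedge> d) - basic_open A c"
  have Z: "?Z = (basic_open A a \<inter> basic_open A b \<inter> basic_open A d) - basic_open A c"
    using ab cd by (simp add: basic_open_meet)
  have "openin (front (pt_space A)) ?Z"
    using ab cd by (intro openin_front_Diff) (auto simp: openin_pt_space)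
  moreover have "p \<in> ?Z" using p cd unfolding Z by (simp add: mem_basic_open)
  moreover have "basic_section A a q = basic_section A b q" if "q \<in> ?Z" for q
  proof -
    have q: "q \<in> basic_open A a" "q \<in> basic_open A b" "q (D_class A d)" "\<not> q (D_class A c)"
      using that unfolding Z by (auto simp: mem_basic_open)
    then have "(a, b) \<in> germ_rel A q"
      using ab cd e' by (intro germ_relI[of a b q c d]) (simp_all add: mem_basic_open)
    then show ?thesis using ab q by (simp add: basic_section_eq_iff)
  qed
  moreover have "?Z \<subseteq> basic_open A a \<inter> basic_open A b" unfolding Z by blast
  ultimately show ?thesis by (intro exI[of _ ?Z]) simp
qed

lemma space_G [simp]: "space (G_obj A) = pt_space A"
  by (simp add: G_obj_def)

lemma restr_G [simp]: "restr (G_obj A) U V \<sigma> = restrict \<sigma> V"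
  by (simp add: G_obj_def)

lemma topspace_etale:
  "topspace (etale_space A) = (\<Union>a\<in>carrier A. basic_section A a ` basic_open A a)"
proof -
  have "locally_closedin (pt_space A) (basic_open A a)" if "a \<in> carrier A" for a
    using that by (intro locally_closedin_open) (auto simp: openin_pt_space)
  then show ?thesis
    unfolding etale_space_def topology_generated_by_topspace by blast
qed

lemma openin_front_basic_open: "a \<in> carrier A \<Longrightarrow> openin (front (pt_space A)) (basic_open A a)"
  by (intro openin_front_open) (auto simp: openin_pt_space)

text \<open>
  Continuous sections are exactly the functions that locally are basic sections. One direction
  uses that the image of \<open>s\<^sub>a\<close> is open among the germs, the other one that the set of points where two
  basic sections agree is open.
\<close>
theorem section_G_iff:
  assumes W: "openin (front (pt_space A)) W"
  shows "\<sigma> \<in> sections (G_obj A) W \<longleftrightarrow> \<sigma> \<in> extensional W \<and>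
    (\<forall>p\<in>W. \<exists>a\<in>carrier A. \<exists>N. openin (front (pt_space A)) N \<and> p \<in> N \<and> N \<subseteq> W \<inter> basic_open A a \<and>
       (\<forall>q\<in>N. \<sigma> q = basic_section A a q))" (is "_ \<longleftrightarrow> _ \<and> ?loc")
proof -
  have Wsub: "W \<subseteq> points A" using openin_subset[OF W] by (simp add: topspace_pt_space)
  have topW: "topspace (subtopology (front (pt_space A)) W) = W"
    using Wsub by (auto simp: topspace_pt_space)
  have openW: "openin (subtopology (front (pt_space A)) W) N \<longleftrightarrow> openin (front (pt_space A)) N \<and> N \<subseteq> W" for N
    by (rule openin_open_subtopology[OF W])
  show ?thesis
  proof (intro iffI conjI)
    assume s: "\<sigma> \<in> sections (G_obj A) W"
    then show "\<sigma> \<in> extensional W" by (simp add: G_obj_def)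
    have cont: "continuous_map (subtopology (front (pt_space A)) W) (etale_space A) \<sigma>"
      and fst: "\<And>p. p \<in> W \<Longrightarrow> fst (\<sigma> p) = p" using s by (simp_all add: G_obj_def)
    show ?loc
    proof
      fix p assume p: "p \<in> W"
      have "\<sigma> p \<in> topspace (etale_space A)"
        using cont p topW by (auto simp: continuous_map_def)
      then obtain a where a: "a \<in> carrier A" "\<sigma> p \<in> basic_section A a ` basic_open A a"
        by (auto simp: topspace_etale)
      define N where "N = {q \<in> W. \<sigma> q \<in> basic_section A a ` basic_open A a}"
      have "openin (etale_space A) (basic_section A a ` basic_open A a)"
        unfolding etale_space_def
      proof (rule topology_generated_by_Basis)
        have "locally_closedin (pt_space A) (basic_open A a)"
          using a by (intro locally_closedin_open) (auto simp: openin_pt_space)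
        then show "basic_section A a ` basic_open A a \<in> {basic_section A a ` Z | a Z.
            a \<in> carrier A \<and> Z \<subseteq> basic_open A a \<and> locally_closedin (pt_space A) Z}"
          using a by blast
      qed
      then have "openin (subtopology (front (pt_space A)) W) N"
        unfolding N_def by (rule openin_continuous_map_preimage[OF cont, unfolded topW])
      then have "openin (front (pt_space A)) N" "N \<subseteq> W" by (simp_all add: openW)
      moreover have "p \<in> N" using a(2) p by (simp add: N_def)
      moreover have on_N: "q \<in> basic_open A a \<and> \<sigma> q = basic_section A a q" if "q \<in> N" for q
      proof -
        have q: "q \<in> W" "\<sigma> q \<in> basic_section A a ` basic_open A a" using that by (simp_all add: N_def)
        obtain r where r: "\<sigma> q = basic_section A a r" "r \<in> basic_open A a"
          using q(2) by (rule imageE)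
        then have "r = q" using fst[OF q(1)] fst_basic_section[OF r(2)] by simp
        then show ?thesis using r by simp
      qed
      moreover have "N \<subseteq> basic_open A a" "\<forall>q\<in>N. \<sigma> q = basic_section A a q" using on_N by blast+
      ultimately show "\<exists>a\<in>carrier A. \<exists>N. openin (front (pt_space A)) N \<and> p \<in> N \<and>
          N \<subseteq> W \<inter> basic_open A a \<and> (\<forall>q\<in>N. \<sigma> q = basic_section A a q)"
        by (intro bexI[OF _ a(1)] exI[of _ N] conjI Int_greatest)
    qed
  next
    assume "\<sigma> \<in> extensional W \<and> ?loc"
    then have ext: "\<sigma> \<in> extensional W" and loc: ?loc by auto
    have fst: "fst (\<sigma> p) = p" if "p \<in> W" for p
      using bspec[OF loc that] by (auto simp: fst_basic_section)
    have "continuous_map (subtopology (front (pt_space A)) W) (etale_space A) \<sigma>"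
      unfolding etale_space_def
    proof (rule continuous_on_generated_topo)
      fix E assume "E \<in> {basic_section A a ` Z | a Z.
          a \<in> carrier A \<and> Z \<subseteq> basic_open A a \<and> locally_closedin (pt_space A) Z}"
      then obtain b Z where E: "E = basic_section A b ` Z" and b: "b \<in> carrier A"
        and Z: "Z \<subseteq> basic_open A b" "openin (front (pt_space A)) Z"
        using openin_front_locally_closed by blast
      have "\<exists>N. openin (front (pt_space A)) N \<and> p \<in> N \<and> N \<subseteq> \<sigma> -` E \<inter> W" if p: "p \<in> \<sigma> -` E \<inter> W" for p
      proof -
        obtain a N where a: "a \<in> carrier A" and N: "openin (front (pt_space A)) N" "p \<in> N"
          "N \<subseteq> W \<inter> basic_open A a" "\<forall>q\<in>N. \<sigma> q = basic_section A a q"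
          using loc p by blast
        obtain r where r: "r \<in> Z" "\<sigma> p = basic_section A b r" using p E by auto
        then have "r = p" using fst[of p] p Z(1) fst_basic_section by auto
        then have pZ: "p \<in> Z" "basic_section A a p = basic_section A b p" using r N by auto
        obtain M where M: "openin (front (pt_space A)) M" "p \<in> M"
          "\<forall>q\<in>M. basic_section A a q = basic_section A b q"
          using basic_sections_agree_near[OF a b _ _ pZ(2)] N(2,3) pZ(1) Z(1) by blast
        have "N \<inter> Z \<inter> M \<subseteq> \<sigma> -` E \<inter> W" using N M E by auto
        then show ?thesis using N M pZ Z by (intro exI[of _ "N \<inter> Z \<inter> M"]) auto
      qed
      then have "openin (front (pt_space A)) (\<sigma> -` E \<inter> W)"
        by (subst openin_subopen) auto
      then show "openin (subtopology (front (pt_space A)) W)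
          (\<sigma> -` E \<inter> topspace (subtopology (front (pt_space A)) W))"
        unfolding topW openW by auto
    next
      have "\<sigma> p \<in> topspace (etale_space A)" if p: "p \<in> W" for p
      proof -
        obtain a N where "a \<in> carrier A" "p \<in> N" "N \<subseteq> W \<inter> basic_open A a" "\<forall>q\<in>N. \<sigma> q = basic_section A a q"
          using bspec[OF loc p] by (elim bexE exE conjE)
        then show ?thesis unfolding topspace_etale by blast
      qed
      then show "\<sigma> ` topspace (subtopology (front (pt_space A)) W) \<subseteq> \<Union>{basic_section A a ` Z | a Z.
          a \<in> carrier A \<and> Z \<subseteq> basic_open A a \<and> locally_closedin (pt_space A) Z}"
        unfolding topW etale_space_def topology_generated_by_topspace by blast
    qed
    then show "\<sigma> \<in> sections (G_obj A) W"
      using ext fst by (simp add: G_obj_def)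
  qed
qed

lemma section_G_locally_basic:
  assumes "openin (front (pt_space A)) W" "\<sigma> \<in> sections (G_obj A) W" "p \<in> W"
  obtains a N where "a \<in> carrier A" "openin (front (pt_space A)) N" "p \<in> N" "N \<subseteq> W"
    "N \<subseteq> basic_open A a" "\<And>q. q \<in> N \<Longrightarrow> \<sigma> q = basic_section A a q"
proof -
  obtain a N where "a \<in> carrier A" "openin (front (pt_space A)) N" "p \<in> N"
    "N \<subseteq> W \<inter> basic_open A a" "\<forall>q\<in>N. \<sigma> q = basic_section A a q"
    using bspec[OF conjunct2[OF assms(2)[unfolded section_G_iff[OF assms(1)]]] assms(3)]
    by (elim bexE exE conjE)
  then show thesis by (intro that[of a N]) auto
qed

lemma basic_section_in_sections:
  assumes "a \<in> carrier A"
  shows "basic_section A a \<in> sections (G_obj A) (basic_open A a)"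
  unfolding section_G_iff[OF openin_front_basic_open[OF assms]]
proof (intro conjI ballI)
  show "basic_section A a \<in> extensional (basic_open A a)" by (simp add: basic_section_def)
  fix p assume "p \<in> basic_open A a"
  then show "\<exists>b\<in>carrier A. \<exists>N. openin (front (pt_space A)) N \<and> p \<in> N \<and>
      N \<subseteq> basic_open A a \<inter> basic_open A b \<and> (\<forall>q\<in>N. basic_section A a q = basic_section A b q)"
    using assms openin_front_basic_open
    by (intro bexI[of _ a] exI[of _ "basic_open A a"]) auto
qed

lemma section_G_restrict:
  assumes U: "openin (front (pt_space A)) U" and V: "openin (front (pt_space A)) V" "V \<subseteq> U"
    and s: "\<sigma> \<in> sections (G_obj A) U"
  shows "restrict \<sigma> V \<in> sections (G_obj A) V"
  unfolding section_G_iff[OF V(1)]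
proof (intro conjI ballI)
  fix p assume p: "p \<in> V"
  then have "p \<in> U" using V by blast
  then obtain a N where "a \<in> carrier A" "openin (front (pt_space A)) N" "p \<in> N"
    "N \<subseteq> basic_open A a" "\<And>q. q \<in> N \<Longrightarrow> \<sigma> q = basic_section A a q"
    using section_G_locally_basic[OF U s] by metis
  then show "\<exists>a\<in>carrier A. \<exists>N. openin (front (pt_space A)) N \<and> p \<in> N \<and> N \<subseteq> V \<inter> basic_open A a \<and>
      (\<forall>q\<in>N. restrict \<sigma> V q = basic_section A a q)"
    using p V by (intro bexI[of _ a] exI[of _ "N \<inter> V"]) auto
qed simp

text \<open>
  Gluing is gluing of functions, because being a section is a local condition by
  \<open>section_G_iff\<close>; a global section is \<open>s\<^sub>m\<close> for \<open>m\<close> in the maximal class, where \<open>U\<^sub>m\<close> is the whole space.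
\<close>
theorem sh_object_G: "sh_object (G_obj A)"
proof unfold_locales
  fix \<U> :: "('a set \<Rightarrow> bool) set set" and \<sigma>
  assume o: "\<And>U. U \<in> \<U> \<Longrightarrow> fopen (G_obj A) U" and s: "\<And>U. U \<in> \<U> \<Longrightarrow> \<sigma> U \<in> sections (G_obj A) U"
    and compat: "\<And>U V. \<lbrakk>U \<in> \<U>; V \<in> \<U>\<rbrakk> \<Longrightarrow>
      restr (G_obj A) U (U \<inter> V) (\<sigma> U) = restr (G_obj A) V (U \<inter> V) (\<sigma> V)"
  have agree: "\<sigma> U p = \<sigma> V p" if "U \<in> \<U>" "V \<in> \<U>" "p \<in> U" "p \<in> V" for U V p
    using fun_cong[OF compat[OF that(1,2)], of p] that(3,4) by simp
  have fopen: "openin (front (pt_space A)) U" if "U \<in> \<U>" for U using o[OF that] by simp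
  have Un: "openin (front (pt_space A)) (\<Union>\<U>)" using fopen by (rule openin_Union)
  define t where "t = (\<lambda>p\<in>\<Union>\<U>. \<sigma> (SOME U. U \<in> \<U> \<and> p \<in> U) p)"
  have t: "t p = \<sigma> U p" if "U \<in> \<U>" "p \<in> U" for U p
  proof -
    let ?V = "SOME U. U \<in> \<U> \<and> p \<in> U"
    have V: "?V \<in> \<U> \<and> p \<in> ?V" by (rule someI[of _ U]) (use that in blast)
    have "t p = \<sigma> ?V p" using that unfolding t_def by auto
    also have "\<dots> = \<sigma> U p" using agree V that by blast
    finally show ?thesis .
  qed
  have t_section: "t \<in> sections (G_obj A) (\<Union>\<U>)"
    unfolding section_G_iff[OF Un]
  proof (intro conjI ballI)
    show "t \<in> extensional (\<Union>\<U>)" by (simp add: t_def)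
    fix p assume "p \<in> \<Union>\<U>"
    then obtain U where U: "U \<in> \<U>" "p \<in> U" by blast
    obtain a N where "a \<in> carrier A" "openin (front (pt_space A)) N" "p \<in> N" "N \<subseteq> U"
      "N \<subseteq> basic_open A a" "\<And>q. q \<in> N \<Longrightarrow> \<sigma> U q = basic_section A a q"
      using section_G_locally_basic[OF fopen[OF U(1)] s[OF U(1)] U(2)] by metis
    then show "\<exists>a\<in>carrier A. \<exists>N. openin (front (pt_space A)) N \<and> p \<in> N \<and>
        N \<subseteq> \<Union>\<U> \<inter> basic_open A a \<and> (\<forall>q\<in>N. t q = basic_section A a q)"
      using U t[OF U(1)] by (intro bexI[of _ a] exI[of _ N]) auto
  qed
  have t_restrict: "restrict t U = \<sigma> U" if "U \<in> \<U>" for U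
  proof (rule extensionalityI)
    show "\<sigma> U \<in> extensional U" using s[OF that] by (simp add: G_obj_def)
  qed (use t[OF that] in auto)
  have t_unique: "u = t" if u: "u \<in> sections (G_obj A) (\<Union>\<U>)"
    and r: "\<forall>U\<in>\<U>. restr (G_obj A) (\<Union>\<U>) U u = \<sigma> U" for u
  proof (rule extensionalityI)
    show "u \<in> extensional (\<Union>\<U>)" using u by (simp add: G_obj_def)
    show "t \<in> extensional (\<Union>\<U>)" by (simp add: t_def)
    fix p assume "p \<in> \<Union>\<U>"
    then obtain U where U: "U \<in> \<U>" "p \<in> U" by blast
    have "restrict u U = \<sigma> U" using r U by simp
    moreover have "restrict u U p = u p" using U(2) by simp
    ultimately have "u p = \<sigma> U p" by simp
    then show "u p = t p" using t[OF U] by simp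
  qed
  show "\<exists>!t. t \<in> sections (G_obj A) (\<Union>\<U>) \<and> (\<forall>U\<in>\<U>. restr (G_obj A) (\<Union>\<U>) U t = \<sigma> U)"
  proof (rule ex1I)
    show "t \<in> sections (G_obj A) (\<Union>\<U>) \<and> (\<forall>U\<in>\<U>. restr (G_obj A) (\<Union>\<U>) U t = \<sigma> U)"
      using t_section t_restrict by simp
  qed (elim conjE, rule t_unique)
next
  obtain m where "m \<in> max_D_class A" using max_D_class_nonempty by blast
  then show "sections (G_obj A) (topspace (space (G_obj A))) \<noteq> {}"
    using basic_section_in_sections[of m] max_D_class_closed basic_open_top
    by (auto simp: topspace_pt_space)
next
  fix U \<sigma> assume "\<sigma> \<in> sections (G_obj A) U"
  then show "restr (G_obj A) U U \<sigma> = \<sigma>" by (simp add: G_obj_def extensional_restrict)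
next
  fix U V \<sigma> assume "fopen (G_obj A) U" "fopen (G_obj A) V" "V \<subseteq> U" "\<sigma> \<in> sections (G_obj A) U"
  then show "restr (G_obj A) U V \<sigma> \<in> sections (G_obj A) V" by (simp add: section_G_restrict)
next
  fix U V W :: "('a set \<Rightarrow> bool) set" and \<sigma> assume "W \<subseteq> V"
  then show "restr (G_obj A) V W (restr (G_obj A) U V \<sigma>) = restr (G_obj A) U W \<sigma>"
    by (simp add: Int_absorb1)
qed

text \<open>
  The germ of a section of \<open>G A\<close> is its value: the stalk of the sheaf at \<open>p\<close> is the fibre
  over \<open>p\<close> of the space of germs.
\<close>
lemma germ_at_G_iff:
  assumes U: "openin (front (pt_space A)) U" and V: "openin (front (pt_space A)) V"
    and s: "\<sigma> \<in> sections (G_obj A) U" and t: "\<tau> \<in> sections (G_obj A) V" and p: "p \<in> U" "p \<in> V"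
  shows "germ_at (G_obj A) U \<sigma> p = germ_at (G_obj A) V \<tau> p \<longleftrightarrow> \<sigma> p = \<tau> p"
proof -
  interpret G: sh_object "G_obj A" by (rule sh_object_G)
  have "germ_at (G_obj A) U \<sigma> p = germ_at (G_obj A) V \<tau> p \<longleftrightarrow>
      (\<exists>N. openin (front (pt_space A)) N \<and> p \<in> N \<and> N \<subseteq> U \<inter> V \<and> restrict \<sigma> N = restrict \<tau> N)"
    using G.germ_at_eq_iff[of U V \<sigma> \<tau> p] U V s t p by simp
  also have "\<dots> \<longleftrightarrow> \<sigma> p = \<tau> p"
  proof
    assume "\<exists>N. openin (front (pt_space A)) N \<and> p \<in> N \<and> N \<subseteq> U \<inter> V \<and> restrict \<sigma> N = restrict \<tau> N"
    then show "\<sigma> p = \<tau> p" by (metis restrict_apply')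
  next
    assume e: "\<sigma> p = \<tau> p"
    obtain a N where N: "a \<in> carrier A" "openin (front (pt_space A)) N" "p \<in> N" "N \<subseteq> U"
      "N \<subseteq> basic_open A a" "\<And>q. q \<in> N \<Longrightarrow> \<sigma> q = basic_section A a q"
      using section_G_locally_basic[OF U s p(1)] by metis
    obtain b M where M: "b \<in> carrier A" "openin (front (pt_space A)) M" "p \<in> M" "M \<subseteq> V"
      "M \<subseteq> basic_open A b" "\<And>q. q \<in> M \<Longrightarrow> \<tau> q = basic_section A b q"
      using section_G_locally_basic[OF V t p(2)] by metis
    have eq: "basic_section A a p = basic_section A b p"
      using e N(6)[OF N(3)] M(6)[OF M(3)] by simp
    obtain Z where Z: "openin (front (pt_space A)) Z" "p \<in> Z"
      "\<forall>q\<in>Z. basic_section A a q = basic_section A b q"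
      using basic_sections_agree_near[OF N(1) M(1) subsetD[OF N(5,3)] subsetD[OF M(5,3)] eq]
      by (elim exE conjE)
    have "restrict \<sigma> (N \<inter> M \<inter> Z) = restrict \<tau> (N \<inter> M \<inter> Z)"
      using N(6) M(6) Z(3) by (intro restrict_ext) simp
    then show "\<exists>N. openin (front (pt_space A)) N \<and> p \<in> N \<and> N \<subseteq> U \<inter> V \<and> restrict \<sigma> N = restrict \<tau> N"
      using N(2-4) M(2-4) Z(1,2) by (intro exI[of _ "N \<inter> M \<inter> Z"]) auto
  qed
  finally show ?thesis .
qed

end

section \<open>The unit\<close>

context left_handed_noncommutative_frame
begin

lemma adj_unit_apply: "a \<in> carrier A \<Longrightarrow> adj_unit A a = (basic_open A a, basic_section A a)"
  by (simp add: adj_unit_def)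

lemma adj_unit_closed: "a \<in> carrier A \<Longrightarrow> adj_unit A a \<in> carrier (H_obj (G_obj A))"
  using basic_section_in_sections by (auto simp: adj_unit_apply mem_H_obj openin_pt_space)

lemma fst_adj_unit: "a \<in> carrier A \<Longrightarrow> fst (adj_unit A a) = basic_open A a"
  by (simp add: adj_unit_apply)

lemma germ_map_adj_unit:
  assumes "a \<in> carrier A" "b \<in> carrier A" "p \<in> basic_open A a" "p \<in> basic_open A b"
    and "basic_section A a p = basic_section A b p"
  shows "germ_map (G_obj A) (adj_unit A a) p = germ_map (G_obj A) (adj_unit A b) p"
  using germ_at_G_iff[OF openin_front_basic_open[OF assms(1)] openin_front_basic_open[OF assms(2)]
      basic_section_in_sections[OF assms(1)] basic_section_in_sections[OF assms(2)] assms(3,4)] assms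
  by (simp add: germ_map_def adj_unit_apply)

text \<open>
  All equations are checked on germs, where they reduce to the behaviour of \<open>s\<^bsub>a \<and> b\<^esub>\<close>
  and \<open>s\<^bsub>a \<or> b\<^esub>\<close> at single points.
\<close>
theorem adj_unit_hom: "adj_unit A \<in> lnf_hom A (H_obj (G_obj A))"
proof -
  interpret G: sh_object "G_obj A" by (rule sh_object_G)
  let ?u = "adj_unit A" and ?g = "\<lambda>a. germ_map (G_obj A) (adj_unit A a)"
  have None: "?g a p = None" if "a \<in> carrier A" "p \<notin> basic_open A a" for a p
    using that by (simp add: germ_map_None_iff fst_adj_unit)
  show ?thesis
  proof (rule lnf_homI)
    show "?u \<in> extensional (carrier A)" by (simp add: adj_unit_def)
  next
    fix a b assume ab: "a \<in> carrier A" "b \<in> carrier A"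
    note u = adj_unit_closed[OF ab(1)] adj_unit_closed[OF ab(2)]
    have m: "a \<curlywedge> b \<in> carrier A" and j: "a \<curlyvee> b \<in> carrier A" using ab by simp_all
    show "?u (a \<curlywedge> b) = ?u a \<curlywedge>\<^bsub>H_obj (G_obj A)\<^esub> ?u b"
    proof (rule G.germ_map_inj[OF adj_unit_closed[OF m] G.H_meet_closed[OF u]], rule ext)
      fix p
      show "?g (a \<curlywedge> b) p = germ_map (G_obj A) (?u a \<curlywedge>\<^bsub>H_obj (G_obj A)\<^esub> ?u b) p"
      proof (cases "p \<in> basic_open A a \<and> p \<in> basic_open A b")
        case True
        then have "?g (a \<curlywedge> b) p = ?g a p"
          using ab by (intro germ_map_adj_unit m basic_section_meet) (auto simp: basic_open_meet)
        then show ?thesis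
          using G.germ_map_meet_on[OF u, of p] True ab by (simp add: fst_adj_unit)
      next
        case False
        then have "?g (a \<curlywedge> b) p = None" using None[OF m] ab by (simp add: basic_open_meet)
        moreover have "germ_map (G_obj A) (?u a \<curlywedge>\<^bsub>H_obj (G_obj A)\<^esub> ?u b) p = None"
          unfolding germ_map_None_iff using False ab by (simp add: fst_adj_unit)
        ultimately show ?thesis by simp
      qed
    qed
    show "?u (a \<curlyvee> b) = ?u a \<curlyvee>\<^bsub>H_obj (G_obj A)\<^esub> ?u b"
    proof (rule G.germ_map_inj[OF adj_unit_closed[OF j] G.H_join(1)[OF u]], rule ext)
      fix p
      show "?g (a \<curlyvee> b) p = germ_map (G_obj A) (?u a \<curlyvee>\<^bsub>H_obj (G_obj A)\<^esub> ?u b) p"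
      proof (cases "p \<in> basic_open A b")
        case True
        then have "?g (a \<curlyvee> b) p = ?g b p"
          using ab by (intro germ_map_adj_unit j basic_section_join_on) (auto simp: basic_open_join)
        then show ?thesis
          using G.germ_map_join_on[OF u, of p] True ab by (simp add: fst_adj_unit)
      next
        case False
        have "?g (a \<curlyvee> b) p = ?g a p"
        proof (cases "p \<in> basic_open A a")
          case True
          then show ?thesis
            using ab False
            by (intro germ_map_adj_unit j basic_section_join_off) (auto simp: basic_open_join)
        next
          case out: False
          then show ?thesis using None[OF j] None[OF ab(1)] False ab by (simp add: basic_open_join)
        qed
        then show ?thesis
          using G.germ_map_join_off[OF u, of p] False ab by (simp add: fst_adj_unit)
      qed
    qed
  next
    show "?u \<zero> = \<zero>\<^bsub>H_obj (G_obj A)\<^esub>"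
    proof (rule G.germ_map_inj[OF adj_unit_closed[OF zero_closed] G.H_zero_closed], rule ext)
      show "?g \<zero> p = germ_map (G_obj A) \<zero>\<^bsub>H_obj (G_obj A)\<^esub> p" for p
        using None[OF zero_closed] by (simp add: G.germ_map_zero basic_open_zero)
    qed
  next
    fix S s assume S: "commuting_subset A S" and s: "is_supremum A s S"
    have sub: "S \<subseteq> carrier A" using S by (simp add: commuting_subset_def)
    have sc: "s \<in> carrier A" and up: "\<And>x. x \<in> S \<Longrightarrow> natural_le A x s"
      using s by (auto simp: is_supremum_iff[OF sub])
    show "is_supremum (H_obj (G_obj A)) (?u s) (?u ` S)"
    proof (rule G.H_supremumI)
      show "?u ` S \<subseteq> carrier (H_obj (G_obj A))" using sub adj_unit_closed by blast
      show "?u s \<in> carrier (H_obj (G_obj A))" by (rule adj_unit_closed[OF sc])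
      have "(\<Union>x\<in>?u ` S. fst x) = (\<Union>x\<in>S. basic_open A x)"
        unfolding image_image using sub by (intro SUP_cong) (auto simp: fst_adj_unit)
      then show "fst (?u s) = (\<Union>x\<in>?u ` S. fst x)"
        using basic_open_sup[OF S s] by (simp add: fst_adj_unit[OF sc])
    next
      fix w assume "w \<in> ?u ` S"
      then obtain x where x: "x \<in> S" "w = ?u x" by blast
      have xc: "x \<in> carrier A" using x sub by blast
      show "germ_map (G_obj A) w \<subseteq>\<^sub>m ?g s"
        unfolding map_le_def x(2)
      proof
        fix p assume "p \<in> dom (?g x)"
        then have p: "p \<in> basic_open A x" by (simp add: fst_adj_unit[OF xc])
        show "?g x p = ?g s p"
          by (rule germ_map_adj_unit[OF xc sc p basic_section_natural_le[OF xc sc up[OF x(1)] p]])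
      qed
    qed
  next
    fix m assume m: "m \<in> max_D_class A"
    show "?u m \<in> max_D_class (H_obj (G_obj A))"
      using adj_unit_closed[OF max_D_class_closed[OF m]] fst_adj_unit[OF max_D_class_closed[OF m]]
      by (simp add: G.mem_max_D_class_H topspace_pt_space basic_open_top[OF m])
  qed (rule adj_unit_closed)
qed

end

section \<open>The transposition is bijective\<close>

lemma adj_transpose_apply:
  "a \<in> carrier A \<Longrightarrow> adj_transpose A X h a = H_map X (G_obj A) h (adj_unit A a)"
  by (simp add: adj_transpose_def compose_eq)

lemma adj_transpose_pair:
  assumes "left_handed_noncommutative_frame A" "a \<in> carrier A"
  shows "adj_transpose A X (f, l) a
    = (preim X f (basic_open A a), l (basic_open A a) (basic_section A a))"
  using left_handed_noncommutative_frame.adj_unit_closed[OF assms]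
    left_handed_noncommutative_frame.adj_unit_apply[OF assms]
  by (simp add: adj_transpose_apply assms(2) H_map_apply)

lemma adj_transpose_hom:
  assumes A: "left_handed_noncommutative_frame A" and X: "sh_object X"
    and h: "h \<in> sh_hom X (G_obj A)"
  shows "adj_transpose A X h \<in> lnf_hom A (H_obj X)"
  unfolding adj_transpose_def
  by (rule lnf_hom_compose[OF A left_handed_noncommutative_frame.adj_unit_hom[OF A]
        H_map_hom[OF X left_handed_noncommutative_frame.sh_object_G[OF A] h]])

lemma germ_at_hom_basic:
  assumes A: "left_handed_noncommutative_frame A" and X: "sheaf_on_front X"
    and h: "(f, l) \<in> sh_hom X (G_obj A)"
    and V: "openin (front (pt_space A)) V" and s: "\<sigma> \<in> sections (G_obj A) V"
    and y: "y \<in> preim X f V" and a: "a \<in> carrier A" "f y \<in> basic_open A a"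
    and e: "\<sigma> (f y) = basic_section A a (f y)"
  shows "germ_at X (preim X f V) (l V \<sigma>) y
    = germ_at X (preim X f (basic_open A a)) (l (basic_open A a) (basic_section A a)) y"
proof -
  interpret A: left_handed_noncommutative_frame A by (rule A)
  interpret G: sh_object "G_obj A" by (rule A.sh_object_G)
  note Ua = A.openin_front_basic_open[OF a(1)] and sa = A.basic_section_in_sections[OF a(1)]
  have y': "y \<in> topspace (space X)" "f y \<in> V" using y by (simp_all add: mem_preim)
  have "germ_at (G_obj A) V \<sigma> (f y) = germ_at (G_obj A) (basic_open A a) (basic_section A a) (f y)"
    using A.germ_at_G_iff[OF V Ua s sa y'(2) a(2)] e by simp
  then show ?thesis
    using germ_at_hom[OF X G.sheaf_on_front_axioms h _ _ s sa y'] V Ua by simp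
qed

text \<open>
  Points are determined by the sets \<open>U\<^sub>a\<close> that contain them, so the preimages of these sets
  determine \<open>f\<close>. At \<open>y\<close> the germ of \<open>l V \<sigma>\<close> is that of \<open>l(s\<^sub>a)\<close> for any \<open>a\<close> such that \<open>s\<^sub>a\<close> represents
  \<open>\<sigma>\<close> at \<open>f y\<close>, so the sections \<open>l(s\<^sub>a)\<close> determine \<open>l\<close>.
\<close>
theorem adj_transpose_inj:
  assumes A: "left_handed_noncommutative_frame A" and X: "sheaf_on_front X"
    and h: "h \<in> sh_hom X (G_obj A)" and k: "k \<in> sh_hom X (G_obj A)"
    and e: "adj_transpose A X h = adj_transpose A X k"
  shows "h = k"
proof -
  interpret A: left_handed_noncommutative_frame A by (rule A)
  interpret X: sheaf_on_front X by (rule X)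
  obtain f l g m where hk: "h = (f, l)" "k = (g, m)" by (cases h; cases k)
  note h' = h[unfolded hk] and k' = k[unfolded hk]
  note hD = sh_homD[OF h'] and kD = sh_homD[OF k']
  have pre: "preim X f (basic_open A a) = preim X g (basic_open A a)"
    and sec: "l (basic_open A a) (basic_section A a) = m (basic_open A a) (basic_section A a)"
    if "a \<in> carrier A" for a
    using fun_cong[OF e, of a] that by (simp_all add: hk adj_transpose_pair[OF A])
  have pts: "f y \<in> points A" "g y \<in> points A" if "y \<in> topspace (space X)" for y
    using hD(1) kD(1) that by (auto simp: continuous_map_def A.topspace_pt_space)
  have fg: "f = g"
  proof (rule extensionalityI[OF hD(2) kD(2)])
    fix y assume y: "y \<in> topspace (space X)"
    show "f y = g y"
    proof (rule A.points_eqI[OF pts[OF y]])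
      fix a assume a: "a \<in> carrier A"
      have "f y \<in> basic_open A a \<longleftrightarrow> g y \<in> basic_open A a"
        using pre[OF a] y by (metis mem_preim)
      then show "f y (D_class A a) = g y (D_class A a)"
        using pts[OF y] by (simp add: A.mem_basic_open)
    qed
  qed
  have "l = m"
  proof (rule extensionalityI[OF hD(5) kD(5)])
    fix V assume "V \<in> {V. fopen (G_obj A) V}"
    then have V: "fopen (G_obj A) V" "openin (front (pt_space A)) V" by simp_all
    show "l V = m V"
    proof (rule extensionalityI[OF hD(6)[OF V(1)] kD(6)[OF V(1)]])
      fix \<sigma> assume s: "\<sigma> \<in> sections (G_obj A) V"
      show "l V \<sigma> = m V \<sigma>"
      proof (rule X.section_eqI)
        show "fopen X (preim X f V)" by (rule fopen_preim[OF hD(1) V(1)])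
        show "l V \<sigma> \<in> sections X (preim X f V)" by (rule hD(3)[OF V(1) s])
        show "m V \<sigma> \<in> sections X (preim X f V)" using kD(3)[OF V(1) s] by (simp add: fg)
        fix y assume y: "y \<in> preim X f V"
        then have fy: "f y \<in> V" by (simp add: mem_preim)
        obtain a N where a: "a \<in> carrier A" and N: "f y \<in> N" "N \<subseteq> basic_open A a"
          "\<And>q. q \<in> N \<Longrightarrow> \<sigma> q = basic_section A a q"
          using A.section_G_locally_basic[OF V(2) s fy] by metis
        have fa: "f y \<in> basic_open A a" and sa: "\<sigma> (f y) = basic_section A a (f y)"
          using N(1,2) N(3)[OF N(1)] by auto
        show "germ_at X (preim X f V) (l V \<sigma>) y = germ_at X (preim X f V) (m V \<sigma>) y"
          using germ_at_hom_basic[OF A X h' V(2) s y a fa sa]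
            germ_at_hom_basic[OF A X k'[folded fg] V(2) s y a fa sa] sec[OF a] by simp
      qed
    qed
  qed
  then show ?thesis using fg hk by simp
qed

text \<open>
  A supremum in \<open>H X\<close> is defined on the union of the domains, and members of the maximal class are
  defined everywhere; so the elements whose image is defined at \<open>y\<close> form a completely prime filter.
\<close>
lemma hom_completely_prime_filter:
  assumes A: "left_handed_noncommutative_frame A" and X: "sh_object X"
    and \<phi>: "\<phi> \<in> lnf_hom A (H_obj X)" and y: "y \<in> topspace (space X)"
  shows "completely_prime_filter A (\<lambda>a. y \<in> fst (\<phi> a))"
proof -
  interpret A: left_handed_noncommutative_frame A by (rule A)
  interpret X: sh_object X by (rule X)
  note D = lnf_homD[OF \<phi>]
  show ?thesis
    unfolding completely_prime_filter_def
  proof (intro conjI ballI allI impI; (elim conjE)?)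
    show "y \<in> fst (\<phi> (a \<curlywedge>\<^bsub>A\<^esub> b)) \<longleftrightarrow> y \<in> fst (\<phi> a) \<and> y \<in> fst (\<phi> b)"
      if "a \<in> carrier A" "b \<in> carrier A" for a b
      using that by (simp add: D(3))
    show "y \<notin> fst (\<phi> \<zero>\<^bsub>A\<^esub>)" by (simp add: D(5))
    show "y \<in> fst (\<phi> m)" if "m \<in> max_D_class A" for m
      using D(7)[OF that] y by (simp add: X.mem_max_D_class_H)
    fix S s assume S: "commuting_subset A S" and s: "is_supremum A s S"
    have "commuting_subset (H_obj X) (\<phi> ` S)"
      by (rule hom_commuting_image[OF A.skew_lattice_axioms D(2-4) S])
    then have "fst (\<phi> s) = (\<Union>x\<in>\<phi> ` S. fst x)"
      using D(6)[OF S s] X.H_supremum_iff by blast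
    then show "y \<in> fst (\<phi> s) \<longleftrightarrow> (\<exists>a\<in>S. y \<in> fst (\<phi> a))" by auto
  qed
qed

text \<open>
  At a point where \<open>\<phi> d\<close> is defined and \<open>\<phi> c\<close> is not, meeting with \<open>\<phi> d\<close> and overriding by \<open>\<phi> c\<close>
  change nothing, so \<open>\<phi> ((a \<curlywedge> d) \<curlyvee> c)\<close> still has the germ of \<open>\<phi> a\<close>.
\<close>
lemma hom_respects_germs:
  assumes A: "left_handed_noncommutative_frame A" and X: "sheaf_on_front X"
    and \<phi>: "\<phi> \<in> lnf_hom A (H_obj X)"
    and c: "a \<in> carrier A" "b \<in> carrier A" "c \<in> carrier A" "d \<in> carrier A"
    and y: "y \<in> fst (\<phi> d)" "y \<notin> fst (\<phi> c)"
    and e: "(a \<curlywedge>\<^bsub>A\<^esub> d) \<curlyvee>\<^bsub>A\<^esub> c = (b \<curlywedge>\<^bsub>A\<^esub> d) \<curlyvee>\<^bsub>A\<^esub> c"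
  shows "germ_map X (\<phi> a) y = germ_map X (\<phi> b) y"
proof -
  interpret A: left_handed_noncommutative_frame A by (rule A)
  interpret X: sheaf_on_front X by (rule X)
  note D = lnf_homD[OF \<phi>]
  have "germ_map X (\<phi> x) y = germ_map X (\<phi> ((x \<curlywedge>\<^bsub>A\<^esub> d) \<curlyvee>\<^bsub>A\<^esub> c)) y" if x: "x \<in> carrier A" for x
  proof -
    have "\<phi> ((x \<curlywedge>\<^bsub>A\<^esub> d) \<curlyvee>\<^bsub>A\<^esub> c) = (\<phi> x \<curlywedge>\<^bsub>H_obj X\<^esub> \<phi> d) \<curlyvee>\<^bsub>H_obj X\<^esub> \<phi> c"
      using x c by (simp add: D(3,4))
    then show ?thesis
      using X.germ_map_join_off[OF X.H_meet_closed[OF D(2)[OF x] D(2)[OF c(4)]] D(2)[OF c(3)] y(2)]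
        X.germ_map_meet_on[OF D(2)[OF x] D(2)[OF c(4)] y(1)] by simp
  qed
  then show ?thesis using c e by metis
qed

text \<open>
  The required morphism \<open>(f, l)\<close> is forced: \<open>f y\<close> has to be the filter of all \<open>a\<close> with \<open>\<phi> a\<close> defined
  at \<open>y\<close>, and \<open>l V \<sigma>\<close> must have at \<open>y\<close> the germ of \<open>\<phi> a\<close> whenever \<open>\<sigma>\<close> and \<open>s\<^sub>a\<close> agree at \<open>f y\<close>.
  That this germ does not depend on \<open>a\<close> is \<open>hom_respects_germs\<close>.
\<close>
theorem adj_transpose_surj:
  assumes A: "left_handed_noncommutative_frame A" and X: "sh_object X"
    and \<phi>: "\<phi> \<in> lnf_hom A (H_obj X)"
  shows "\<exists>h\<in>sh_hom X (G_obj A). adj_transpose A X h = \<phi>"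
proof -
  interpret A: left_handed_noncommutative_frame A by (rule A)
  interpret X: sh_object X by (rule X)
  note D = lnf_homD[OF \<phi>]
  note filter = hom_completely_prime_filter[OF A X \<phi>]
  define f where "f = (\<lambda>y\<in>topspace (space X). point_of A (\<lambda>a. y \<in> fst (\<phi> a)))"
  have f_basic: "f y \<in> basic_open A a \<longleftrightarrow> y \<in> fst (\<phi> a)"
    if "y \<in> topspace (space X)" "a \<in> carrier A" for y a
    using that A.point_of_in_points[OF filter] A.point_of_D_class[OF filter]
    by (simp add: f_def A.mem_basic_open)
  have pre: "preim X f (basic_open A a) = fst (\<phi> a)" if a: "a \<in> carrier A" for a
    using openin_subset[OF H_obj_D(1)[OF D(2)[OF a]]] f_basic[OF _ a] by (auto simp: mem_preim)
  have cont: "continuous_map (space X) (pt_space A) f"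
    unfolding continuous_map_def
  proof (intro conjI allI impI)
    show "f \<in> topspace (space X) \<rightarrow> topspace (pt_space A)"
      using A.point_of_in_points[OF filter] by (simp add: f_def A.topspace_pt_space)
    fix U assume "openin (pt_space A) U"
    then obtain a where "a \<in> carrier A" "U = basic_open A a" by (auto simp: A.openin_pt_space)
    then show "openin (space X) {y \<in> topspace (space X). f y \<in> U}"
      using pre[of a] H_obj_D(1)[OF D(2)] by (simp add: preim_def)
  qed
  have agree: "germ_map X (\<phi> a) y = germ_map X (\<phi> b) y"
    if ab: "a \<in> carrier A" "b \<in> carrier A" and y: "y \<in> topspace (space X)"
      and fy: "f y \<in> basic_open A a" "f y \<in> basic_open A b"
      and e: "basic_section A a (f y) = basic_section A b (f y)" for a b y
  proof -
    have "(a, b) \<in> germ_rel A (f y)" using A.basic_section_eq_iff[OF ab fy] e by simp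
    then obtain c d where cd: "c \<in> carrier A" "d \<in> carrier A" "\<not> f y (D_class A c)" "f y (D_class A d)"
      "(a \<curlywedge>\<^bsub>A\<^esub> d) \<curlyvee>\<^bsub>A\<^esub> c = (b \<curlywedge>\<^bsub>A\<^esub> d) \<curlyvee>\<^bsub>A\<^esub> c" by (elim A.germ_relE)
    have "y \<in> fst (\<phi> d)" "y \<notin> fst (\<phi> c)"
      using cd(3,4) fy(1) f_basic[OF y cd(1)] f_basic[OF y cd(2)] by (simp_all add: A.mem_basic_open)
    then show ?thesis
      by (rule hom_respects_germs[OF A X.sheaf_on_front_axioms \<phi> ab cd(1,2) _ _ cd(5)])
  qed
  \<comment> \<open>\<open>repr \<sigma> y a\<close>: the element \<open>a\<close> represents the germ of \<open>\<sigma>\<close> at \<open>f y\<close>. The value \<open>g \<sigma> y\<close> is computed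
     from an arbitrary representative; by \<open>agree\<close> every other one gives the same germ.\<close>
  define repr where "repr \<sigma> y a \<longleftrightarrow> a \<in> carrier A \<and> f y \<in> basic_open A a \<and>
      \<sigma> (f y) = basic_section A a (f y)" for \<sigma> y a
  define g where "g \<sigma> y = the (germ_map X (\<phi> (SOME a. repr \<sigma> y a)) y)" for \<sigma> y
  have g: "germ_at X (fst (\<phi> a)) (snd (\<phi> a)) y = g \<sigma> y" "y \<in> fst (\<phi> a)"
    if y: "y \<in> topspace (space X)" and a: "repr \<sigma> y a" for \<sigma> y a
  proof -
    let ?b = "SOME a. repr \<sigma> y a"
    have b: "repr \<sigma> y ?b" by (rule someI[of "repr \<sigma> y"]) (rule a)
    have "germ_map X (\<phi> a) y = germ_map X (\<phi> ?b) y"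
      using a b unfolding repr_def by (intro agree[OF _ _ y]) simp_all
    moreover show ya: "y \<in> fst (\<phi> a)" using a f_basic[OF y, of a] unfolding repr_def by blast
    ultimately show "germ_at X (fst (\<phi> a)) (snd (\<phi> a)) y = g \<sigma> y"
      unfolding g_def by (metis germ_map_def option.sel)
  qed
  have ex_repr: "\<exists>a N. a \<in> carrier A \<and> openin (front (pt_space A)) N \<and> f y \<in> N \<and> N \<subseteq> V \<and>
      (\<forall>z. f z \<in> N \<longrightarrow> repr \<sigma> z a)"
    if V: "openin (front (pt_space A)) V" and s: "\<sigma> \<in> sections (G_obj A) V" and fy: "f y \<in> V" for V \<sigma> y
  proof -
    obtain a N where "a \<in> carrier A" "openin (front (pt_space A)) N" "f y \<in> N" "N \<subseteq> V"
      "N \<subseteq> basic_open A a" "\<And>q. q \<in> N \<Longrightarrow> \<sigma> q = basic_section A a q"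
      using A.section_G_locally_basic[OF V s fy] by metis
    then show ?thesis unfolding repr_def by (intro exI[of _ a] exI[of _ N]) auto
  qed
  let ?P = "\<lambda>V \<sigma> s. s \<in> sections X (preim X f V) \<and>
      (\<forall>y\<in>preim X f V. germ_at X (preim X f V) s y = g \<sigma> y)"
  have ex1: "\<exists>!s. ?P V \<sigma> s"
    if V: "openin (front (pt_space A)) V" and s: "\<sigma> \<in> sections (G_obj A) V" for V \<sigma>
  proof (rule X.glue_germs)
    fix y assume "y \<in> preim X f V"
    then have y: "y \<in> topspace (space X)" "f y \<in> V" by (simp_all add: mem_preim)
    obtain a N where a: "a \<in> carrier A" and N: "openin (front (pt_space A)) N" "f y \<in> N" "N \<subseteq> V"
      and r: "\<And>z. f z \<in> N \<Longrightarrow> repr \<sigma> z a"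
      using ex_repr[OF V s y(2)] by (elim exE conjE) blast
    let ?W = "preim X f N"
    note xD = H_obj_D[OF D(2)[OF a]]
    have W: "fopen X ?W" using fopen_preim[of X "G_obj A" f N] cont N(1) by simp
    have sub: "?W \<subseteq> fst (\<phi> a)"
    proof
      show "z \<in> fst (\<phi> a)" if "z \<in> ?W" for z
        using that g(2)[of z \<sigma> a] r[of z] by (simp add: mem_preim)
    qed
    have "germ_at X ?W (restr X (fst (\<phi> a)) ?W (snd (\<phi> a))) z = g \<sigma> z" if "z \<in> ?W" for z
      using X.germ_at_restr[OF xD(2) W sub xD(3) that] g(1)[of z \<sigma> a] r[of z] that
      by (simp add: mem_preim)
    then show "\<exists>W t. fopen X W \<and> y \<in> W \<and> W \<subseteq> preim X f V \<and> t \<in> sections X W \<and>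
        (\<forall>z\<in>W. germ_at X W t z = g \<sigma> z)"
      using W y N X.restr_closed[OF xD(2) W sub xD(3)]
      by (intro exI[of _ ?W] exI[of _ "restr X (fst (\<phi> a)) ?W (snd (\<phi> a))"]) (auto simp: mem_preim)
  qed
  define l where "l = (\<lambda>V\<in>{V. fopen (G_obj A) V}. \<lambda>\<sigma>\<in>sections (G_obj A) V. THE s. ?P V \<sigma> s)"
  have l: "?P V \<sigma> (l V \<sigma>)"
    if V: "openin (front (pt_space A)) V" and s: "\<sigma> \<in> sections (G_obj A) V" for V \<sigma>
  proof -
    have "l V \<sigma> = (THE s. ?P V \<sigma> s)" using V s by (simp add: l_def)
    then show ?thesis using theI'[OF ex1[OF V s]] by simp
  qed
  have nat: "l V (restrict \<sigma> V) = restr X (preim X f U) (preim X f V) (l U \<sigma>)"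
    if U: "openin (front (pt_space A)) U" and V: "openin (front (pt_space A)) V" "V \<subseteq> U"
      and s: "\<sigma> \<in> sections (G_obj A) U" for U V \<sigma>
  proof -
    have s': "restrict \<sigma> V \<in> sections (G_obj A) V" by (rule A.section_G_restrict[OF U V s])
    have o: "fopen X (preim X f U)" "fopen X (preim X f V)"
      using fopen_preim[of X "G_obj A" f] cont U V(1) by simp_all
    have sub: "preim X f V \<subseteq> preim X f U" using V(2) by (auto simp: mem_preim)
    have lU: "l U \<sigma> \<in> sections X (preim X f U)" using l[OF U s] by simp
    show ?thesis
    proof (rule X.section_eqI[OF o(2)])
      show "l V (restrict \<sigma> V) \<in> sections X (preim X f V)" using l[OF V(1) s'] by simp
      show "restr X (preim X f U) (preim X f V) (l U \<sigma>) \<in> sections X (preim X f V)"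
        by (rule X.restr_closed[OF o sub lU])
      fix y assume y: "y \<in> preim X f V"
      then have y': "y \<in> topspace (space X)" "f y \<in> V" "f y \<in> U" using V(2) by (auto simp: mem_preim)
      have "repr (restrict \<sigma> V) y = repr \<sigma> y" using y'(2) by (simp add: repr_def fun_eq_iff)
      then have "g (restrict \<sigma> V) y = g \<sigma> y" by (simp add: g_def)
      then show "germ_at X (preim X f V) (l V (restrict \<sigma> V)) y
          = germ_at X (preim X f V) (restr X (preim X f U) (preim X f V) (l U \<sigma>)) y"
        using l[OF V(1) s'] l[OF U s] X.germ_at_restr[OF o sub lU y] y subsetD[OF sub y] by simp
    qed
  qed
  have h: "(f, l) \<in> sh_hom X (G_obj A)"
  proof (rule sh_homI)
    show "continuous_map (space X) (space (G_obj A)) f" using cont by simp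
    show "f \<in> extensional (topspace (space X))" by (simp add: f_def)
    show "l V s \<in> sections X (preim X f V)"
      if "fopen (G_obj A) V" "s \<in> sections (G_obj A) V" for V s
      using l[of V s] that by simp
    show "l V (restr (G_obj A) U V s) = restr X (preim X f U) (preim X f V) (l U s)"
      if "fopen (G_obj A) U" "fopen (G_obj A) V" "V \<subseteq> U" "s \<in> sections (G_obj A) U" for U V s
      using nat[of U V s] that by simp
  qed (simp_all add: l_def)
  have "adj_transpose A X (f, l) = \<phi>"
  proof (rule extensionalityI)
    show "adj_transpose A X (f, l) \<in> extensional (carrier A)" by (simp add: adj_transpose_def)
    show "\<phi> \<in> extensional (carrier A)" by (rule D(1))
    fix a assume a: "a \<in> carrier A"
    note xD = H_obj_D[OF D(2)[OF a]]
    note L = l[OF A.openin_front_basic_open[OF a] A.basic_section_in_sections[OF a], unfolded pre[OF a]]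
    have "l (basic_open A a) (basic_section A a) = snd (\<phi> a)"
    proof (rule X.section_eqI[OF xD(2) _ xD(3)])
      show "l (basic_open A a) (basic_section A a) \<in> sections X (fst (\<phi> a))" using L by simp
      fix y assume y: "y \<in> fst (\<phi> a)"
      have yt: "y \<in> topspace (space X)" using y openin_subset[OF xD(1)] by blast
      have "repr (basic_section A a) y a" using a y f_basic[OF yt a] by (simp add: repr_def)
      then show "germ_at X (fst (\<phi> a)) (l (basic_open A a) (basic_section A a)) y
          = germ_at X (fst (\<phi> a)) (snd (\<phi> a)) y"
        using g(1)[OF yt] L y by simp
    qed
    then show "adj_transpose A X (f, l) a = \<phi> a"
      by (simp add: adj_transpose_pair[OF A a] pre[OF a])
  qed
  then show ?thesis using h by blast
qed

theorem adj_transpose_bij: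
  assumes "left_handed_noncommutative_frame A" and "sh_object X"
  shows "bij_betw (adj_transpose A X) (sh_hom X (G_obj A)) (lnf_hom A (H_obj X))"
  unfolding bij_betw_def
proof
  have X: "sheaf_on_front X" using assms(2) by (rule sh_object.axioms(1))
  show "inj_on (adj_transpose A X) (sh_hom X (G_obj A))"
    by (rule inj_onI) (rule adj_transpose_inj[OF assms(1) X])
  show "adj_transpose A X ` sh_hom X (G_obj A) = lnf_hom A (H_obj X)"
    using adj_transpose_hom[OF assms] adj_transpose_surj[OF assms] by blast
qed

section \<open>The functor from noncommutative frames to sheaves\<close>

lemma pt_map_D_class:
  assumes A: "left_handed_noncommutative_frame A" and B: "left_handed_noncommutative_frame B"
    and \<phi>: "\<phi> \<in> lnf_hom A B" and q: "q \<in> points B" and a: "a \<in> carrier A"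
  shows "pt_map A B \<phi> q (D_class A a) = q (D_class B (\<phi> a))"
proof -
  interpret A: left_handed_noncommutative_frame A by (rule A)
  interpret B: left_handed_noncommutative_frame B by (rule B)
  note D = lnf_homD[OF \<phi>]
  have "D_class B (\<phi> b) = D_class B (\<phi> a)" if "b \<in> D_class A a" for b
  proof -
    have b: "b \<in> carrier A" "a \<curlywedge>\<^bsub>A\<^esub> b = a" "b \<curlywedge>\<^bsub>A\<^esub> a = b" using that by (simp_all add: A.mem_D_class_iff)
    then have "\<phi> a \<curlywedge>\<^bsub>B\<^esub> \<phi> b = \<phi> a" "\<phi> b \<curlywedge>\<^bsub>B\<^esub> \<phi> a = \<phi> b" using a by (simp_all flip: D(3))
    then show ?thesis using B.D_class_eq_iff[OF D(2)[OF b(1)] D(2)[OF a]] by simp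
  qed
  then have "(\<Union>b\<in>D_class A a. D_class B (\<phi> b)) = D_class B (\<phi> a)"
    using A.D_class_self[OF a] by blast
  then show ?thesis using q A.D_class_in_shadow[OF a] by (simp add: pt_map_def)
qed

text \<open>
  The definite description in \<^const>\<open>G_map\<close> is evaluated with the bijection for \<open>X = G B\<close>: the transpose
  of a pair \<open>(f, l)\<close> is the unit of \<open>B\<close> composed with \<open>\<phi>\<close> exactly if \<open>l\<close> maps \<open>s\<^sub>a\<close> to \<open>s\<^bsub>\<phi> a\<^esub>\<close> and the
  preimage of \<open>U\<^sub>a\<close> under \<open>f\<close> is \<open>U\<^bsub>\<phi> a\<^esub>\<close>, and the last condition says that \<open>f\<close> is composition with \<open>\<phi>\<close>.
\<close>
theorem G_map_spec:
  assumes A: "left_handed_noncommutative_frame A" and B: "left_handed_noncommutative_frame B"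
    and \<phi>: "\<phi> \<in> lnf_hom A B"
  shows "G_map A B \<phi> \<in> sh_hom (G_obj B) (G_obj A)"
    and "adj_transpose A (G_obj B) (G_map A B \<phi>) = compose (carrier A) (adj_unit B) \<phi>"
proof -
  interpret A: left_handed_noncommutative_frame A by (rule A)
  interpret B: left_handed_noncommutative_frame B by (rule B)
  interpret GB: sh_object "G_obj B" by (rule B.sh_object_G)
  note D = lnf_homD[OF \<phi>]
  have "compose (carrier A) (adj_unit B) \<phi> \<in> lnf_hom A (H_obj (G_obj B))"
    by (rule lnf_hom_compose[OF A \<phi> B.adj_unit_hom])
  then obtain f l where h: "(f, l) \<in> sh_hom (G_obj B) (G_obj A)"
    and tr: "adj_transpose A (G_obj B) (f, l) = compose (carrier A) (adj_unit B) \<phi>"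
    using adj_transpose_surj[OF A B.sh_object_G] by (metis surj_pair)
  note hD = sh_homD[OF h]
  have tr_a: "preim (G_obj B) f (basic_open A a) = basic_open B (\<phi> a)"
      "l (basic_open A a) (basic_section A a) = basic_section B (\<phi> a)" if a: "a \<in> carrier A" for a
    using fun_cong[OF tr, of a] a D(2)[OF a]
    by (simp_all add: adj_transpose_pair[OF A a] compose_eq B.adj_unit_apply)
  have f: "f = pt_map A B \<phi>"
  proof (rule extensionalityI)
    show "f \<in> extensional (points B)" using hD(2) by (simp add: B.topspace_pt_space)
    show "pt_map A B \<phi> \<in> extensional (points B)" by (simp add: pt_map_def)
    fix q assume q: "q \<in> points B"
    have fq: "f q \<in> points A"
      using hD(1) q by (auto simp: continuous_map_def A.topspace_pt_space B.topspace_pt_space)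
    show "f q = pt_map A B \<phi> q"
    proof (rule extensionalityI)
      show "f q \<in> extensional (carrier (shadow A))" using fq by (simp add: points_def)
      show "pt_map A B \<phi> q \<in> extensional (carrier (shadow A))" using q by (simp add: pt_map_def)
      fix P assume "P \<in> carrier (shadow A)"
      then obtain a where a: "a \<in> carrier A" "P = D_class A a" by (auto simp: A.carrier_shadow)
      have "f q (D_class A a) \<longleftrightarrow> q \<in> preim (G_obj B) f (basic_open A a)"
        using q fq by (simp add: mem_preim B.topspace_pt_space A.mem_basic_open)
      also have "\<dots> \<longleftrightarrow> q (D_class B (\<phi> a))" using q by (simp add: tr_a(1)[OF a(1)] B.mem_basic_open)
      finally show "f q P = pt_map A B \<phi> q P" using pt_map_D_class[OF A B \<phi> q a(1)] a(2) by simp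
    qed
  qed
  let ?R = "\<lambda>l. (pt_map A B \<phi>, l) \<in> sh_hom (G_obj B) (G_obj A) \<and>
       (\<forall>a\<in>carrier A. l (basic_open A a) (basic_section A a) = basic_section B (\<phi> a))"
  have "(THE l. ?R l) = l"
  proof (rule the_equality)
    show "?R l" using h tr_a(2) by (simp add: f)
    fix m assume m: "?R m"
    have "adj_transpose A (G_obj B) (pt_map A B \<phi>, m) = adj_transpose A (G_obj B) (pt_map A B \<phi>, l)"
    proof (rule extensionalityI)
      fix a assume a: "a \<in> carrier A"
      show "adj_transpose A (G_obj B) (pt_map A B \<phi>, m) a = adj_transpose A (G_obj B) (pt_map A B \<phi>, l) a"
        using m a by (simp add: adj_transpose_pair[OF A a] tr_a(2))
    qed (simp_all add: adj_transpose_def)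
    then have "(pt_map A B \<phi>, m) = (pt_map A B \<phi>, l)"
      using m h adj_transpose_inj[OF A GB.sheaf_on_front_axioms] unfolding f by blast
    then show "m = l" by simp
  qed
  then have G: "G_map A B \<phi> = (f, l)" unfolding G_map_def by (simp add: f)
  show "G_map A B \<phi> \<in> sh_hom (G_obj B) (G_obj A)" using h by (simp add: G)
  show "adj_transpose A (G_obj B) (G_map A B \<phi>) = compose (carrier A) (adj_unit B) \<phi>"
    using tr by (simp add: G)
qed

text \<open>
  Since transposition is injective, \<open>G \<phi>\<close> is recognised by its effect on the unit.
\<close>
lemma G_map_eqI:
  assumes A: "left_handed_noncommutative_frame A" and B: "left_handed_noncommutative_frame B"
    and \<phi>: "\<phi> \<in> lnf_hom A B" and h: "h \<in> sh_hom (G_obj B) (G_obj A)"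
    and tr: "\<And>a. a \<in> carrier A \<Longrightarrow> H_map (G_obj B) (G_obj A) h (adj_unit A a) = adj_unit B (\<phi> a)"
  shows "G_map A B \<phi> = h"
proof (rule adj_transpose_inj[OF A _ G_map_spec(1)[OF A B \<phi>] h])
  show "sheaf_on_front (G_obj B)"
    using left_handed_noncommutative_frame.sh_object_G[OF B] by (rule sh_object.axioms(1))
  show "adj_transpose A (G_obj B) (G_map A B \<phi>) = adj_transpose A (G_obj B) h"
    unfolding G_map_spec(2)[OF A B \<phi>]
  proof (rule extensionalityI)
    show "compose (carrier A) (adj_unit B) \<phi> a = adj_transpose A (G_obj B) h a" if "a \<in> carrier A" for a
      using that by (simp add: compose_eq adj_transpose_apply tr)
  qed (simp_all add: adj_transpose_def)
qed

lemma H_map_G_map: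
  assumes "left_handed_noncommutative_frame A" "left_handed_noncommutative_frame B"
    and "\<phi> \<in> lnf_hom A B" and a: "a \<in> carrier A"
  shows "H_map (G_obj B) (G_obj A) (G_map A B \<phi>) (adj_unit A a) = adj_unit B (\<phi> a)"
  using fun_cong[OF G_map_spec(2)[OF assms(1-3)], of a] a by (simp add: adj_transpose_apply compose_eq)

lemma G_map_id:
  assumes A: "left_handed_noncommutative_frame A"
  shows "G_map A A (lnf_id A) = sh_id (G_obj A)"
proof (rule G_map_eqI[OF A A lnf_id_hom[OF A]])
  have G: "sh_object (G_obj A)" by (rule left_handed_noncommutative_frame.sh_object_G[OF A])
  show "sh_id (G_obj A) \<in> sh_hom (G_obj A) (G_obj A)"
    by (rule sh_id_hom) (rule sh_object.axioms(1)[OF G])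
  show "H_map (G_obj A) (G_obj A) (sh_id (G_obj A)) (adj_unit A a) = adj_unit A (lnf_id A a)"
    if "a \<in> carrier A" for a
    using that left_handed_noncommutative_frame.adj_unit_closed[OF A that]
    by (simp add: H_map_id) (simp add: lnf_id_def)
qed

lemma G_map_comp:
  assumes A: "left_handed_noncommutative_frame A" and B: "left_handed_noncommutative_frame B"
    and C: "left_handed_noncommutative_frame C"
    and \<phi>: "\<phi> \<in> lnf_hom A B" and \<psi>: "\<psi> \<in> lnf_hom B C"
  shows "G_map A C (compose (carrier A) \<psi> \<phi>)
    = sh_comp (G_obj C) (G_obj B) (G_obj A) (G_map A B \<phi>) (G_map B C \<psi>)"
proof (rule G_map_eqI[OF A C lnf_hom_compose[OF A \<phi> \<psi>]])
  have G: "sh_object (G_obj A)" by (rule left_handed_noncommutative_frame.sh_object_G[OF A])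
  note g\<phi> = G_map_spec(1)[OF A B \<phi>] and g\<psi> = G_map_spec(1)[OF B C \<psi>]
  show "sh_comp (G_obj C) (G_obj B) (G_obj A) (G_map A B \<phi>) (G_map B C \<psi>)
      \<in> sh_hom (G_obj C) (G_obj A)"
    by (rule sh_comp_hom[OF sh_object.axioms(1)[OF G] g\<psi> g\<phi>])
  fix a assume a: "a \<in> carrier A"
  show "H_map (G_obj C) (G_obj A)
      (sh_comp (G_obj C) (G_obj B) (G_obj A) (G_map A B \<phi>) (G_map B C \<psi>)) (adj_unit A a)
    = adj_unit C (compose (carrier A) \<psi> \<phi> a)"
    using a left_handed_noncommutative_frame.adj_unit_closed[OF A a] lnf_homD(2)[OF \<phi> a]
    by (simp add: H_map_comp[OF g\<psi> g\<phi>] compose_eq H_map_G_map[OF A B \<phi>] H_map_G_map[OF B C \<psi>])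
qed

section \<open>The adjunction\<close>

lemma adj_transpose_natural_frame:
  assumes A: "left_handed_noncommutative_frame A" and B: "left_handed_noncommutative_frame B"
    and \<phi>: "\<phi> \<in> lnf_hom B A" and h: "h \<in> sh_hom X (G_obj A)"
  shows "adj_transpose B X (sh_comp X (G_obj A) (G_obj B) (G_map B A \<phi>) h)
    = compose (carrier B) (adj_transpose A X h) \<phi>"
proof (rule extensionalityI)
  fix b assume b: "b \<in> carrier B"
  show "adj_transpose B X (sh_comp X (G_obj A) (G_obj B) (G_map B A \<phi>) h) b
      = compose (carrier B) (adj_transpose A X h) \<phi> b"
    using b left_handed_noncommutative_frame.adj_unit_closed[OF B b] lnf_homD(2)[OF \<phi> b]
    by (simp add: adj_transpose_apply H_map_comp[OF h G_map_spec(1)[OF B A \<phi>]] compose_eq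
        H_map_G_map[OF B A \<phi>])
qed (simp_all add: adj_transpose_def)

lemma adj_transpose_natural_sheaf:
  assumes A: "left_handed_noncommutative_frame A"
    and k: "k \<in> sh_hom X' X" and h: "h \<in> sh_hom X (G_obj A)"
  shows "adj_transpose A X' (sh_comp X' X (G_obj A) h k)
    = compose (carrier A) (H_map X' X k) (adj_transpose A X h)"
proof (rule extensionalityI)
  fix a assume a: "a \<in> carrier A"
  show "adj_transpose A X' (sh_comp X' X (G_obj A) h k) a
      = compose (carrier A) (H_map X' X k) (adj_transpose A X h) a"
    using a left_handed_noncommutative_frame.adj_unit_closed[OF A a]
    by (simp add: adj_transpose_apply H_map_comp[OF k h] compose_eq)
qed (simp_all add: adj_transpose_def)

theorem theorem3p8:
  fixes A :: "'a skew" and A' :: "'b skew" and A'' :: "'c skew"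
    and X :: "('y, 's) fspace" and X' :: "('z, 't) fspace" and X'' :: "('w, 'u) fspace"
  assumes "left_handed_noncommutative_frame A" and "left_handed_noncommutative_frame A'"
    and "left_handed_noncommutative_frame A''"
    and "sh_object X" and "sh_object X'" and "sh_object X''"
  shows
    \<comment> \<open>\<open>G\<close> is a functor to the opposite category\<close>
    "sh_object (G_obj A) \<and>
     (\<forall>\<phi>\<in>lnf_hom A A'. G_map A A' \<phi> \<in> sh_hom (G_obj A') (G_obj A)) \<and>
     G_map A A (lnf_id A) = sh_id (G_obj A) \<and>
     (\<forall>\<phi>\<in>lnf_hom A A'. \<forall>\<psi>\<in>lnf_hom A' A''.
        G_map A A'' (compose (carrier A) \<psi> \<phi>)
          = sh_comp (G_obj A'') (G_obj A') (G_obj A) (G_map A A' \<phi>) (G_map A' A'' \<psi>)) \<and>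
     \<comment> \<open>\<open>H\<close> is a functor from the opposite category\<close>
     left_handed_noncommutative_frame (H_obj X) \<and>
     (\<forall>k\<in>sh_hom X X'. H_map X X' k \<in> lnf_hom (H_obj X') (H_obj X)) \<and>
     H_map X X (sh_id X) = lnf_id (H_obj X) \<and>
     (\<forall>k\<in>sh_hom X X'. \<forall>h\<in>sh_hom X' X''.
        H_map X X'' (sh_comp X X' X'' h k)
          = compose (carrier (H_obj X'')) (H_map X X' k) (H_map X' X'' h)) \<and>
     \<comment> \<open>the bijection\<close>
     bij_betw (adj_transpose A X) (sh_hom X (G_obj A)) (lnf_hom A (H_obj X)) \<and>
     \<comment> \<open>naturality in the frame\<close>
     (\<forall>\<phi>\<in>lnf_hom A' A. \<forall>h\<in>sh_hom X (G_obj A).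
        adj_transpose A' X (sh_comp X (G_obj A) (G_obj A') (G_map A' A \<phi>) h)
          = compose (carrier A') (adj_transpose A X h) \<phi>) \<and>
     \<comment> \<open>naturality in the sheaf\<close>
     (\<forall>k\<in>sh_hom X' X. \<forall>h\<in>sh_hom X (G_obj A).
        adj_transpose A X' (sh_comp X' X (G_obj A) h k)
          = compose (carrier A) (H_map X' X k) (adj_transpose A X h))"
proof (intro conjI ballI)
  show "sh_object (G_obj A)"
    by (rule left_handed_noncommutative_frame.sh_object_G[OF assms(1)])
  show "left_handed_noncommutative_frame (H_obj X)"
    by (rule sheaf_on_front.left_handed_noncommutative_frame_H[OF sh_object.axioms(1)[OF assms(4)]])
  show "bij_betw (adj_transpose A X) (sh_hom X (G_obj A)) (lnf_hom A (H_obj X))"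
    by (rule adj_transpose_bij[OF assms(1,4)])
  show "G_map A A' \<phi> \<in> sh_hom (G_obj A') (G_obj A)" if "\<phi> \<in> lnf_hom A A'" for \<phi>
    by (rule G_map_spec(1)[OF assms(1,2) that])
  show "G_map A A (lnf_id A) = sh_id (G_obj A)" by (rule G_map_id[OF assms(1)])
  show "G_map A A'' (compose (carrier A) \<psi> \<phi>)
      = sh_comp (G_obj A'') (G_obj A') (G_obj A) (G_map A A' \<phi>) (G_map A' A'' \<psi>)"
    if "\<phi> \<in> lnf_hom A A'" "\<psi> \<in> lnf_hom A' A''" for \<phi> \<psi>
    by (rule G_map_comp[OF assms(1-3) that])
  show "H_map X X' k \<in> lnf_hom (H_obj X') (H_obj X)" if "k \<in> sh_hom X X'" for k
    by (rule H_map_hom[OF assms(4,5) that])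
  show "H_map X X (sh_id X) = lnf_id (H_obj X)" by (rule H_map_id)
  show "H_map X X'' (sh_comp X X' X'' h k)
      = compose (carrier (H_obj X'')) (H_map X X' k) (H_map X' X'' h)"
    if "k \<in> sh_hom X X'" "h \<in> sh_hom X' X''" for k h
    by (rule H_map_comp[OF that])
  show "adj_transpose A' X (sh_comp X (G_obj A) (G_obj A') (G_map A' A \<phi>) h)
      = compose (carrier A') (adj_transpose A X h) \<phi>"
    if "\<phi> \<in> lnf_hom A' A" "h \<in> sh_hom X (G_obj A)" for \<phi> h
    by (rule adj_transpose_natural_frame[OF assms(1,2) that])
  show "adj_transpose A X' (sh_comp X' X (G_obj A) h k)
      = compose (carrier A) (H_map X' X k) (adj_transpose A X h)"
    if "k \<in> sh_hom X' X" "h \<in> sh_hom X (G_obj A)" for k h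
    by (rule adj_transpose_natural_sheaf[OF assms(1) that])
qed

end
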